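(* Let $n\ge1$ and let $\alpha=(\alpha_1,\dots,\alpha_n)$ with $\alpha_i>1/2$ for $i=1,\dots,n$. There is a constant $C_\alpha$ such that for every measurable function $f$ on $\mathbf R^n$ for which $|f|(\log(2+|f|))^{n-1}$ is integrable over $\mathbf R^n$ and every $\lambda>0$, $$\left|\left\{x\in\mathbf R^n:\mu_\alpha(f)(x)>\lambda\right\}\right|\le C_\alpha\int_{\mathbf R^n}\frac{|f(x)|}{\lambda}\left(\log\left(2+\frac{|f(x)|}{\lambda}\right)\right)^{n-1}dx .$$
   Context: $|\cdot|$ of a set denotes Lebesgue measure. For $a>0$ let $\varphi^{(a)}(x)=a\,|1-|x||^{a-1}(\chi_{[0,1]}(x)-\chi_{[-1,0]}(x))$ on $\mathbf R$ and $\varphi^{(a)}_s(x)=s^{-1}\varphi^{(a)}(x/s)$ for $s>0$. For $t=(t_1,\dots,t_n)$, $t_i>0$, put $\Phi_t^{(\alpha)}(x)=\prod_{i=1}^n\varphi^{(\alpha_i)}_{t_i}(x_i)$, $S_t^\alpha(f)(x)=f\star\Phi_t^{(\alpha)}(x)=\int f(x-y)\Phi_t^{(\alpha)}(y)\,dy$ and $$\mu_\alpha(f)(x)=\left(\int_0^\infty\cdots\int_0^\infty|S_t^\alpha(f)(x)|^2\,\frac{dt_1}{t_1}\cdots\frac{dt_n}{t_n}\right)^{1/2}.$$ *)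

theory Defs
  imports "HOL-Analysis.Analysis"
begin

(* Since 0 powr b = 0, the kernel takes the value 0 at x = 1 and x = -1 for every a; this is a
   null set, and phi is only ever used under an integral sign. *)
definition phi :: "real \<Rightarrow> real \<Rightarrow> real" where
  "phi a x = a * \<bar>1 - \<bar>x\<bar>\<bar> powr (a - 1) * (indicator {0..1} x - indicator {-1..0} x)"

definition phi_dil :: "real \<Rightarrow> real \<Rightarrow> real \<Rightarrow> real" where
  "phi_dil a s x = inverse s * phi a (x / s)"

definition Phi :: "real ^ 'n \<Rightarrow> real ^ 'n \<Rightarrow> real ^ 'n \<Rightarrow> real" where
  "Phi \<alpha> t x = (\<Prod>i\<in>UNIV. phi_dil (\<alpha> $ i) (t $ i) (x $ i))"

(* For integrable f, the integral converges absolutely for almost every (x, t). Where it does not,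
   the library convention gives the value 0. *)
definition S_op ::
  "real ^ 'n \<Rightarrow> real ^ 'n \<Rightarrow> (real ^ 'n \<Rightarrow> complex) \<Rightarrow> real ^ 'n \<Rightarrow> complex" where
  "S_op \<alpha> t f x = (LINT y|lebesgue. f (x - y) * complex_of_real (Phi \<alpha> t y))"

definition ennreal_sqrt :: "ennreal \<Rightarrow> ennreal" where
  "ennreal_sqrt u = (if u = \<infinity> then \<infinity> else ennreal (sqrt (enn2real u)))"

(* The n-fold iterated integral in t is taken as one integral over the positive orthant; the value
   may be infinite. *)
definition mu_op :: "real ^ 'n \<Rightarrow> (real ^ 'n \<Rightarrow> complex) \<Rightarrow> real ^ 'n \<Rightarrow> ennreal" where
  "mu_op \<alpha> f x = ennreal_sqrt
     (\<integral>\<^sup>+t\<in>{t. \<forall>i. 0 < t $ i}.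
        ennreal ((cmod (S_op \<alpha> t f x))\<^sup>2 / (\<Prod>i\<in>UNIV. t $ i)) \<partial>lebesgue)"

end

theory Submission
  imports Defs
begin

text \<open>The kernel is a product, so the square function arises by applying the one-dimensional
  transform \<open>F \<mapsto> (F \<star> \<phi>\<^sub>t)\<^sub>t\<close> in one variable after the other, each time to a function with values
  in an \<open>L\<^sup>2\<close> space over the dilation parameters already used, with measure \<open>dt / t\<close> for each.
  In one variable this transform is bounded on \<open>L\<^sup>2\<close> and of weak type (1,1), also for such vector
  valued functions, whence the measure of \<open>{|TF| > 1}\<close> is at most \<open>C \<integral> min(|F|, |F|\<^sup>2)\<close>. Inserting
  this bound, for \<open>F / s\<close>, into the layer cake formula for the integral of \<open>min(|TF|, |TF|\<^sup>2)\<close>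
  costs one logarithm, so \<open>n - 1\<close> variables produce \<open>L (log L)\<^sup>n\<^sup>-\<^sup>1\<close>, and for the last variable
  the level set estimate itself suffices.

  The \<open>L\<^sup>2\<close> bound needs no Fourier transform: \<open>\<phi>\<close> has mean zero and is Hoelder continuous in
  \<open>L\<^sup>1\<close>, hence \<open>\<phi>\<^sub>t\<close> and \<open>\<phi>\<^sub>s\<close> are almost orthogonal, and Schur's test applies to \<open>T T\<^sup>*\<close>. The weak
  type bound follows from a Calderon-Zygmund decomposition at height one and Hoermander's condition
  for the kernel \<open>x \<mapsto> (\<phi>\<^sub>t(x))\<^sub>t\<close> with values in \<open>L\<^sup>2(dt / t)\<close>; this is where \<open>\<alpha> > 1/2\<close> is needed,
  since it makes \<open>\<bar>1 - x\<bar>\<^bsup>\<alpha> - 1\<^esup>\<close> square integrable at the singularity.\<close>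

section \<open>Integral inequalities\<close>

text \<open>No Banach space valued integral occurs: a function with values in \<open>L^2(N)\<close>
  is a real function of two arguments \<open>x\<close> and \<open>w\<close>, its squared norm is a
  nonnegative integral over \<open>w\<close>, and the one-variable theorem has a constant
  independent of the sigma-finite measure \<open>N\<close>. It can therefore be applied on every
  line parallel to an axis.

  The gauge \<open>min(|F|, |F|^2)\<close> is forced by the iteration. With the weak type bound
  alone, the measure of \<open>{|TF| > s}\<close> is of order \<open>1 / s\<close>, and its integral
  diverges at both ends. With the gauge, large \<open>s\<close> profits from the \<open>L^2\<close>
  bound and small \<open>s\<close> from a weight \<open>min(s, 1)\<close>; what remains is
  \<open>1 < s < |F|\<close>, where the integral of \<open>1 / s\<close> is the logarithm.

  All level set estimates are made at height one and transferred by homogeneity. A persistent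
  obstacle is that a divergent integral has the value 0, so linearity and Fubini have to be backed
  by absolute convergence, which holds only almost everywhere; \<open>regular\<close> and
  \<open>abs_conv_on\<close> keep track of it.\<close>

lemma ennreal_sqrt_power2 [simp]: "(ennreal_sqrt u)\<^sup>2 = u"
  by (cases u) (auto simp: ennreal_sqrt_def ennreal_power power2_eq_square ennreal_top_mult simp flip: ennreal_mult)

lemma ennreal_power2_le_iff: "(a::ennreal)\<^sup>2 \<le> b\<^sup>2 \<longleftrightarrow> a \<le> b"
proof
  assume *: "a\<^sup>2 \<le> b\<^sup>2"
  show "a \<le> b"
  proof (cases a; cases b)
    fix r s assume "0 \<le> r" "a = ennreal r" "0 \<le> s" "b = ennreal s"
    with * show ?thesis
      by (auto simp: ennreal_power intro: power2_le_imp_le)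
  next
    fix s assume "a = top" "0 \<le> s" "b = ennreal s"
    with * show ?thesis by (simp add: ennreal_power power2_eq_square ennreal_top_mult top_unique flip: ennreal_mult)
  qed auto
qed (rule power_mono_ennreal)

lemma ennreal_sqrt_of_power2 [simp]: "ennreal_sqrt (u\<^sup>2) = u"
  by (rule antisym) (use ennreal_power2_le_iff[of "ennreal_sqrt (u\<^sup>2)" u]
    ennreal_power2_le_iff[of u "ennreal_sqrt (u\<^sup>2)"] in simp_all)

lemma ennreal_sqrt_le_iff [simp]: "ennreal_sqrt u \<le> ennreal_sqrt v \<longleftrightarrow> u \<le> v"
  using ennreal_power2_le_iff[of "ennreal_sqrt u" "ennreal_sqrt v"] by simp

lemma ennreal_sqrt_mult: "ennreal_sqrt (u * v) = ennreal_sqrt u * ennreal_sqrt v"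
  by (metis ennreal_sqrt_of_power2 ennreal_sqrt_power2 power_mult_distrib)

lemma measurable_ennreal_sqrt [measurable]: "ennreal_sqrt \<in> borel_measurable borel"
  unfolding ennreal_sqrt_def by (intro measurable_If) (auto intro!: borel_closed)

lemma ennreal_abs_power2: "(ennreal \<bar>r\<bar>)\<^sup>2 = ennreal (r\<^sup>2)"
  by (simp add: ennreal_power)

section \<open>Interchange of integrals, Minkowski's inequality, Schur's test\<close>

lemma nn_integral_swap:
  assumes "sigma_finite_measure M" "sigma_finite_measure N"
    and "(\<lambda>(x, y). f x y) \<in> borel_measurable (M \<Otimes>\<^sub>M N)"
  shows "(\<integral>\<^sup>+x. \<integral>\<^sup>+y. f x y \<partial>N \<partial>M) = (\<integral>\<^sup>+y. \<integral>\<^sup>+x. f x y \<partial>M \<partial>N)"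
proof -
  interpret pair_sigma_finite M N using assms by (simp add: pair_sigma_finite_def)
  show ?thesis using Fubini'[OF assms(3)] by simp
qed

lemma integral_swap:
  fixes f :: "'a \<Rightarrow> 'b \<Rightarrow> real"
  assumes "sigma_finite_measure M" "sigma_finite_measure N"
    and [measurable]: "(\<lambda>(x, y). f x y) \<in> borel_measurable (M \<Otimes>\<^sub>M N)"
    and "(\<integral>\<^sup>+x. \<integral>\<^sup>+y. ennreal \<bar>f x y\<bar> \<partial>N \<partial>M) < \<infinity>"
  shows "(LINT x|M. LINT y|N. f x y) = (LINT y|N. LINT x|M. f x y)"
proof -
  interpret pair_sigma_finite M N using assms by (simp add: pair_sigma_finite_def)
  have "integrable (M \<Otimes>\<^sub>M N) (\<lambda>(x, y). f x y)"
  proof (rule integrableI_bounded)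
    have "(\<integral>\<^sup>+z. ennreal (norm (case z of (x, y) \<Rightarrow> f x y)) \<partial>(M \<Otimes>\<^sub>M N)) =
        (\<integral>\<^sup>+x. \<integral>\<^sup>+y. ennreal \<bar>f x y\<bar> \<partial>N \<partial>M)"
      by (subst M2.nn_integral_fst[symmetric]) auto
    then show "(\<integral>\<^sup>+z. ennreal (norm (case z of (x, y) \<Rightarrow> f x y)) \<partial>(M \<Otimes>\<^sub>M N)) < \<infinity>"
      using assms(4) by simp
  qed simp
  from Fubini_integral[OF this] show ?thesis by simp
qed

lemma ennreal_abs_integral_le:
  fixes f :: "'a \<Rightarrow> real"
  shows "ennreal \<bar>integral\<^sup>L M f\<bar> \<le> (\<integral>\<^sup>+x. ennreal \<bar>f x\<bar> \<partial>M)"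
  using integral_norm_bound_ennreal[of M f] by (cases "integrable M f") (auto simp: not_integrable_integral_eq)

lemma Cauchy_Schwarz_nn_integral_sqrt:
  assumes "f \<in> borel_measurable M" "g \<in> borel_measurable M"
  shows "(\<integral>\<^sup>+x. f x * g x \<partial>M) \<le> ennreal_sqrt (\<integral>\<^sup>+x. (f x)\<^sup>2 \<partial>M) * ennreal_sqrt (\<integral>\<^sup>+x. (g x)\<^sup>2 \<partial>M)"
  by (subst ennreal_power2_le_iff[symmetric]) (simp add: power_mult_distrib Cauchy_Schwarz_nn_integral assms)

text \<open>The square of the inner integral is a double integral in \<open>y\<close> and
  \<open>z\<close>; Cauchy-Schwarz in \<open>p\<close> for each pair turns it into a product again.
  There is no division by a norm, so infinite values need no separate treatment.\<close>

lemma Minkowski_nn_integral: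
  fixes f :: "'a \<Rightarrow> 'b \<Rightarrow> ennreal"
  assumes M: "sigma_finite_measure M" and N: "sigma_finite_measure N"
    and f [measurable]: "(\<lambda>(y, p). f y p) \<in> borel_measurable (M \<Otimes>\<^sub>M N)"
  shows "(\<integral>\<^sup>+p. (\<integral>\<^sup>+y. f y p \<partial>M)\<^sup>2 \<partial>N) \<le> (\<integral>\<^sup>+y. ennreal_sqrt (\<integral>\<^sup>+p. (f y p)\<^sup>2 \<partial>N) \<partial>M)\<^sup>2"
proof -
  interpret M: sigma_finite_measure M by fact
  interpret N: sigma_finite_measure N by fact
  have f' [measurable]: "(\<lambda>(p, y). f y p) \<in> borel_measurable (N \<Otimes>\<^sub>M M)"
    by measurable
  let ?s = "\<lambda>y. ennreal_sqrt (\<integral>\<^sup>+p. (f y p)\<^sup>2 \<partial>N)"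
  have "(\<integral>\<^sup>+p. (\<integral>\<^sup>+y. f y p \<partial>M)\<^sup>2 \<partial>N) = (\<integral>\<^sup>+p. \<integral>\<^sup>+y. \<integral>\<^sup>+z. f y p * f z p \<partial>M \<partial>M \<partial>N)"
    by (intro nn_integral_cong) (simp add: nn_integral_cmult nn_integral_multc power2_eq_square)
  also have "\<dots> = (\<integral>\<^sup>+y. \<integral>\<^sup>+p. \<integral>\<^sup>+z. f y p * f z p \<partial>M \<partial>N \<partial>M)"
    by (intro nn_integral_swap M N) measurable
  also have "\<dots> = (\<integral>\<^sup>+y. \<integral>\<^sup>+z. \<integral>\<^sup>+p. f y p * f z p \<partial>N \<partial>M \<partial>M)"
    by (intro nn_integral_cong nn_integral_swap M N) measurable
  also have "\<dots> \<le> (\<integral>\<^sup>+y. \<integral>\<^sup>+z. ?s y * ?s z \<partial>M \<partial>M)"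
    by (intro nn_integral_mono Cauchy_Schwarz_nn_integral_sqrt) measurable
  also have "\<dots> = (\<integral>\<^sup>+y. ?s y \<partial>M)\<^sup>2"
    by (simp add: nn_integral_cmult nn_integral_multc power2_eq_square)
  finally show ?thesis .
qed

text \<open>Cauchy-Schwarz in \<open>y\<close> for \<open>ennreal_sqrt K\<close> times
  \<open>ennreal_sqrt K * g\<close> gives the row sum \<open>A1\<close>; integrating the remaining
  factor over \<open>p\<close> first gives the column sum \<open>A2\<close>.\<close>

lemma Schur_nn_integral:
  fixes K :: "'a \<Rightarrow> 'b \<Rightarrow> ennreal"
  assumes M: "sigma_finite_measure M" and N: "sigma_finite_measure N"
    and K [measurable]: "(\<lambda>(p, y). K p y) \<in> borel_measurable (M \<Otimes>\<^sub>M N)"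
    and g [measurable]: "g \<in> borel_measurable N"
    and A1: "\<And>p. p \<in> space M \<Longrightarrow> (\<integral>\<^sup>+y. K p y \<partial>N) \<le> A1"
    and A2: "\<And>y. y \<in> space N \<Longrightarrow> (\<integral>\<^sup>+p. K p y \<partial>M) \<le> A2"
  shows "(\<integral>\<^sup>+p. (\<integral>\<^sup>+y. K p y * g y \<partial>N)\<^sup>2 \<partial>M) \<le> A1 * A2 * (\<integral>\<^sup>+y. (g y)\<^sup>2 \<partial>N)"
proof -
  interpret M: sigma_finite_measure M by fact
  interpret N: sigma_finite_measure N by fact
  have "(\<integral>\<^sup>+p. (\<integral>\<^sup>+y. K p y * g y \<partial>N)\<^sup>2 \<partial>M) \<le> (\<integral>\<^sup>+p. A1 * (\<integral>\<^sup>+y. K p y * (g y)\<^sup>2 \<partial>N) \<partial>M)"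
  proof (rule nn_integral_mono)
    fix p assume p [measurable]: "p \<in> space M"
    have "(\<integral>\<^sup>+y. K p y * g y \<partial>N)\<^sup>2 = (\<integral>\<^sup>+y. ennreal_sqrt (K p y) * (ennreal_sqrt (K p y) * g y) \<partial>N)\<^sup>2"
      by (simp add: mult.assoc[symmetric] power2_eq_square[symmetric])
    also have "\<dots> \<le> (\<integral>\<^sup>+y. K p y \<partial>N) * (\<integral>\<^sup>+y. K p y * (g y)\<^sup>2 \<partial>N)"
      using Cauchy_Schwarz_nn_integral[of "\<lambda>y. ennreal_sqrt (K p y)" N "\<lambda>y. ennreal_sqrt (K p y) * g y"]
      by (simp add: power_mult_distrib)
    also have "\<dots> \<le> A1 * (\<integral>\<^sup>+y. K p y * (g y)\<^sup>2 \<partial>N)"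
      by (intro mult_right_mono A1 p) simp
    finally show "(\<integral>\<^sup>+y. K p y * g y \<partial>N)\<^sup>2 \<le> A1 * (\<integral>\<^sup>+y. K p y * (g y)\<^sup>2 \<partial>N)" .
  qed
  also have "\<dots> = A1 * (\<integral>\<^sup>+p. \<integral>\<^sup>+y. K p y * (g y)\<^sup>2 \<partial>N \<partial>M)"
    by (intro nn_integral_cmult) measurable
  also have "(\<integral>\<^sup>+p. \<integral>\<^sup>+y. K p y * (g y)\<^sup>2 \<partial>N \<partial>M) = (\<integral>\<^sup>+y. \<integral>\<^sup>+p. K p y * (g y)\<^sup>2 \<partial>M \<partial>N)"
    by (intro nn_integral_swap M N) measurable
  also have "\<dots> = (\<integral>\<^sup>+y. (\<integral>\<^sup>+p. K p y \<partial>M) * (g y)\<^sup>2 \<partial>N)"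
    by (intro nn_integral_cong nn_integral_multc) measurable
  also have "\<dots> \<le> (\<integral>\<^sup>+y. A2 * (g y)\<^sup>2 \<partial>N)"
    by (intro nn_integral_mono mult_right_mono A2) auto
  also have "\<dots> = A2 * (\<integral>\<^sup>+y. (g y)\<^sup>2 \<partial>N)"
    by (intro nn_integral_cmult) measurable
  finally show ?thesis by (simp add: mult_left_mono mult.assoc)
qed

text \<open>Schur's test with \<open>A1\<close> and \<open>A2\<close> makes
  \<open>F p * k p y * f y\<close> absolutely integrable in both variables, which is what moving the
  kernel from one side of the scalar product to the other requires. The lemma is applied to a kernel
  and to its transpose.\<close>

lemma square_integral_transpose:
  fixes M :: "'a measure" and N :: "'b measure" and k :: "'a \<Rightarrow> 'b \<Rightarrow> real" and f :: "'b \<Rightarrow> real" and A1 A2 :: real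
  defines "F \<equiv> (\<lambda>p. LINT y|N. k p y * f y)"
  assumes M: "sigma_finite_measure M" and N: "sigma_finite_measure N"
    and k [measurable]: "(\<lambda>(p, y). k p y) \<in> borel_measurable (M \<Otimes>\<^sub>M N)"
    and f [measurable]: "f \<in> borel_measurable N"
    and A1: "\<And>p. p \<in> space M \<Longrightarrow> (\<integral>\<^sup>+y. ennreal \<bar>k p y\<bar> \<partial>N) \<le> ennreal A1"
    and A2: "\<And>y. y \<in> space N \<Longrightarrow> (\<integral>\<^sup>+p. ennreal \<bar>k p y\<bar> \<partial>M) \<le> ennreal A2"
    and f2: "(\<integral>\<^sup>+y. ennreal ((f y)\<^sup>2) \<partial>N) < \<infinity>"
  shows "(\<integral>\<^sup>+p. ennreal ((F p)\<^sup>2) \<partial>M) < \<infinity>"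
    and "(\<integral>\<^sup>+p. ennreal ((F p)\<^sup>2) \<partial>M) \<le> (\<integral>\<^sup>+y. ennreal \<bar>f y\<bar> * ennreal \<bar>LINT p|M. k p y * F p\<bar> \<partial>N)"
proof -
  interpret M: sigma_finite_measure M by fact
  interpret N: sigma_finite_measure N by fact
  have [measurable]: "F \<in> borel_measurable M" unfolding F_def by measurable
  let ?G = "\<lambda>p. \<integral>\<^sup>+y. ennreal \<bar>k p y\<bar> * ennreal \<bar>f y\<bar> \<partial>N"
  have G2: "(\<integral>\<^sup>+p. (?G p)\<^sup>2 \<partial>M) < \<infinity>"
  proof -
    have "(\<integral>\<^sup>+p. (?G p)\<^sup>2 \<partial>M) \<le> ennreal A1 * ennreal A2 * (\<integral>\<^sup>+y. (ennreal \<bar>f y\<bar>)\<^sup>2 \<partial>N)"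
      by (intro Schur_nn_integral M N A1 A2) measurable
    also have "\<dots> < \<infinity>" using f2 by (simp add: ennreal_abs_power2 ennreal_mult_less_top)
    finally show ?thesis .
  qed
  have FG: "ennreal \<bar>F p\<bar> \<le> ?G p" for p
    unfolding F_def by (rule order_trans[OF ennreal_abs_integral_le]) (simp add: abs_mult ennreal_mult)
  have "(\<integral>\<^sup>+p. ennreal ((F p)\<^sup>2) \<partial>M) \<le> (\<integral>\<^sup>+p. (?G p)\<^sup>2 \<partial>M)"
    by (intro nn_integral_mono) (simp add: FG power_mono_ennreal flip: ennreal_abs_power2)
  with G2 show fin: "(\<integral>\<^sup>+p. ennreal ((F p)\<^sup>2) \<partial>M) < \<infinity>" by simp
  have FGfin: "(\<integral>\<^sup>+p. ennreal \<bar>F p\<bar> * ?G p \<partial>M) < \<infinity>"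
  proof -
    have "(\<integral>\<^sup>+p. ennreal \<bar>F p\<bar> * ?G p \<partial>M) \<le> (\<integral>\<^sup>+p. (?G p)\<^sup>2 \<partial>M)"
      by (intro nn_integral_mono) (simp add: FG power2_eq_square mult_right_mono)
    with G2 show ?thesis by simp
  qed
  have *: "(\<integral>\<^sup>+p. \<integral>\<^sup>+y. ennreal \<bar>F p * (k p y * f y)\<bar> \<partial>N \<partial>M) < \<infinity>"
  proof -
    have "(\<integral>\<^sup>+p. \<integral>\<^sup>+y. ennreal \<bar>F p * (k p y * f y)\<bar> \<partial>N \<partial>M) = (\<integral>\<^sup>+p. ennreal \<bar>F p\<bar> * ?G p \<partial>M)"
      by (intro nn_integral_cong) (simp add: abs_mult ennreal_mult nn_integral_cmult)
    with FGfin show ?thesis by simp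
  qed
  have "integrable M (\<lambda>p. (F p)\<^sup>2)"
    using fin by (intro integrableI_bounded) auto
  then have "(\<integral>\<^sup>+p. ennreal ((F p)\<^sup>2) \<partial>M) = ennreal (LINT p|M. (F p)\<^sup>2)"
    by (intro nn_integral_eq_integral) auto
  also have "(LINT p|M. (F p)\<^sup>2) = (LINT p|M. LINT y|N. F p * (k p y * f y))"
    by (simp add: F_def power2_eq_square)
  also have "\<dots> = (LINT y|N. LINT p|M. F p * (k p y * f y))"
    by (intro integral_swap M N *) measurable
  also have "\<dots> = (LINT y|N. f y * (LINT p|M. k p y * F p))"
    by (simp add: mult_ac flip: integral_mult_right_zero)
  also have "ennreal \<dots> \<le> ennreal \<bar>LINT y|N. f y * (LINT p|M. k p y * F p)\<bar>"
    by (intro ennreal_leI) simp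
  also have "\<dots> \<le> (\<integral>\<^sup>+y. ennreal \<bar>f y * (LINT p|M. k p y * F p)\<bar> \<partial>N)"
    by (rule ennreal_abs_integral_le)
  finally show "(\<integral>\<^sup>+p. ennreal ((F p)\<^sup>2) \<partial>M) \<le> (\<integral>\<^sup>+y. ennreal \<bar>f y\<bar> * ennreal \<bar>LINT p|M. k p y * F p\<bar> \<partial>N)"
    by (simp add: abs_mult ennreal_mult)
qed

text \<open>With \<open>T f(p) = \<integral> k(p, y) f(y) dy\<close> one has \<open>\<parallel>Tf\<parallel>\<^sup>2 = \<langle>f, T\<^sup>* T f\<rangle>\<close> and
  \<open>\<parallel>T\<^sup>* T f\<parallel>\<^sup>2 = \<langle>T f, T T\<^sup>* T f\<rangle> \<le> B \<parallel>T f\<parallel>\<^sup>2\<close>, by Schur's test for the kernel of \<open>T T\<^sup>*\<close>. The bounds \<open>A1\<close> and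
  \<open>A2\<close> only guarantee absolute convergence and do not enter the conclusion.\<close>

lemma TT_star_bound:
  fixes k :: "'a \<Rightarrow> 'b \<Rightarrow> real" and f :: "'b \<Rightarrow> real" and A1 A2 :: real
  assumes M: "sigma_finite_measure M" and N: "sigma_finite_measure N"
    and k [measurable]: "(\<lambda>(p, y). k p y) \<in> borel_measurable (M \<Otimes>\<^sub>M N)"
    and f [measurable]: "f \<in> borel_measurable N"
    and A1: "\<And>p. p \<in> space M \<Longrightarrow> (\<integral>\<^sup>+y. ennreal \<bar>k p y\<bar> \<partial>N) \<le> ennreal A1"
    and A2: "\<And>y. y \<in> space N \<Longrightarrow> (\<integral>\<^sup>+p. ennreal \<bar>k p y\<bar> \<partial>M) \<le> ennreal A2"
    and B: "\<And>p. p \<in> space M \<Longrightarrow> (\<integral>\<^sup>+q. ennreal \<bar>LINT y|N. k p y * k q y\<bar> \<partial>M) \<le> B"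
    and f2: "(\<integral>\<^sup>+y. ennreal ((f y)\<^sup>2) \<partial>N) < \<infinity>"
  shows "(\<integral>\<^sup>+p. ennreal ((LINT y|N. k p y * f y)\<^sup>2) \<partial>M) \<le> B * (\<integral>\<^sup>+y. ennreal ((f y)\<^sup>2) \<partial>N)"
proof -
  interpret M: sigma_finite_measure M by fact
  interpret N: sigma_finite_measure N by fact
  define F where "F = (\<lambda>p. LINT y|N. k p y * f y)"
  define G where "G = (\<lambda>y. LINT p|M. k p y * F p)"
  define K where "K = (\<lambda>p q. LINT y|N. k p y * k q y)"
  have [measurable]: "F \<in> borel_measurable M" unfolding F_def by measurable
  have [measurable]: "G \<in> borel_measurable N" unfolding G_def by measurable
  have [measurable]: "(\<lambda>(p, q). K p q) \<in> borel_measurable (M \<Otimes>\<^sub>M M)" unfolding K_def by measurable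
  define Q where "Q = (\<integral>\<^sup>+p. ennreal ((F p)\<^sup>2) \<partial>M)"
  have Qfin: "Q < \<infinity>" and QG: "Q \<le> (\<integral>\<^sup>+y. ennreal \<bar>f y\<bar> * ennreal \<bar>G y\<bar> \<partial>N)"
    unfolding Q_def G_def F_def
    using square_integral_transpose[OF M N k f A1 A2 f2] by simp_all
  have k': "(\<lambda>(y, p). k p y) \<in> borel_measurable (N \<Otimes>\<^sub>M M)" by measurable
  have Gfin: "(\<integral>\<^sup>+y. ennreal ((G y)\<^sup>2) \<partial>N) < \<infinity>"
    and GF: "(\<integral>\<^sup>+y. ennreal ((G y)\<^sup>2) \<partial>N) \<le> (\<integral>\<^sup>+p. ennreal \<bar>F p\<bar> * ennreal \<bar>LINT y|N. k p y * G y\<bar> \<partial>M)"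
    unfolding G_def
    using square_integral_transpose[OF N M k' \<open>F \<in> borel_measurable M\<close> A2 A1] Qfin by (simp_all add: Q_def)
  \<comment> \<open>Two more applications of Schur's test show that the version of
    \<open>T T* F\<close> with absolute values is finite almost everywhere; the interchange that
    produces \<open>K\<close> is justified at such \<open>p\<close>.\<close>
  let ?g = "\<lambda>y. \<integral>\<^sup>+q. ennreal \<bar>k q y\<bar> * ennreal \<bar>F q\<bar> \<partial>M"
  have "(\<integral>\<^sup>+y. (?g y)\<^sup>2 \<partial>N) \<le> ennreal A2 * ennreal A1 * (\<integral>\<^sup>+p. (ennreal \<bar>F p\<bar>)\<^sup>2 \<partial>M)"
    by (intro Schur_nn_integral M N A1 A2) measurable
  also have "\<dots> < \<infinity>" using Qfin by (simp add: ennreal_abs_power2 ennreal_mult_less_top Q_def)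
  finally have g2: "(\<integral>\<^sup>+y. (?g y)\<^sup>2 \<partial>N) < \<infinity>" .
  have "(\<integral>\<^sup>+p. (\<integral>\<^sup>+y. ennreal \<bar>k p y\<bar> * ?g y \<partial>N)\<^sup>2 \<partial>M) \<le> ennreal A1 * ennreal A2 * (\<integral>\<^sup>+y. (?g y)\<^sup>2 \<partial>N)"
    by (intro Schur_nn_integral M N A1 A2) measurable
  also have "\<dots> < \<infinity>" using g2 by (simp add: ennreal_mult_less_top)
  finally have "AE p in M. (\<integral>\<^sup>+y. ennreal \<bar>k p y\<bar> * ?g y \<partial>N)\<^sup>2 \<noteq> \<infinity>"
    by (intro nn_integral_PInf_AE) auto
  then have Kle: "AE p in M. ennreal \<bar>LINT y|N. k p y * G y\<bar> \<le> (\<integral>\<^sup>+q. ennreal \<bar>K p q\<bar> * ennreal \<bar>F q\<bar> \<partial>M)"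
  proof (rule AE_mp, intro AE_I2 impI)
    fix p assume [measurable]: "p \<in> space M" and *: "(\<integral>\<^sup>+y. ennreal \<bar>k p y\<bar> * ?g y \<partial>N)\<^sup>2 \<noteq> \<infinity>"
    have **: "(\<integral>\<^sup>+y. \<integral>\<^sup>+q. ennreal \<bar>k p y * (k q y * F q)\<bar> \<partial>M \<partial>N) < \<infinity>"
    proof -
      have "(\<integral>\<^sup>+y. \<integral>\<^sup>+q. ennreal \<bar>k p y * (k q y * F q)\<bar> \<partial>M \<partial>N) = (\<integral>\<^sup>+y. ennreal \<bar>k p y\<bar> * ?g y \<partial>N)"
        by (intro nn_integral_cong) (simp add: abs_mult ennreal_mult nn_integral_cmult)
      also have "\<dots> < \<infinity>"
        using * by (auto simp: power2_eq_square ennreal_mult_eq_top_iff top.not_eq_extremum)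
      finally show ?thesis .
    qed
    have "(LINT y|N. k p y * G y) = (LINT y|N. LINT q|M. k p y * (k q y * F q))"
      by (simp add: G_def)
    also have "\<dots> = (LINT q|M. LINT y|N. k p y * (k q y * F q))"
      by (intro integral_swap M N **) measurable
    also have "\<dots> = (LINT q|M. K p q * F q)"
      by (simp add: K_def mult.assoc flip: integral_mult_left_zero)
    finally show "ennreal \<bar>LINT y|N. k p y * G y\<bar> \<le> (\<integral>\<^sup>+q. ennreal \<bar>K p q\<bar> * ennreal \<bar>F q\<bar> \<partial>M)"
      using ennreal_abs_integral_le[of M "\<lambda>q. K p q * F q"] by (simp add: abs_mult ennreal_mult)
  qed
  have Ksym: "K p q = K q p" for p q unfolding K_def by (simp add: mult.commute)
  have amgm: "ennreal \<bar>u\<bar> * ennreal \<bar>v\<bar> * 2 \<le> ennreal (u\<^sup>2) + ennreal (v\<^sup>2)" for u v :: real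
    using sum_squares_bound[of "\<bar>u\<bar>" "\<bar>v\<bar>"]
    by (simp add: mult_ac ennreal_leI flip: ennreal_mult ennreal_plus ennreal_numeral)
  have FFK: "(\<integral>\<^sup>+p. \<integral>\<^sup>+q. ennreal ((F p)\<^sup>2) * ennreal \<bar>K p q\<bar> \<partial>M \<partial>M) \<le> B * Q"
  proof -
    have "(\<integral>\<^sup>+p. \<integral>\<^sup>+q. ennreal ((F p)\<^sup>2) * ennreal \<bar>K p q\<bar> \<partial>M \<partial>M) = (\<integral>\<^sup>+p. ennreal ((F p)\<^sup>2) * (\<integral>\<^sup>+q. ennreal \<bar>K p q\<bar> \<partial>M) \<partial>M)"
      by (intro nn_integral_cong nn_integral_cmult) measurable
    also have "\<dots> \<le> (\<integral>\<^sup>+p. ennreal ((F p)\<^sup>2) * B \<partial>M)"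
      using B by (intro nn_integral_mono mult_left_mono) (auto simp: K_def)
    also have "\<dots> = B * Q" unfolding Q_def by (subst nn_integral_multc) (auto simp: mult.commute)
    finally show ?thesis .
  qed
  \<comment> \<open>\<open>K\<close> is symmetric, so
    \<open>2 |F p| |F q| <= (F p)^2 + (F q)^2\<close> reduces the double integral to row sums. The
    factor 2 is kept on the left to avoid a division in \<open>ennreal\<close>.\<close>
  have "(\<integral>\<^sup>+y. ennreal ((G y)\<^sup>2) \<partial>N) * 2 \<le> (\<integral>\<^sup>+p. ennreal \<bar>F p\<bar> * (\<integral>\<^sup>+q. ennreal \<bar>K p q\<bar> * ennreal \<bar>F q\<bar> \<partial>M) \<partial>M) * 2"
  proof (intro mult_right_mono order_trans[OF GF] nn_integral_mono_AE)
    show "AE p in M. ennreal \<bar>F p\<bar> * ennreal \<bar>LINT y|N. k p y * G y\<bar> \<le> ennreal \<bar>F p\<bar> * (\<integral>\<^sup>+q. ennreal \<bar>K p q\<bar> * ennreal \<bar>F q\<bar> \<partial>M)"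
      using Kle by eventually_elim (rule mult_left_mono, auto)
  qed simp
  also have "\<dots> = (\<integral>\<^sup>+p. \<integral>\<^sup>+q. ennreal \<bar>K p q\<bar> * (ennreal \<bar>F p\<bar> * ennreal \<bar>F q\<bar> * 2) \<partial>M \<partial>M)"
    by (subst nn_integral_multc[symmetric])
      (auto intro!: nn_integral_cong simp: mult_ac simp flip: nn_integral_cmult)
  also have "\<dots> \<le> (\<integral>\<^sup>+p. \<integral>\<^sup>+q. ennreal \<bar>K p q\<bar> * (ennreal ((F p)\<^sup>2) + ennreal ((F q)\<^sup>2)) \<partial>M \<partial>M)"
    by (intro nn_integral_mono mult_left_mono amgm) simp
  also have "\<dots> = (\<integral>\<^sup>+p. \<integral>\<^sup>+q. ennreal ((F p)\<^sup>2) * ennreal \<bar>K p q\<bar> \<partial>M \<partial>M) + (\<integral>\<^sup>+p. \<integral>\<^sup>+q. ennreal ((F q)\<^sup>2) * ennreal \<bar>K p q\<bar> \<partial>M \<partial>M)"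
    by (subst nn_integral_add[symmetric])
      (auto intro!: nn_integral_cong simp: distrib_left mult.commute simp flip: nn_integral_add)
  also have "(\<integral>\<^sup>+p. \<integral>\<^sup>+q. ennreal ((F q)\<^sup>2) * ennreal \<bar>K p q\<bar> \<partial>M \<partial>M) = (\<integral>\<^sup>+q. \<integral>\<^sup>+p. ennreal ((F q)\<^sup>2) * ennreal \<bar>K p q\<bar> \<partial>M \<partial>M)"
    by (intro nn_integral_swap M) measurable
  also have "\<dots> = (\<integral>\<^sup>+p. \<integral>\<^sup>+q. ennreal ((F p)\<^sup>2) * ennreal \<bar>K p q\<bar> \<partial>M \<partial>M)"
    by (simp add: Ksym)
  also have "(\<integral>\<^sup>+p. \<integral>\<^sup>+q. ennreal ((F p)\<^sup>2) * ennreal \<bar>K p q\<bar> \<partial>M \<partial>M) + (\<integral>\<^sup>+p. \<integral>\<^sup>+q. ennreal ((F p)\<^sup>2) * ennreal \<bar>K p q\<bar> \<partial>M \<partial>M) \<le> B * Q * 2"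
    using FFK by (simp add: mult_2_right add_mono)
  finally have G2: "(\<integral>\<^sup>+y. ennreal ((G y)\<^sup>2) \<partial>N) \<le> B * Q"
    by (simp add: ennreal_mult_le_mult_iff mult.commute[of _ 2])
  have "Q\<^sup>2 \<le> (\<integral>\<^sup>+y. ennreal \<bar>f y\<bar> * ennreal \<bar>G y\<bar> \<partial>N)\<^sup>2"
    using QG by (rule power_mono_ennreal)
  also have "\<dots> \<le> (\<integral>\<^sup>+y. ennreal ((f y)\<^sup>2) \<partial>N) * (\<integral>\<^sup>+y. ennreal ((G y)\<^sup>2) \<partial>N)"
    using Cauchy_Schwarz_nn_integral[of "\<lambda>y. ennreal \<bar>f y\<bar>" N "\<lambda>y. ennreal \<bar>G y\<bar>"]
    by (simp add: ennreal_abs_power2)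
  also have "\<dots> \<le> (\<integral>\<^sup>+y. ennreal ((f y)\<^sup>2) \<partial>N) * (B * Q)"
    by (intro mult_left_mono G2) simp
  finally have le: "Q * Q \<le> Q * (B * (\<integral>\<^sup>+y. ennreal ((f y)\<^sup>2) \<partial>N))"
    by (simp add: power2_eq_square mult_ac)
  show ?thesis
  proof (cases "Q = 0")
    case True then show ?thesis by (simp add: Q_def F_def)
  next
    case False
    \<comment> \<open>Cancelling \<open>Q\<close> requires \<open>Q < \<infinity>\<close>: here the
      qualitative information from \<open>A1\<close> and \<open>A2\<close> enters.\<close>
    with le Qfin have "Q \<le> B * (\<integral>\<^sup>+y. ennreal ((f y)\<^sup>2) \<partial>N)"
      by (subst (asm) ennreal_mult_le_mult_iff) auto
    then show ?thesis by (simp add: Q_def F_def)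
  qed
qed

section \<open>The one-dimensional kernel\<close>

text \<open>The right half of \<open>phi\<close>. With the open interval,
  \<open>phi a x = psi a x - psi a (- x)\<close> holds at every point: at 0 the two indicators in
  \<open>phi\<close> cancel, and at 1 and -1 the power is 0.\<close>

definition psi :: "real \<Rightarrow> real \<Rightarrow> real" where
  "psi a x = a * (1 - x) powr (a - 1) * indicator {0<..<1} x"

lemma phi_eq_psi: "phi a x = psi a x - psi a (- x)"
  by (auto simp: phi_def psi_def indicator_def abs_if)

lemma measurable_psi [measurable]: "psi a \<in> borel_measurable borel"
  unfolding psi_def by measurable

lemma measurable_phi [measurable]: "phi a \<in> borel_measurable borel"
  unfolding phi_def by measurable

lemma measurable_phi_dil [measurable (raw)]:
  assumes [measurable]: "f \<in> borel_measurable M" "g \<in> borel_measurable M"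
  shows "(\<lambda>x. phi_dil a (f x) (g x)) \<in> borel_measurable M"
  unfolding phi_dil_def by measurable

lemma psi_nonneg: "a \<ge> 0 \<Longrightarrow> psi a x \<ge> 0"
  by (simp add: psi_def)

lemma nn_integral_powr_from_0:
  assumes "b > -1" "c \<ge> 0"
  shows "(\<integral>\<^sup>+x. ennreal (x powr b * indicator {0..c} x) \<partial>lborel) = ennreal (c powr (b + 1) / (b + 1))"
proof -
  have "(\<integral>\<^sup>+x. ennreal (indicator {0..c} x * x powr b) \<partial>lborel) = ennreal (c powr (b + 1) / (b + 1))"
    using has_integral_powr_from_0[OF assms]
    by (intro nn_integral_has_integral_lebesgue) auto
  then show ?thesis by (simp add: mult.commute)
qed

lemma nn_integral_powr_at_top:
  assumes "b > 1" "c > 0"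
  shows "(\<integral>\<^sup>+x. ennreal (x powr (- b)) * indicator {c..} x \<partial>lborel) = ennreal (c powr (1 - b) / (b - 1))"
proof -
  have "(\<integral>\<^sup>+x. ennreal (x powr (- b)) * indicator {c..} x \<partial>lborel) = ennreal (0 - (c powr (1 - b) / (1 - b)))"
  proof (rule nn_integral_FTC_atLeast)
    show "((\<lambda>x. x powr (1 - b) / (1 - b)) has_real_derivative x powr (- b)) (at x)" if "c \<le> x" for x
      using that assms by (auto intro!: derivative_eq_intros)
    have "((\<lambda>x. x powr (1 - b)) \<longlongrightarrow> 0) at_top"
      using assms by (intro tendsto_neg_powr filterlim_ident) auto
    then show "((\<lambda>x. x powr (1 - b) / (1 - b)) \<longlongrightarrow> 0) at_top"
      by (rule tendsto_divide_zero)
  qed auto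
  also have "0 - (c powr (1 - b) / (1 - b)) = c powr (1 - b) / (b - 1)"
    using assms by (simp add: field_simps)
  finally show ?thesis .
qed

text \<open>The reflection \<open>x -> 1 - x\<close> moves the singularity at 1 to the origin, where
  \<open>a * x powr (a - 1)\<close> has the primitive \<open>x powr a\<close>. The tail is the cost
  of a translation by \<open>h\<close> when \<open>a <= 1\<close>; \<open>h = 1\<close> gives total
  mass one.\<close>

lemma nn_integral_psi_tail:
  assumes "a > 0" "0 \<le> h" "h \<le> 1"
  shows "(\<integral>\<^sup>+x. ennreal (psi a x) * indicator {1 - h..} x \<partial>lborel) = ennreal (h powr a)"
proof -
  have "(\<integral>\<^sup>+x. ennreal (psi a x) * indicator {1 - h..} x \<partial>lborel) =
      (\<integral>\<^sup>+x. ennreal (psi a (1 - x)) * indicator {1 - h..} (1 - x) \<partial>lborel)"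
    by (subst nn_integral_real_affine[where c = "-1" and t = 1]) auto
  also have "\<dots> = (\<integral>\<^sup>+x. ennreal a * ennreal (x powr (a - 1) * indicator {0..h} x) \<partial>lborel)"
  proof (rule nn_integral_cong_AE)
    have "AE x in lborel. x \<noteq> (1::real)" "AE x in lborel. x \<noteq> (0::real)" by (rule AE_lborel_singleton)+
    then show "AE x in lborel. ennreal (psi a (1 - x)) * indicator {1 - h..} (1 - x) = ennreal a * ennreal (x powr (a - 1) * indicator {0..h} x)"
      by eventually_elim (use assms in \<open>auto simp: psi_def indicator_def ennreal_mult\<close>)
  qed
  also have "\<dots> = ennreal a * ennreal (h powr a / a)"
    using nn_integral_powr_from_0[of "a - 1" h] assms by (subst nn_integral_cmult) auto
  also have "\<dots> = ennreal (h powr a)" using assms by (simp flip: ennreal_mult)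
  finally show ?thesis .
qed

lemma nn_integral_psi: "a > 0 \<Longrightarrow> (\<integral>\<^sup>+x. ennreal (psi a x) \<partial>lborel) = 1"
proof -
  assume a: "a > 0"
  have "(\<integral>\<^sup>+x. ennreal (psi a x) \<partial>lborel) = (\<integral>\<^sup>+x. ennreal (psi a x) * indicator {1 - 1..} x \<partial>lborel)"
    by (intro nn_integral_cong) (auto simp: psi_def indicator_def)
  also have "\<dots> = 1" using a by (subst nn_integral_psi_tail) auto
  finally show ?thesis .
qed

lemma nn_integral_reflect:
  assumes [measurable]: "f \<in> borel_measurable borel"
  shows "(\<integral>\<^sup>+x. f (c - x :: real) \<partial>lborel) = (\<integral>\<^sup>+x. f x \<partial>lborel)"
  by (subst (2) nn_integral_real_affine[where c = "-1" and t = c]) auto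

lemma nn_integral_shift:
  assumes [measurable]: "f \<in> borel_measurable borel"
  shows "(\<integral>\<^sup>+x. f (x + c :: real) \<partial>lborel) = (\<integral>\<^sup>+x. f x \<partial>lborel)"
  by (subst (2) nn_integral_real_affine[where c = 1 and t = c]) (auto simp: add.commute)

lemma nn_integral_phi_le:
  assumes "a > 0"
  shows "(\<integral>\<^sup>+x. ennreal \<bar>phi a x\<bar> \<partial>lborel) \<le> 2"
proof -
  have "(\<integral>\<^sup>+x. ennreal \<bar>phi a x\<bar> \<partial>lborel) \<le> (\<integral>\<^sup>+x. ennreal (psi a x) + ennreal (psi a (0 - x)) \<partial>lborel)"
  proof (rule nn_integral_mono)
    fix x
    show "ennreal \<bar>phi a x\<bar> \<le> ennreal (psi a x) + ennreal (psi a (0 - x))"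
      using psi_nonneg[of a x] psi_nonneg[of a "- x"] assms
      by (simp add: phi_eq_psi ennreal_leI flip: ennreal_plus)
  qed
  also have "\<dots> = 2"
    using assms nn_integral_reflect[of "\<lambda>x. ennreal (psi a x)" 0] by (simp add: nn_integral_add nn_integral_psi)
  finally show ?thesis .
qed

text \<open>No sign of \<open>t\<close> is assumed: the substitution produces \<open>|t|\<close>,
  which cancels \<open>|inverse t|\<close>, and at \<open>t = 0\<close> the dilated kernel vanishes
  because \<open>inverse 0 = 0\<close>. The bound is thus available under any integral in
  \<open>t\<close>.\<close>

lemma nn_integral_phi_dil_le:
  assumes "a > 0"
  shows "(\<integral>\<^sup>+x. ennreal \<bar>phi_dil a t x\<bar> \<partial>lborel) \<le> 2"
proof (cases "t = 0")
  case False
  have "(\<integral>\<^sup>+x. ennreal \<bar>phi_dil a t x\<bar> \<partial>lborel) = ennreal \<bar>t\<bar> * (\<integral>\<^sup>+x. ennreal \<bar>phi_dil a t (0 + t * x)\<bar> \<partial>lborel)"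
    using False by (intro nn_integral_real_affine) auto
  also have "\<dots> = (\<integral>\<^sup>+x. ennreal \<bar>phi a x\<bar> \<partial>lborel)"
    using False by (subst nn_integral_cmult[symmetric]) (auto simp: phi_dil_def abs_mult mult.assoc[symmetric] simp flip: ennreal_mult)
  finally show ?thesis using nn_integral_phi_le[OF assms] by simp
qed (simp add: phi_dil_def)

lemma phi_minus: "phi a (- x) = - phi a x"
  by (simp add: phi_eq_psi)

lemma phi_dil_minus: "phi_dil a t (- x) = - phi_dil a t x"
  by (simp add: phi_dil_def phi_minus)

lemma phi_dil_eq_0: "t < \<bar>x\<bar> \<Longrightarrow> 0 < t \<Longrightarrow> phi_dil a t x = 0"
  by (auto simp: phi_dil_def phi_def indicator_def field_simps abs_if split: if_splits)

lemma integrable_phi_dil: "a > 0 \<Longrightarrow> integrable lborel (phi_dil a t)"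
  using nn_integral_phi_dil_le[of a t] by (intro integrableI_bounded) (auto simp: le_less_trans)

lemma integral_phi_dil: "(LINT x|lborel. phi_dil a t x) = 0"
proof -
  have "(LINT x|lborel. phi_dil a t x) = (LINT x|lborel. phi_dil a t (0 + (-1) * x))"
    by (subst lborel_integral_real_affine[where c = "-1" and t = 0]) auto
  then show ?thesis by (simp add: phi_dil_minus)
qed

text \<open>Integrals of absolute differences are estimated below after adding a known finite mass
  \<open>p\<close>, which converts them into one-sided terms; this removes \<open>p\<close>
  again.\<close>

lemma ennreal_add_le_cancel:
  assumes "X + ennreal p \<le> ennreal q" "0 \<le> p"
  shows "X \<le> ennreal (q - p)"
proof (cases X)
  case (real r)
  with assms have "ennreal (r + p) \<le> ennreal q" by simp
  then have "r + p \<le> q \<or> r + p \<le> 0"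
    using real assms by (cases "q \<ge> 0") (auto simp: ennreal_neg simp del: ennreal_plus)
  then consider "r \<le> q - p" | "r = 0" using real assms by linarith
  then show ?thesis by cases (auto simp: real ennreal_leI)
qed (use assms in \<open>simp add: top_unique\<close>)

text \<open>Where \<open>psi a\<close> is monotone, the integral of \<open>\<bar>psi a (x + h) - psi a x\<bar>\<close> telescopes; only the
  jump at an end point of the support has to be paid for.\<close>

lemma nn_integral_psi_diff_le_1:
  assumes "0 < a" "a \<le> 1" "0 \<le> h" "h \<le> 1"
  shows "(\<integral>\<^sup>+x. ennreal \<bar>psi a (x + h) - psi a x\<bar> \<partial>lborel) \<le> ennreal (2 * h powr a)"
proof -
  have "(\<integral>\<^sup>+x. ennreal \<bar>psi a (x + h) - psi a x\<bar> \<partial>lborel) + ennreal 1 =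
      (\<integral>\<^sup>+x. ennreal \<bar>psi a (x + h) - psi a x\<bar> + ennreal (psi a x) \<partial>lborel)"
    using assms by (simp add: nn_integral_add nn_integral_psi)
  also have "\<dots> \<le> (\<integral>\<^sup>+x. ennreal (psi a (x + h)) + 2 * (ennreal (psi a x) * indicator {1 - h..} x) \<partial>lborel)"
  proof (rule nn_integral_mono)
    fix x :: real
    have "\<bar>psi a (x + h) - psi a x\<bar> + psi a x \<le> psi a (x + h) + 2 * (psi a x * indicator {1 - h..} x)"
    proof (cases "0 < x \<and> x + h < 1")
      case True
      then have "psi a x \<le> psi a (x + h)"
        using assms by (auto simp: psi_def intro!: mult_left_mono powr_mono2')
      then show ?thesis using True by (simp add: indicator_def)
    next
      case False
      then consider "x \<le> 0" | "x + h \<ge> 1" by linarith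
      then show ?thesis
        by cases (use assms in \<open>auto simp: psi_def indicator_def\<close>)
    qed
    then show "ennreal \<bar>psi a (x + h) - psi a x\<bar> + ennreal (psi a x) \<le> ennreal (psi a (x + h)) + 2 * (ennreal (psi a x) * indicator {1 - h..} x)"
      using psi_nonneg[of a] assms
      by (auto simp: indicator_def ennreal_leI simp flip: ennreal_plus ennreal_mult ennreal_numeral split: if_splits)
  qed
  also have "\<dots> = ennreal (1 + 2 * h powr a)"
    using assms nn_integral_shift[of "\<lambda>x. ennreal (psi a x)" h]
    by (simp add: nn_integral_add nn_integral_psi nn_integral_cmult nn_integral_psi_tail ennreal_mult)
  finally show ?thesis by (rule order_trans[OF ennreal_add_le_cancel]) auto
qed

text \<open>The monotonicity is reversed: for \<open>a >= 1\<close> the function decreases on the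
  unit interval, and the jump to be paid for is the one at 0, of height \<open>a\<close>, seen on an
  interval of length \<open>h\<close>.\<close>

lemma nn_integral_psi_diff_ge_1:
  assumes "1 \<le> a" "0 \<le> h"
  shows "(\<integral>\<^sup>+x. ennreal \<bar>psi a (x + h) - psi a x\<bar> \<partial>lborel) \<le> ennreal (2 * a * h)"
proof -
  have "(\<integral>\<^sup>+x. ennreal \<bar>psi a (x + h) - psi a x\<bar> \<partial>lborel) + ennreal 1 =
      (\<integral>\<^sup>+x. ennreal \<bar>psi a (x + h) - psi a x\<bar> + ennreal (psi a (x + h)) \<partial>lborel)"
    using assms nn_integral_shift[of "\<lambda>x. ennreal (psi a x)" h] by (simp add: nn_integral_add nn_integral_psi)
  also have "\<dots> \<le> (\<integral>\<^sup>+x. ennreal (psi a x) + ennreal (2 * a) * indicator {-h..0} x \<partial>lborel)"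
  proof (rule nn_integral_mono)
    fix x :: real
    have "\<bar>psi a (x + h) - psi a x\<bar> + psi a (x + h) \<le> psi a x + 2 * a * indicator {-h..0} x"
    proof (cases "0 < x")
      case True
      then have "psi a (x + h) \<le> psi a x"
        using assms by (auto simp: psi_def indicator_def intro!: mult_left_mono powr_mono2)
      then show ?thesis using True by (simp add: indicator_def)
    next
      case False
      have "psi a (x + h) \<le> a * indicator {-h..0} x"
        using False assms by (auto simp: psi_def indicator_def powr_le1)
      then show ?thesis
        using False psi_nonneg[of a "x + h"] assms by (auto simp: psi_def indicator_def)
    qed
    then show "ennreal \<bar>psi a (x + h) - psi a x\<bar> + ennreal (psi a (x + h)) \<le> ennreal (psi a x) + ennreal (2 * a) * indicator {-h..0} x"
      using psi_nonneg[of a] assms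
      by (auto simp: indicator_def ennreal_leI simp flip: ennreal_plus split: if_splits)
  qed
  also have "\<dots> = ennreal (1 + 2 * a * h)"
    using assms by (simp add: nn_integral_add nn_integral_psi nn_integral_cmult_indicator flip: ennreal_mult)
  finally show ?thesis by (rule order_trans[OF ennreal_add_le_cancel]) auto
qed

text \<open>The exponent \<open>min a 1\<close> records the two obstructions to smoothness, the
  singularity at 1 (giving \<open>h powr a\<close>) and the jump at 0 (giving \<open>h\<close>). For
  \<open>h > 1\<close> it is enough that both translates have mass one.\<close>

lemma nn_integral_psi_diff:
  assumes a: "0 < a" and h: "0 \<le> h"
  shows "(\<integral>\<^sup>+x. ennreal \<bar>psi a (x + h) - psi a x\<bar> \<partial>lborel) \<le> ennreal (2 * (a + 1) * h powr (min a 1))"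
proof (cases "h \<le> 1")
  case True
  show ?thesis
  proof (cases "a \<le> 1")
    case le: True
    have "2 * h powr a \<le> 2 * (a + 1) * h powr a" using a by (intro mult_right_mono) auto
    then show ?thesis using order_trans[OF nn_integral_psi_diff_le_1[OF a le h True] ennreal_leI] le by simp
  next
    case False
    have "2 * a * h \<le> 2 * (a + 1) * h" using h by (simp add: algebra_simps)
    then show ?thesis using order_trans[OF nn_integral_psi_diff_ge_1[OF _ h] ennreal_leI, of a] False h by simp
  qed
next
  case False
  have "(\<integral>\<^sup>+x. ennreal \<bar>psi a (x + h) - psi a x\<bar> \<partial>lborel) \<le> (\<integral>\<^sup>+x. ennreal (psi a (x + h)) + ennreal (psi a x) \<partial>lborel)"
  proof (rule nn_integral_mono)
    fix x
    show "ennreal \<bar>psi a (x + h) - psi a x\<bar> \<le> ennreal (psi a (x + h)) + ennreal (psi a x)"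
      using psi_nonneg[of a x] psi_nonneg[of a "x + h"] a
      by (simp add: ennreal_leI flip: ennreal_plus)
  qed
  also have "\<dots> = ennreal 2"
    using a nn_integral_shift[of "\<lambda>x. ennreal (psi a x)" h] by (simp add: nn_integral_add nn_integral_psi)
  also have "\<dots> \<le> ennreal (2 * (a + 1) * h powr (min a 1))"
  proof (rule ennreal_leI)
    have "1 \<le> h powr (min a 1)" using False a by (intro ge_one_powr_ge_zero) auto
    then have "2 * 1 * 1 \<le> 2 * (a + 1) * h powr (min a 1)" using a by (intro mult_mono) auto
    then show "2 \<le> 2 * (a + 1) * h powr (min a 1)" by simp
  qed
  finally show ?thesis .
qed

lemma nn_integral_phi_diff:
  assumes a: "0 < a"
  shows "(\<integral>\<^sup>+x. ennreal \<bar>phi a (x + h) - phi a x\<bar> \<partial>lborel) \<le> ennreal (4 * (a + 1) * \<bar>h\<bar> powr (min a 1))"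
proof -
  have pos: "(\<integral>\<^sup>+x. ennreal \<bar>phi a (x + h) - phi a x\<bar> \<partial>lborel) \<le> ennreal (4 * (a + 1) * h powr (min a 1))"
    if h: "h \<ge> 0" for h
  proof -
    let ?D = "\<lambda>x. ennreal \<bar>psi a (x + h) - psi a x\<bar>"
    have "(\<integral>\<^sup>+x. ennreal \<bar>phi a (x + h) - phi a x\<bar> \<partial>lborel) \<le> (\<integral>\<^sup>+x. ?D x + ?D (- h - x) \<partial>lborel)"
    proof (rule nn_integral_mono)
      fix x
      have "\<bar>phi a (x + h) - phi a x\<bar> \<le> \<bar>psi a (x + h) - psi a x\<bar> + \<bar>psi a (- x) - psi a (- (x + h))\<bar>"
        unfolding phi_eq_psi by linarith
      moreover have "- h - x + h = - x" "- h - x = - (x + h)" by simp_all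
      ultimately show "ennreal \<bar>phi a (x + h) - phi a x\<bar> \<le> ?D x + ?D (- h - x)"
        by (simp only: ennreal_leI flip: ennreal_plus)
    qed
    also have "\<dots> = (\<integral>\<^sup>+x. ?D x \<partial>lborel) + (\<integral>\<^sup>+x. ?D x \<partial>lborel)"
      using nn_integral_reflect[of ?D "- h"] by (simp add: nn_integral_add)
    also have "\<dots> \<le> ennreal (2 * (a + 1) * h powr (min a 1)) + ennreal (2 * (a + 1) * h powr (min a 1))"
      by (intro add_mono nn_integral_psi_diff a h)
    also have "\<dots> = ennreal (4 * (a + 1) * h powr (min a 1))"
      using a by (simp flip: ennreal_plus)
    finally show ?thesis .
  qed
  show ?thesis
  proof (cases "h \<ge> 0")
    case True with pos show ?thesis by simp
  next
    case False
    have "(\<integral>\<^sup>+x. ennreal \<bar>phi a (x + h) - phi a x\<bar> \<partial>lborel) = (\<integral>\<^sup>+x. ennreal \<bar>phi a (x - h + h) - phi a (x - h)\<bar> \<partial>lborel)"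
      using nn_integral_shift[of "\<lambda>x. ennreal \<bar>phi a (x + h) - phi a x\<bar>" "- h"] by simp
    also have "\<dots> = (\<integral>\<^sup>+x. ennreal \<bar>phi a (x + - h) - phi a x\<bar> \<partial>lborel)"
      by (simp add: abs_minus_commute)
    finally show ?thesis using pos[of "- h"] False by simp
  qed
qed

lemma nn_integral_phi_dil_diff:
  assumes a: "0 < a" and t: "t > 0"
  shows "(\<integral>\<^sup>+x. ennreal \<bar>phi_dil a t (x + h) - phi_dil a t x\<bar> \<partial>lborel) \<le> ennreal (4 * (a + 1) * \<bar>h / t\<bar> powr (min a 1))"
proof -
  have "(\<integral>\<^sup>+x. ennreal \<bar>phi_dil a t (x + h) - phi_dil a t x\<bar> \<partial>lborel) =
     ennreal \<bar>t\<bar> * (\<integral>\<^sup>+x. ennreal \<bar>phi_dil a t (0 + t * x + h) - phi_dil a t (0 + t * x)\<bar> \<partial>lborel)"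
    using t by (intro nn_integral_real_affine) auto
  also have "\<dots> = (\<integral>\<^sup>+x. ennreal \<bar>phi a (x + h / t) - phi a x\<bar> \<partial>lborel)"
    using t by (subst nn_integral_cmult[symmetric])
      (auto simp: phi_dil_def abs_mult add_divide_distrib mult.assoc[symmetric] simp flip: ennreal_mult right_diff_distrib)
  finally show ?thesis using nn_integral_phi_diff[OF a, of "h / t"] by simp
qed

section \<open>Regularity of the kernel in the dilation parameter\<close>

text \<open>Haar measure of the multiplicative group of positive reals, carried by the whole line
  with density 0 at \<open>t <= 0\<close>, so that it has the Borel sets of \<open>real\<close> and
  its products can be indexed like those of \<open>lborel\<close>.\<close>

definition nu :: "real measure" where
  "nu = density lborel (\<lambda>t. ennreal (indicator {0<..} t / t))"

lemma sets_nu [simp, measurable_cong]: "sets nu = sets borel"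
  by (simp add: nu_def)

lemma space_nu [simp]: "space nu = UNIV"
  by (simp add: nu_def)

lemma nn_integral_nu:
  "f \<in> borel_measurable borel \<Longrightarrow> (\<integral>\<^sup>+t. f t \<partial>nu) = (\<integral>\<^sup>+t. ennreal (indicator {0<..} t / t) * f t \<partial>lborel)"
  unfolding nu_def by (subst nn_integral_density) auto

lemma sigma_finite_nu: "sigma_finite_measure nu"
  unfolding nu_def by (subst sigma_finite_measure.sigma_finite_iff_density_finite[OF lborel.sigma_finite_measure_axioms]) auto

lemma AE_nu_pos: "AE t in nu. t > 0"
  unfolding nu_def by (subst AE_density) (auto simp: indicator_def split: if_splits)

lemma nn_integral_nu_scale:
  assumes [measurable]: "f \<in> borel_measurable borel" and c: "c > 0"
  shows "(\<integral>\<^sup>+t. f (c * t) \<partial>nu) = (\<integral>\<^sup>+t. f t \<partial>nu)"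
proof -
  have "(\<integral>\<^sup>+t. f t \<partial>nu) = (\<integral>\<^sup>+t. ennreal (indicator {0<..} t / t) * f t \<partial>lborel)"
    by (intro nn_integral_nu) measurable
  also have "\<dots> = ennreal \<bar>c\<bar> * (\<integral>\<^sup>+t. ennreal (indicator {0<..} (0 + c * t) / (0 + c * t)) * f (0 + c * t) \<partial>lborel)"
    using c by (intro nn_integral_real_affine) auto
  also have "\<dots> = (\<integral>\<^sup>+t. f (c * t) \<partial>nu)"
    using c by (subst nn_integral_cmult[symmetric], simp, subst nn_integral_nu)
      (auto intro!: nn_integral_cong simp: indicator_def zero_less_mult_iff mult.assoc[symmetric] simp flip: ennreal_mult)
  finally show ?thesis by simp
qed

text \<open>This form exhibits both the singularity in \<open>t\<close> at \<open>t = x\<close> and,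
  for fixed \<open>t\<close>, the monotonicity in \<open>x\<close> on the interval from 0 to
  \<open>t\<close>: increasing for \<open>a <= 1\<close>, decreasing for
  \<open>a >= 1\<close>.\<close>

lemma phi_dil_pos:
  assumes "x > 0" "t > 0"
  shows "phi_dil a t x = (if x < t then a * t powr (- a) * (t - x) powr (a - 1) else 0)"
proof (cases "x < t")
  case True
  have "phi_dil a t x = inverse t * (a * (1 - x / t) powr (a - 1))"
    using assms True by (auto simp: phi_dil_def phi_def indicator_def field_simps)
  also have "1 - x / t = (t - x) / t" using assms by (simp add: field_simps)
  also have "((t - x) / t) powr (a - 1) = (t - x) powr (a - 1) / t powr (a - 1)"
    using assms True by (simp add: powr_divide)
  also have "t powr (a - 1) = t powr a / t" using assms by (simp add: powr_diff)
  finally show ?thesis using assms True by (simp add: powr_minus field_simps)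
next
  case False
  then show ?thesis using assms
    by (cases "x = t") (auto simp: phi_dil_def phi_def indicator_def field_simps)
qed

text \<open>Near \<open>t = 1\<close> the square is of size \<open>(t - 1) powr (2 * a - 2)\<close>,
  integrable because \<open>2 * a - 2 > -1\<close>; for \<open>t > 2\<close> the kernel is of size
  \<open>1 / t\<close>, so its square is integrable at infinity.\<close>

lemma nn_integral_phi_dil_sq_finite:
  assumes a: "a > 1/2"
  shows "(\<integral>\<^sup>+t. ennreal ((phi_dil a t 1)\<^sup>2) \<partial>nu) < \<infinity>"
proof -
  have fin: "ennreal p * ennreal q + ennreal r * ennreal s < \<infinity>" for p q r s
    by (simp add: ennreal_mult_less_top)
  have "(\<integral>\<^sup>+t. ennreal ((phi_dil a t 1)\<^sup>2) \<partial>nu) =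
    (\<integral>\<^sup>+t. ennreal (indicator {0<..} t / t) * ennreal ((phi_dil a t 1)\<^sup>2) \<partial>lborel)"
    by (intro nn_integral_nu) measurable
  also have "\<dots> \<le> (\<integral>\<^sup>+t. ennreal (a\<^sup>2) * ennreal ((t - 1) powr (2 * a - 2) * indicator {0..1} (t - 1)) +
       ennreal (2 * a\<^sup>2) * (ennreal (t powr (- 2)) * indicator {2..} t) \<partial>lborel)"
  proof (rule nn_integral_mono)
    fix t :: real
    consider "t \<le> 1" | "1 < t" "t \<le> 2" | "t > 2" by linarith
    then show "ennreal (indicator {0<..} t / t) * ennreal ((phi_dil a t 1)\<^sup>2) \<le>
       ennreal (a\<^sup>2) * ennreal ((t - 1) powr (2 * a - 2) * indicator {0..1} (t - 1)) +
       ennreal (2 * a\<^sup>2) * (ennreal (t powr (- 2)) * indicator {2..} t)"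
    proof cases
      case 1
      then show ?thesis by (cases "t > 0") (auto simp: phi_dil_pos)
    next
      case 2
      have "(t powr (- a))\<^sup>2 \<le> 1" using 2 a by (intro power_le_one) (auto simp: powr_minus inverse_le_1_iff ge_one_powr_ge_zero)
      moreover have "((t - 1) powr (a - 1))\<^sup>2 = (t - 1) powr (2 * a - 2)"
        by (simp add: power2_eq_square flip: powr_add)
      ultimately have "a\<^sup>2 * (t powr (- a))\<^sup>2 * ((t - 1) powr (a - 1))\<^sup>2 \<le> a\<^sup>2 * 1 * (t - 1) powr (2 * a - 2)"
        by (metis mult_left_mono mult_right_mono powr_ge_zero zero_le_power2)
      then have "(phi_dil a t 1)\<^sup>2 \<le> a\<^sup>2 * 1 * (t - 1) powr (2 * a - 2)"
        using 2 by (simp add: phi_dil_pos power_mult_distrib)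
      moreover have "1 / t \<le> 1" using 2 by simp
      ultimately have "1 / t * (phi_dil a t 1)\<^sup>2 \<le> 1 * (a\<^sup>2 * 1 * (t - 1) powr (2 * a - 2))"
        by (intro mult_mono) auto
      then have "ennreal (1 / t * (phi_dil a t 1)\<^sup>2) \<le> ennreal (a\<^sup>2 * (t - 1) powr (2 * a - 2))"
        by (intro ennreal_leI) simp
      then show ?thesis using 2 by (auto simp: indicator_def ennreal_mult[symmetric] intro!: add_increasing2)
    next
      case 3
      \<comment> \<open>This base lies between 1/2 and 1, and \<open>2 * a - 2 > -1\<close> bounds
        its power by its reciprocal, hence by 2, even if the exponent is negative.\<close>
      define y where "y = 1 - 1 / t"
      have y: "1/2 \<le> y" "y \<le> 1" using 3 by (auto simp: y_def field_simps)
      have "y powr (2 * a - 2) \<le> y powr (- 1)" using y a by (intro powr_mono') auto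
      also have "\<dots> \<le> 2" using y by (simp add: powr_minus field_simps)
      finally have y2: "y powr (2 * a - 2) \<le> 2" .
      have "phi_dil a t 1 = inverse t * (a * y powr (a - 1))"
        using 3 by (auto simp: phi_dil_def phi_def indicator_def field_simps y_def)
      then have "(phi_dil a t 1)\<^sup>2 = a\<^sup>2 * (y powr (2 * a - 2) * (inverse t)\<^sup>2)"
        by (simp add: power_mult_distrib power2_eq_square mult_ac flip: powr_add)
      also have "\<dots> \<le> a\<^sup>2 * (2 * (inverse t)\<^sup>2)" using y2 by (intro mult_left_mono mult_right_mono) auto
      also have "(inverse t)\<^sup>2 = t powr (- 2)" using 3 by (simp add: powr_minus powr_numeral power_inverse)
      finally have "(phi_dil a t 1)\<^sup>2 \<le> 2 * a\<^sup>2 * t powr (- 2)" by simp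
      moreover have "1 / t \<le> 1" using 3 by simp
      ultimately have "1 / t * (phi_dil a t 1)\<^sup>2 \<le> 1 * (2 * a\<^sup>2 * t powr (- 2))"
        using 3 by (intro mult_mono) auto
      then have "ennreal (1 / t * (phi_dil a t 1)\<^sup>2) \<le> ennreal (2 * a\<^sup>2 * t powr (- 2))"
        by (intro ennreal_leI) simp
      then show ?thesis using 3 by (auto simp: indicator_def ennreal_mult[symmetric] intro: order_trans)
    qed
  qed
  also have "\<dots> = ennreal (a\<^sup>2) * (\<integral>\<^sup>+t. ennreal ((t - 1) powr (2 * a - 2) * indicator {0..1} (t - 1)) \<partial>lborel) +
      ennreal (2 * a\<^sup>2) * (\<integral>\<^sup>+t. ennreal (t powr (- 2)) * indicator {2..} t \<partial>lborel)"
    by (subst nn_integral_add) (auto simp: nn_integral_cmult)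
  also have "(\<integral>\<^sup>+t. ennreal ((t - 1) powr (2 * a - 2) * indicator {0..1} (t - 1)) \<partial>lborel) =
      (\<integral>\<^sup>+t. ennreal (t powr (2 * a - 2) * indicator {0..1} t) \<partial>lborel)"
    using nn_integral_shift[of "\<lambda>t. ennreal (t powr (2 * a - 2) * indicator {0..1} t)" "- 1"] by simp
  also have "\<dots> = ennreal (1 powr (2 * a - 2 + 1) / (2 * a - 2 + 1))"
    using a by (intro nn_integral_powr_from_0) auto
  also have "(\<integral>\<^sup>+t. ennreal (t powr (- 2)) * indicator {2..} t \<partial>lborel) = ennreal (2 powr (1 - 2) / (2 - 1))"
    by (intro nn_integral_powr_at_top) auto
  also have "ennreal (a\<^sup>2) * ennreal (1 powr (2 * a - 2 + 1) / (2 * a - 2 + 1)) + ennreal (2 * a\<^sup>2) * ennreal (2 powr (1 - 2) / (2 - 1)) < \<infinity>"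
    by (rule fin)
  finally show ?thesis .
qed

text \<open>Dilation invariance of \<open>nu\<close> together with
  \<open>phi_dil a (x * t) x = phi_dil a t 1 / x\<close>. In the norm of \<open>L^2(dt / t)\<close>
  the kernel thus has the size \<open>1 / x\<close> of a singular integral kernel on the
  line.\<close>

lemma nn_integral_phi_dil_sq:
  assumes x: "x > 0"
  shows "(\<integral>\<^sup>+t. ennreal ((phi_dil a t x)\<^sup>2) \<partial>nu) = (\<integral>\<^sup>+t. ennreal ((phi_dil a t 1)\<^sup>2) \<partial>nu) * ennreal (1 / x\<^sup>2)"
proof -
  have "(\<integral>\<^sup>+t. ennreal ((phi_dil a t x)\<^sup>2) \<partial>nu) = (\<integral>\<^sup>+t. ennreal ((phi_dil a (x * t) x)\<^sup>2) \<partial>nu)"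
    using x by (intro nn_integral_nu_scale[symmetric]) measurable
  also have "\<dots> = (\<integral>\<^sup>+t. ennreal ((phi_dil a t 1)\<^sup>2) * ennreal (1 / x\<^sup>2) \<partial>nu)"
    using x by (intro nn_integral_cong)
      (auto simp: phi_dil_def power_mult_distrib power_inverse field_simps simp flip: ennreal_mult)
  also have "\<dots> = (\<integral>\<^sup>+t. ennreal ((phi_dil a t 1)\<^sup>2) \<partial>nu) * ennreal (1 / x\<^sup>2)"
    by (intro nn_integral_multc) measurable
  finally show ?thesis .
qed

text \<open>For \<open>w < t <= v\<close> the kernel at \<open>v\<close> vanishes while that at
  \<open>w\<close> need not. Bounding \<open>t\<close> below by \<open>w\<close> in the smooth
  factor leaves the integral of \<open>(t - w) powr (2 * a - 2)\<close> over an interval of length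
  \<open>v - w\<close>.\<close>

lemma nn_integral_phi_dil_sq_near:
  assumes a: "a > 1/2" and w: "0 < w" "w < v"
  shows "(\<integral>\<^sup>+t. ennreal ((phi_dil a t w)\<^sup>2) * indicator {..v} t \<partial>nu) \<le>
    ennreal (a\<^sup>2 / (2 * a - 1) * w powr (- 1 - 2 * a) * (v - w) powr (2 * a - 1))"
proof -
  have "(\<integral>\<^sup>+t. ennreal ((phi_dil a t w)\<^sup>2) * indicator {..v} t \<partial>nu) =
    (\<integral>\<^sup>+t. ennreal (indicator {0<..} t / t) * (ennreal ((phi_dil a t w)\<^sup>2) * indicator {..v} t) \<partial>lborel)"
    by (intro nn_integral_nu) measurable
  also have "\<dots> \<le> (\<integral>\<^sup>+t. ennreal (a\<^sup>2 * w powr (- 1 - 2 * a)) *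
      ennreal ((t - w) powr (2 * a - 2) * indicator {0..v - w} (t - w)) \<partial>lborel)"
  proof (rule nn_integral_mono)
    fix t :: real
    show "ennreal (indicator {0<..} t / t) * (ennreal ((phi_dil a t w)\<^sup>2) * indicator {..v} t) \<le>
      ennreal (a\<^sup>2 * w powr (- 1 - 2 * a)) * ennreal ((t - w) powr (2 * a - 2) * indicator {0..v - w} (t - w))"
    proof (cases "w < t \<and> t \<le> v")
      case True
      then have t: "t > 0" using w by simp
      have "1 / t * (phi_dil a t w)\<^sup>2 = a\<^sup>2 * ((t powr (- a))\<^sup>2 * t powr (- 1)) * ((t - w) powr (a - 1))\<^sup>2"
        using True w by (simp add: phi_dil_pos power_mult_distrib powr_minus divide_inverse)
      also have "(t powr (- a))\<^sup>2 * t powr (- 1) = t powr (- 1 - 2 * a)"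
        by (simp only: power2_eq_square powr_add[symmetric], simp add: algebra_simps)
      also have "((t - w) powr (a - 1))\<^sup>2 = (t - w) powr (2 * a - 2)"
        by (simp add: power2_eq_square flip: powr_add)
      also have "a\<^sup>2 * t powr (- 1 - 2 * a) * (t - w) powr (2 * a - 2) \<le> a\<^sup>2 * w powr (- 1 - 2 * a) * (t - w) powr (2 * a - 2)"
        using True w a by (intro mult_left_mono mult_right_mono powr_mono2') auto
      finally have "ennreal (1 / t * (phi_dil a t w)\<^sup>2) \<le> ennreal (a\<^sup>2 * w powr (- 1 - 2 * a) * (t - w) powr (2 * a - 2))"
        by (rule ennreal_leI)
      then show ?thesis using True t by (simp add: indicator_def flip: ennreal_mult)
    next
      case False
      then show ?thesis using w by (cases "t > 0") (auto simp: phi_dil_pos indicator_def)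
    qed
  qed
  also have "\<dots> = ennreal (a\<^sup>2 * w powr (- 1 - 2 * a)) * (\<integral>\<^sup>+t. ennreal ((t - w) powr (2 * a - 2) * indicator {0..v - w} (t - w)) \<partial>lborel)"
    by (intro nn_integral_cmult) measurable
  also have "(\<integral>\<^sup>+t. ennreal ((t - w) powr (2 * a - 2) * indicator {0..v - w} (t - w)) \<partial>lborel) =
      (\<integral>\<^sup>+t. ennreal (t powr (2 * a - 2) * indicator {0..v - w} t) \<partial>lborel)"
    using nn_integral_shift[of "\<lambda>t. ennreal (t powr (2 * a - 2) * indicator {0..v - w} t)" "- w"] by simp
  also have "\<dots> = ennreal ((v - w) powr (2 * a - 2 + 1) / (2 * a - 2 + 1))"
    using a w by (intro nn_integral_powr_from_0) auto
  also have "ennreal (a\<^sup>2 * w powr (- 1 - 2 * a)) * \<dots> = ennreal (a\<^sup>2 / (2 * a - 1) * w powr (- 1 - 2 * a) * (v - w) powr (2 * a - 1))"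
    using a by (simp flip: ennreal_mult)
  finally show ?thesis .
qed

text \<open>By monotonicity \<open>(u - v)\<^sup>2 \<le> \<bar>u\<^sup>2 - v\<^sup>2\<bar>\<close> reduces the claim to the difference of the values at
  \<open>w\<close> and \<open>v\<close> of the integral of \<open>phi_dil a t x\<^sup>2\<close>, which is \<open>c / x\<^sup>2\<close> by homogeneity. For \<open>a < 1\<close>
  the range \<open>w < t \<le> v\<close>, on which the monotonicity in \<open>x\<close> is violated, has to be added.\<close>

lemma nn_integral_phi_dil_diff_sq:
  assumes a: "a > 1/2"
  shows "\<exists>C\<ge>0. \<forall>w v. 0 < w \<longrightarrow> w \<le> v \<longrightarrow>
     (\<integral>\<^sup>+t. ennreal ((phi_dil a t w - phi_dil a t v)\<^sup>2) \<partial>nu) \<le>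
       ennreal (C * w powr (- 2 - min (2 * a - 1) 1) * (v - w) powr (min (2 * a - 1) 1))"
proof -
  let ?A = "\<lambda>x. \<integral>\<^sup>+t. ennreal ((phi_dil a t x)\<^sup>2) \<partial>nu"
  obtain c where c: "c \<ge> 0" "?A 1 = ennreal c"
    using nn_integral_phi_dil_sq_finite[OF a] by (cases "?A 1") auto
  have A: "?A x = ennreal (c / x\<^sup>2)" if "x > 0" for x
    using nn_integral_phi_dil_sq[OF that, of a] c that by (simp flip: ennreal_mult)
  have pm: "AE t in nu. P t" if "\<And>t. t > 0 \<Longrightarrow> P t" for P
    using AE_nu_pos that by (auto elim: eventually_mono)
  let ?D = "\<lambda>w v. \<integral>\<^sup>+t. ennreal ((phi_dil a t w - phi_dil a t v)\<^sup>2) \<partial>nu"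
  show ?thesis
  proof (cases "a \<le> 1")
    case True
    show ?thesis
    proof (intro exI[of _ "2 * a\<^sup>2 / (2 * a - 1)"] conjI allI impI)
      fix w v :: real assume w: "0 < w" "w \<le> v"
      show "?D w v \<le> ennreal (2 * a\<^sup>2 / (2 * a - 1) * w powr (- 2 - min (2 * a - 1) 1) * (v - w) powr (min (2 * a - 1) 1))"
      proof (cases "w = v")
        case False
        let ?E = "\<integral>\<^sup>+t. ennreal ((phi_dil a t w)\<^sup>2) * indicator {..v} t \<partial>nu"
        have "?D w v + ?A w = (\<integral>\<^sup>+t. ennreal ((phi_dil a t w - phi_dil a t v)\<^sup>2) + ennreal ((phi_dil a t w)\<^sup>2) \<partial>nu)"
          by (intro nn_integral_add[symmetric]) measurable
        also have "\<dots> \<le> (\<integral>\<^sup>+t. ennreal ((phi_dil a t v)\<^sup>2) + 2 * (ennreal ((phi_dil a t w)\<^sup>2) * indicator {..v} t) \<partial>nu)"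
        proof (intro nn_integral_mono_AE pm)
          fix t :: real assume t: "t > 0"
          have "(phi_dil a t w - phi_dil a t v)\<^sup>2 + (phi_dil a t w)\<^sup>2 \<le> (phi_dil a t v)\<^sup>2 + 2 * ((phi_dil a t w)\<^sup>2 * indicator {..v} t)"
          proof (cases "t \<le> v")
            case True
            then show ?thesis using t w by (simp add: phi_dil_pos)
          next
            case F: False
            have le: "0 \<le> phi_dil a t w" "phi_dil a t w \<le> phi_dil a t v"
              using F w t True a by (auto simp: phi_dil_pos intro!: mult_left_mono powr_mono2')
            have "(phi_dil a t w)\<^sup>2 \<le> phi_dil a t w * phi_dil a t v"
              using le by (auto simp: power2_eq_square intro!: mult_left_mono)
            then show ?thesis using F by (simp add: power2_diff)
          qed
          then show "ennreal ((phi_dil a t w - phi_dil a t v)\<^sup>2) + ennreal ((phi_dil a t w)\<^sup>2) \<le> ennreal ((phi_dil a t v)\<^sup>2) + 2 * (ennreal ((phi_dil a t w)\<^sup>2) * indicator {..v} t)"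
            by (auto simp: indicator_def ennreal_leI simp flip: ennreal_plus ennreal_mult ennreal_numeral split: if_splits)
        qed
        also have "\<dots> = ?A v + 2 * ?E"
          by (simp add: nn_integral_add nn_integral_cmult)
        \<comment> \<open>\<open>?A x = c / x^2\<close> decreases in \<open>x\<close>, and
          \<open>?A w\<close>, being finite, cancels next.\<close>
        also have "\<dots> \<le> ?A w + 2 * ?E"
          using w c by (auto intro!: add_mono ennreal_leI divide_left_mono simp: A power_mono)
        finally have "?D w v \<le> 2 * ?E"
          using w by (subst (asm) add.commute) (simp add: ennreal_add_left_cancel_le A)
        also have "\<dots> \<le> 2 * ennreal (a\<^sup>2 / (2 * a - 1) * w powr (- 1 - 2 * a) * (v - w) powr (2 * a - 1))"
          using False w by (intro mult_left_mono nn_integral_phi_dil_sq_near a) auto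
        also have "\<dots> = ennreal (2 * a\<^sup>2 / (2 * a - 1) * w powr (- 2 - (2 * a - 1)) * (v - w) powr (2 * a - 1))"
          using a by (simp add: mult.assoc flip: ennreal_mult ennreal_numeral)
        finally show ?thesis using True by (simp add: min_def)
      qed simp
    qed (use a in simp)
  next
    case False
    show ?thesis
    proof (intro exI[of _ "2 * c"] conjI allI impI)
      fix w v :: real assume w: "0 < w" "w \<le> v"
      have "?D w v + ?A v = (\<integral>\<^sup>+t. ennreal ((phi_dil a t w - phi_dil a t v)\<^sup>2) + ennreal ((phi_dil a t v)\<^sup>2) \<partial>nu)"
        by (intro nn_integral_add[symmetric]) measurable
      also have "\<dots> \<le> ?A w"
      proof (intro nn_integral_mono_AE pm)
        fix t :: real assume t: "t > 0"
        have le: "0 \<le> phi_dil a t v" "phi_dil a t v \<le> phi_dil a t w"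
          using w t a False by (auto simp: phi_dil_pos intro!: mult_left_mono powr_mono2)
        have "(phi_dil a t v)\<^sup>2 \<le> phi_dil a t w * phi_dil a t v"
          using le by (auto simp: power2_eq_square intro!: mult_right_mono)
        then have "(phi_dil a t w - phi_dil a t v)\<^sup>2 + (phi_dil a t v)\<^sup>2 \<le> (phi_dil a t w)\<^sup>2"
          by (simp add: power2_diff)
        then show "ennreal ((phi_dil a t w - phi_dil a t v)\<^sup>2) + ennreal ((phi_dil a t v)\<^sup>2) \<le> ennreal ((phi_dil a t w)\<^sup>2)"
          by (simp add: ennreal_leI flip: ennreal_plus)
      qed
      finally have "?D w v \<le> ennreal (c / w\<^sup>2 - c / v\<^sup>2)"
        using w c by (intro ennreal_add_le_cancel) (auto simp: A)
      also have "c / w\<^sup>2 - c / v\<^sup>2 \<le> 2 * c * w powr (- 3) * (v - w)"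
      proof -
        have "c / w\<^sup>2 - c / v\<^sup>2 = c * (v - w) * ((v + w) / (w\<^sup>2 * v\<^sup>2))"
          using w by (simp add: field_simps power2_eq_square)
        \<comment> \<open>\<open>v + w <= 2 * v\<close> in the numerator and
          \<open>v^2 >= v * w\<close> in the denominator; the factor \<open>v\<close> then
          cancels.\<close>
        also have "\<dots> \<le> c * (v - w) * (2 * v / (w\<^sup>2 * (v * w)))"
          using w c by (intro mult_left_mono frac_le) (auto simp: power2_eq_square)
        also have "2 * v / (w\<^sup>2 * (v * w)) = 2 * w powr (- 3)" using w by (simp add: powr_minus powr_numeral field_simps power2_eq_square power3_eq_cube)
        finally show ?thesis by (simp add: mult_ac)
      qed
      finally show "?D w v \<le> ennreal (2 * c * w powr (- 2 - min (2 * a - 1) 1) * (v - w) powr (min (2 * a - 1) 1))"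
        using False w by (simp add: min_def ennreal_leI)
    qed (use c in simp)
  qed
qed

text \<open>As \<open>|y - c| <= r <= |x - c| / 2\<close>, the numbers \<open>x - y\<close> and
  \<open>x - c\<close> have the same sign and modulus at least \<open>|x - c| / 2\<close>, and they
  differ by at most \<open>r\<close>. The factor \<open>2 powr (2 + b)\<close> is the price of
  halving the distance; negative arguments are treated by oddness.\<close>

lemma nn_integral_phi_dil_Hormander_pointwise:
  assumes a: "a > 1/2"
  defines "b \<equiv> min (2 * a - 1) 1"
  shows "\<exists>C\<ge>0. \<forall>x c y r. 0 < r \<longrightarrow> 2 * r \<le> \<bar>x - c\<bar> \<longrightarrow> \<bar>y - c\<bar> \<le> r \<longrightarrow>
     (\<integral>\<^sup>+t. ennreal ((phi_dil a t (x - y) - phi_dil a t (x - c))\<^sup>2) \<partial>nu) \<le> ennreal (C * \<bar>x - c\<bar> powr (- 2 - b) * r powr b)"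
proof -
  let ?D = "\<lambda>w v. \<integral>\<^sup>+t. ennreal ((phi_dil a t w - phi_dil a t v)\<^sup>2) \<partial>nu"
  have b: "b > 0" using a by (simp add: b_def)
  obtain C where C: "C \<ge> 0" "\<And>w v. 0 < w \<Longrightarrow> w \<le> v \<Longrightarrow> ?D w v \<le> ennreal (C * w powr (- 2 - b) * (v - w) powr b)"
    using nn_integral_phi_dil_diff_sq[OF a] unfolding b_def by blast
  have D_sym: "?D v w = ?D w v" for v w by (simp add: power2_commute)
  have *: "?D v w \<le> ennreal (C * 2 powr (2 + b) * d powr (- 2 - b) * r powr b)"
    if r: "0 < r" "2 * r \<le> d" "\<bar>v - w\<bar> \<le> r" "d \<le> 2 * v" "d \<le> 2 * w" for v w d r
  proof -
    have pos: "min v w > 0" using r by auto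
    have "?D v w = ?D (min v w) (max v w)" by (cases "v \<le> w") (auto simp: D_sym min_def max_def)
    also have "\<dots> \<le> ennreal (C * min v w powr (- 2 - b) * (max v w - min v w) powr b)"
      by (rule C(2)[OF pos]) simp
    also have "\<dots> \<le> ennreal (C * (d / 2) powr (- 2 - b) * r powr b)"
    proof -
      have "min v w powr (- 2 - b) \<le> (d / 2) powr (- 2 - b)" using r b by (intro powr_mono2') auto
      moreover have "(max v w - min v w) powr b \<le> r powr b" using r b by (intro powr_mono2) auto
      ultimately show ?thesis using C(1) by (intro ennreal_leI mult_mono mult_left_mono) auto
    qed
    also have "(d / 2) powr (- 2 - b) = d powr (- 2 - b) * 2 powr (2 + b)"
    proof -
      have "2 powr (2 + b) = inverse (2 powr (- 2 - b))" 
      proof -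
        have "2 + b = - (- 2 - b)" by simp
        then show ?thesis by (simp only: powr_minus)
      qed
      moreover have "(d / 2) powr (- 2 - b) = d powr (- 2 - b) / 2 powr (- 2 - b)"
        using r by (intro powr_divide)
      ultimately show ?thesis by (simp only: divide_inverse)
    qed
    finally show ?thesis by (simp add: mult_ac)
  qed
  show ?thesis
  proof (intro exI[of _ "C * 2 powr (2 + b)"] conjI allI impI)
    fix x c y r :: real assume r: "0 < r" "2 * r \<le> \<bar>x - c\<bar>" "\<bar>y - c\<bar> \<le> r"
    show "?D (x - y) (x - c) \<le> ennreal (C * 2 powr (2 + b) * \<bar>x - c\<bar> powr (- 2 - b) * r powr b)"
    proof (cases "x > c")
      case True
      then show ?thesis using r by (intro *) auto
    next
      case False
      have "phi_dil a t (x - y) - phi_dil a t (x - c) = - (phi_dil a t (y - x) - phi_dil a t (c - x))" for t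
        using phi_dil_minus[of a t "y - x"] phi_dil_minus[of a t "c - x"] by simp
      then have "?D (x - y) (x - c) = ?D (y - x) (c - x)"
        by (simp only: power2_minus)
      also have "\<dots> \<le> ennreal (C * 2 powr (2 + b) * \<bar>x - c\<bar> powr (- 2 - b) * r powr b)"
        using r False by (intro *) auto
      finally show ?thesis .
    qed
  qed (use C in simp)
qed

lemma nn_integral_powr_abs_ge:
  assumes "b > 1" "d > 0"
  shows "(\<integral>\<^sup>+x. ennreal (\<bar>x - c\<bar> powr (- b)) * indicator {x. d \<le> \<bar>x - c\<bar>} x \<partial>lborel) \<le> ennreal (2 * d powr (1 - b) / (b - 1))"
proof -
  let ?g = "\<lambda>x. ennreal (x powr (- b)) * indicator {d..} x"
  have "(\<integral>\<^sup>+x. ennreal (\<bar>x - c\<bar> powr (- b)) * indicator {x. d \<le> \<bar>x - c\<bar>} x \<partial>lborel) \<le> (\<integral>\<^sup>+x. ?g (x + - c) + ?g (c - x) \<partial>lborel)"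
    by (intro nn_integral_mono) (auto simp: indicator_def abs_if)
  also have "\<dots> = (\<integral>\<^sup>+x. ?g x \<partial>lborel) + (\<integral>\<^sup>+x. ?g x \<partial>lborel)"
  proof -
    have "(\<integral>\<^sup>+x. ?g (x + - c) \<partial>lborel) = (\<integral>\<^sup>+x. ?g x \<partial>lborel)" "(\<integral>\<^sup>+x. ?g (c - x) \<partial>lborel) = (\<integral>\<^sup>+x. ?g x \<partial>lborel)"
      by (rule nn_integral_shift nn_integral_reflect, measurable)+
    then show ?thesis by (subst nn_integral_add) auto
  qed
  also have "\<dots> = ennreal (2 * d powr (1 - b) / (b - 1))"
    using assms by (simp add: nn_integral_powr_at_top flip: ennreal_plus)
  finally show ?thesis .
qed

lemma ennreal_sqrt_ennreal: "0 \<le> r \<Longrightarrow> ennreal_sqrt (ennreal r) = ennreal (sqrt r)"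
  by (simp add: ennreal_sqrt_def)

text \<open>The square root of the pointwise bound is a constant times
  \<open>r powr (b / 2) * |x - c| powr (- 1 - b / 2)\<close>; since \<open>b > 0\<close>, its
  integral over \<open>|x - c| >= 2 * r\<close> converges, and by scaling it does not depend on
  \<open>r\<close>.\<close>

lemma nn_integral_phi_dil_Hormander:
  assumes a: "a > 1/2"
  shows "\<exists>C\<ge>0. \<forall>c y r. 0 < r \<longrightarrow> \<bar>y - c\<bar> \<le> r \<longrightarrow>
     (\<integral>\<^sup>+x. ennreal_sqrt (\<integral>\<^sup>+t. ennreal ((phi_dil a t (x - y) - phi_dil a t (x - c))\<^sup>2) \<partial>nu) *
        indicator {x. 2 * r \<le> \<bar>x - c\<bar>} x \<partial>lborel) \<le> ennreal C"
proof -
  define b where "b = min (2 * a - 1) 1"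
  have b: "b > 0" using a by (simp add: b_def)
  let ?D = "\<lambda>x y c. \<integral>\<^sup>+t. ennreal ((phi_dil a t (x - y) - phi_dil a t (x - c))\<^sup>2) \<partial>nu"
  obtain C where C: "C \<ge> 0" "\<And>x c y r. 0 < r \<Longrightarrow> 2 * r \<le> \<bar>x - c\<bar> \<Longrightarrow> \<bar>y - c\<bar> \<le> r \<Longrightarrow>
     ?D x y c \<le> ennreal (C * \<bar>x - c\<bar> powr (- 2 - b) * r powr b)"
    using nn_integral_phi_dil_Hormander_pointwise[OF a] unfolding b_def by blast
  show ?thesis
  proof (intro exI[of _ "sqrt C * (2 * 2 powr (- b / 2) / (b / 2))"] conjI allI impI)
    fix c y r :: real assume r: "0 < r" "\<bar>y - c\<bar> \<le> r"
    have "(\<integral>\<^sup>+x. ennreal_sqrt (?D x y c) * indicator {x. 2 * r \<le> \<bar>x - c\<bar>} x \<partial>lborel) \<le>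
      (\<integral>\<^sup>+x. ennreal (sqrt C * r powr (b / 2)) * (ennreal (\<bar>x - c\<bar> powr (- (1 + b / 2))) * indicator {x. 2 * r \<le> \<bar>x - c\<bar>} x) \<partial>lborel)"
    proof (rule nn_integral_mono)
      fix x
      show "ennreal_sqrt (?D x y c) * indicator {x. 2 * r \<le> \<bar>x - c\<bar>} x \<le>
        ennreal (sqrt C * r powr (b / 2)) * (ennreal (\<bar>x - c\<bar> powr (- (1 + b / 2))) * indicator {x. 2 * r \<le> \<bar>x - c\<bar>} x)"
      proof (cases "2 * r \<le> \<bar>x - c\<bar>")
        case True
        have "ennreal_sqrt (?D x y c) \<le> ennreal_sqrt (ennreal (C * \<bar>x - c\<bar> powr (- 2 - b) * r powr b))"
          using C(2)[OF r(1) True r(2)] by simp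
        also have "\<dots> = ennreal (sqrt (C * \<bar>x - c\<bar> powr (- 2 - b) * r powr b))"
          using C(1) by (intro ennreal_sqrt_ennreal) auto
        also have "sqrt (C * \<bar>x - c\<bar> powr (- 2 - b) * r powr b) = sqrt C * r powr (b / 2) * \<bar>x - c\<bar> powr (- (1 + b / 2))"
        proof -
          have *: "- (1 + b / 2) = (- 2 - b) / 2" by (simp add: field_simps)
          show ?thesis unfolding * using r True by (simp add: real_sqrt_mult powr_half_sqrt[symmetric] powr_powr mult_ac)
        qed
        also have "ennreal \<dots> = ennreal (sqrt C * r powr (b / 2)) * ennreal (\<bar>x - c\<bar> powr (- (1 + b / 2)))"
          using C(1) by (intro ennreal_mult) auto
        finally show ?thesis using True by (simp add: indicator_def)
      qed (simp add: indicator_def)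
    qed
    also have "\<dots> = ennreal (sqrt C * r powr (b / 2)) * (\<integral>\<^sup>+x. ennreal (\<bar>x - c\<bar> powr (- (1 + b / 2))) * indicator {x. 2 * r \<le> \<bar>x - c\<bar>} x \<partial>lborel)"
      by (intro nn_integral_cmult) measurable
    also have "\<dots> \<le> ennreal (sqrt C * r powr (b / 2)) * ennreal (2 * (2 * r) powr (1 - (1 + b / 2)) / (1 + b / 2 - 1))"
      using b r by (intro mult_left_mono nn_integral_powr_abs_ge) auto
    also have "\<dots> = ennreal (sqrt C * r powr (b / 2) * (2 * (2 * r) powr (- (b / 2)) / (b / 2)))"
      using b C by (subst ennreal_mult[symmetric]) auto
    also have "sqrt C * r powr (b / 2) * (2 * (2 * r) powr (- (b / 2)) / (b / 2)) = sqrt C * (2 * 2 powr (- b / 2) / (b / 2))"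
      using r by (simp add: powr_mult powr_minus field_simps)
    finally show "(\<integral>\<^sup>+x. ennreal_sqrt (?D x y c) * indicator {x. 2 * r \<le> \<bar>x - c\<bar>} x \<partial>lborel) \<le> ennreal (sqrt C * (2 * 2 powr (- b / 2) / (b / 2)))" .
  qed (use C b in simp)
qed

section \<open>The quadratic estimate\<close>

text \<open>The factor at scale \<open>s\<close> has mean zero, so \<open>phi_dil a t q\<close> may
  be subtracted from the other one; it is supported in \<open>|z| <= s\<close>, so the
  \<open>L^1\<close> modulus of continuity at scale \<open>t\<close> yields a power of
  \<open>s / t\<close>.\<close>

lemma nn_integral_phi_dil_correlation:
  assumes a: "0 < a" and s: "0 < s" "0 < t"
  shows "(\<integral>\<^sup>+q. ennreal \<bar>LINT z|lborel. phi_dil a t (q + z) * phi_dil a s z\<bar> \<partial>lborel) \<le> ennreal (8 * (a + 1) * (s / t) powr (min a 1))"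
proof -
  let ?E = "ennreal (4 * (a + 1) * (s / t) powr (min a 1))"
  have "(\<integral>\<^sup>+q. ennreal \<bar>LINT z|lborel. phi_dil a t (q + z) * phi_dil a s z\<bar> \<partial>lborel) \<le>
    (\<integral>\<^sup>+q. \<integral>\<^sup>+z. ennreal \<bar>phi_dil a t (q + z) - phi_dil a t q\<bar> * ennreal \<bar>phi_dil a s z\<bar> \<partial>lborel \<partial>lborel)"
  proof (rule nn_integral_mono)
    fix q
    show "ennreal \<bar>LINT z|lborel. phi_dil a t (q + z) * phi_dil a s z\<bar> \<le>
      (\<integral>\<^sup>+z. ennreal \<bar>phi_dil a t (q + z) - phi_dil a t q\<bar> * ennreal \<bar>phi_dil a s z\<bar> \<partial>lborel)"
    \<comment> \<open>If the product is not integrable, the integral on the left is 0 by convention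
      and the bound is trivial.\<close>
    proof (cases "integrable lborel (\<lambda>z. phi_dil a t (q + z) * phi_dil a s z)")
      case True
      have "(LINT z|lborel. phi_dil a t (q + z) * phi_dil a s z) = (LINT z|lborel. (phi_dil a t (q + z) - phi_dil a t q) * phi_dil a s z)"
        using True integrable_phi_dil[OF a, of s] by (simp add: left_diff_distrib integral_phi_dil)
      then show ?thesis
        using ennreal_abs_integral_le[of lborel "\<lambda>z. (phi_dil a t (q + z) - phi_dil a t q) * phi_dil a s z"]
        by (simp add: abs_mult ennreal_mult)
    qed (simp add: not_integrable_integral_eq)
  qed
  also have "\<dots> = (\<integral>\<^sup>+z. \<integral>\<^sup>+q. ennreal \<bar>phi_dil a t (q + z) - phi_dil a t q\<bar> * ennreal \<bar>phi_dil a s z\<bar> \<partial>lborel \<partial>lborel)"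
    by (intro nn_integral_swap lborel.sigma_finite_measure_axioms) measurable
  also have "\<dots> = (\<integral>\<^sup>+z. (\<integral>\<^sup>+q. ennreal \<bar>phi_dil a t (q + z) - phi_dil a t q\<bar> \<partial>lborel) * ennreal \<bar>phi_dil a s z\<bar> \<partial>lborel)"
    by (intro nn_integral_cong nn_integral_multc) measurable
  also have "\<dots> \<le> (\<integral>\<^sup>+z. ?E * ennreal \<bar>phi_dil a s z\<bar> \<partial>lborel)"
  proof (rule nn_integral_mono)
    fix z
    show "(\<integral>\<^sup>+q. ennreal \<bar>phi_dil a t (q + z) - phi_dil a t q\<bar> \<partial>lborel) * ennreal \<bar>phi_dil a s z\<bar> \<le> ?E * ennreal \<bar>phi_dil a s z\<bar>"
    proof (cases "\<bar>z\<bar> \<le> s")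
      case True
      have "(\<integral>\<^sup>+q. ennreal \<bar>phi_dil a t (q + z) - phi_dil a t q\<bar> \<partial>lborel) \<le> ennreal (4 * (a + 1) * \<bar>z / t\<bar> powr (min a 1))"
        by (intro nn_integral_phi_dil_diff a s)
      also have "\<dots> \<le> ?E"
        using True s a by (intro ennreal_leI mult_left_mono powr_mono2) (auto simp: divide_right_mono)
      finally show ?thesis by (rule mult_right_mono) simp
    next
      case False
      then show ?thesis using s by (simp add: phi_dil_eq_0)
    qed
  qed
  also have "\<dots> = ?E * (\<integral>\<^sup>+z. ennreal \<bar>phi_dil a s z\<bar> \<partial>lborel)"
    by (intro nn_integral_cmult) measurable
  also have "\<dots> \<le> ?E * 2"
    by (intro mult_left_mono nn_integral_phi_dil_le a) simp
  also have "\<dots> = ennreal (8 * (a + 1) * (s / t) powr (min a 1))"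
    using a by (subst ennreal_numeral[symmetric], subst ennreal_mult[symmetric]) auto
  finally show ?thesis .
qed

text \<open>The inner integral depends on \<open>x - v\<close> only. Two different substitutions
  bring it into the form of the correlation above with either factor in the role of the translated
  one, so the smaller of the two quotients may be used.\<close>

lemma nn_integral_phi_dil_kernel_le:
  assumes a: "0 < a" and s: "0 < s" "0 < t"
  shows "(\<integral>\<^sup>+v. ennreal \<bar>LINT y|lborel. phi_dil a t (x - y) * phi_dil a s (v - y)\<bar> \<partial>lborel) \<le>
     ennreal (8 * (a + 1) * min (s / t) (t / s) powr (min a 1))"
proof -
  let ?J = "\<lambda>t s. \<integral>\<^sup>+q. ennreal \<bar>LINT z|lborel. phi_dil a t (q + z) * phi_dil a s z\<bar> \<partial>lborel"
  have "(LINT y|lborel. phi_dil a t (x - y) * phi_dil a s (v - y)) = (LINT z|lborel. phi_dil a t ((x - v) + z) * phi_dil a s z)" for v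
    by (subst lborel_integral_real_affine[where c = "-1" and t = v]) (auto simp: algebra_simps)
  then have 1: "(\<integral>\<^sup>+v. ennreal \<bar>LINT y|lborel. phi_dil a t (x - y) * phi_dil a s (v - y)\<bar> \<partial>lborel) = ?J t s"
    using nn_integral_reflect[of "\<lambda>q. ennreal \<bar>LINT z|lborel. phi_dil a t (q + z) * phi_dil a s z\<bar>" x] by simp
  have "(LINT y|lborel. phi_dil a t (x - y) * phi_dil a s (v - y)) = (LINT z|lborel. phi_dil a s ((v + - x) + z) * phi_dil a t z)" for v
    by (subst lborel_integral_real_affine[where c = "-1" and t = x]) (auto simp: algebra_simps)
  then have 2: "(\<integral>\<^sup>+v. ennreal \<bar>LINT y|lborel. phi_dil a t (x - y) * phi_dil a s (v - y)\<bar> \<partial>lborel) = ?J s t"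
    using nn_integral_shift[of "\<lambda>q. ennreal \<bar>LINT z|lborel. phi_dil a s (q + z) * phi_dil a t z\<bar>" "- x"] by simp
  show ?thesis
  proof (cases "s / t \<le> t / s")
    case True
    show ?thesis unfolding 1 min_absorb1[OF True] by (rule nn_integral_phi_dil_correlation[OF a s])
  next
    case False
    then have "t / s \<le> s / t" by simp
    show ?thesis unfolding 2 min_absorb2[OF \<open>t / s \<le> s / t\<close>] by (rule nn_integral_phi_dil_correlation[OF a s(2,1)])
  qed
qed

text \<open>By invariance \<open>t\<close> may be taken to be 1; then the ranges below and above 1
  contribute at most \<open>1 / e\<close> each. This is the row sum of \<open>T T*\<close> over the
  scales.\<close>

lemma nn_integral_nu_min_powr:
  assumes e: "e > 0" and t: "t > 0"
  shows "(\<integral>\<^sup>+s. ennreal (min (s / t) (t / s) powr e) \<partial>nu) \<le> ennreal (2 / e)"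
proof -
  have "(\<integral>\<^sup>+s. ennreal (min (s / t) (t / s) powr e) \<partial>nu) = (\<integral>\<^sup>+s. ennreal (min (t * s / t) (t / (t * s)) powr e) \<partial>nu)"
    by (intro nn_integral_nu_scale[symmetric] t) measurable
  also have "\<dots> = (\<integral>\<^sup>+s. ennreal (indicator {0<..} s / s) * ennreal (min (t * s / t) (t / (t * s)) powr e) \<partial>lborel)"
    by (intro nn_integral_nu) measurable
  also have "\<dots> \<le> (\<integral>\<^sup>+s. ennreal (s powr (e - 1) * indicator {0..1} s) + ennreal (s powr (- (1 + e))) * indicator {1..} s \<partial>lborel)"
  proof (rule nn_integral_mono)
    fix s :: real
    consider "s \<le> 0" | "0 < s" "s \<le> 1" | "1 < s" by linarith
    then show "ennreal (indicator {0<..} s / s) * ennreal (min (t * s / t) (t / (t * s)) powr e) \<le>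
      ennreal (s powr (e - 1) * indicator {0..1} s) + ennreal (s powr (- (1 + e))) * indicator {1..} s"
    proof cases
      case 2
      have "min s (1 / s) powr e \<le> s powr e" using 2 e by (intro powr_mono2) auto
      then have "min s (1 / s) powr e / s \<le> s powr (e - 1)" using 2 by (simp add: powr_diff divide_right_mono)
      then show ?thesis using t 2 by (auto simp: indicator_def ennreal_leI simp flip: ennreal_mult intro!: add_increasing2)
    next
      case 3
      have "min s (1 / s) powr e \<le> (1 / s) powr e" using 3 e by (intro powr_mono2) auto
      also have "\<dots> = s powr (- e)" using 3 by (simp add: powr_divide powr_minus_divide)
      finally have "min s (1 / s) powr e / s \<le> s powr (- e) / s" using 3 by (simp add: divide_right_mono)
      also have "\<dots> = s powr (- e - 1)" using 3 by (simp add: powr_diff)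
      also have "- e - 1 = - (1 + e)" by simp
      finally show ?thesis using t 3 by (auto simp: indicator_def ennreal_leI simp flip: ennreal_mult intro!: add_increasing2)
    qed simp
  qed
  also have "\<dots> = (\<integral>\<^sup>+s. ennreal (s powr (e - 1) * indicator {0..1} s) \<partial>lborel) + (\<integral>\<^sup>+s. ennreal (s powr (- (1 + e))) * indicator {1..} s \<partial>lborel)"
    by (rule nn_integral_add) measurable
  also have "(\<integral>\<^sup>+s. ennreal (s powr (e - 1) * indicator {0..1} s) \<partial>lborel) = ennreal (1 powr (e - 1 + 1) / (e - 1 + 1))"
    using e by (intro nn_integral_powr_from_0) auto
  also have "(\<integral>\<^sup>+s. ennreal (s powr (- (1 + e))) * indicator {1..} s \<partial>lborel) = ennreal (1 powr (1 - (1 + e)) / (1 + e - 1))"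
    using e by (intro nn_integral_powr_at_top) auto
  also have "ennreal (1 powr (e - 1 + 1) / (e - 1 + 1)) + ennreal (1 powr (1 - (1 + e)) / (1 + e - 1)) = ennreal (1 / e + 1 / e)"
    using e by (subst ennreal_plus[symmetric]) auto
  also have "\<dots> = ennreal (2 / e)" using e by (simp flip: ennreal_plus)
  finally show ?thesis .
qed

text \<open>Over all scales the column sums of the kernel diverge, because \<open>nu\<close> is
  infinite. The scales are therefore cut off to \<open>I n\<close>. The resulting constant,
  \<open>8 * (a + 1)\<close> times \<open>2 / e\<close>, comes from the row sums of
  \<open>T T*\<close> and is the same for all \<open>n\<close>, so monotone convergence removes the
  cut-off.\<close>

lemma square_function_L2_bound:
  assumes a: "a > 0"
  shows "\<exists>B>0. \<forall>f. f \<in> borel_measurable borel \<longrightarrow>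
    (\<integral>\<^sup>+x. \<integral>\<^sup>+t. ennreal ((LINT y|lborel. f y * phi_dil a t (x - y))\<^sup>2) \<partial>nu \<partial>lborel) \<le> ennreal B * (\<integral>\<^sup>+y. ennreal ((f y)\<^sup>2) \<partial>lborel)"
proof -
  define e where "e = min a 1"
  have e: "e > 0" using a by (simp add: e_def)
  define B where "B = 8 * (a + 1) * (2 / e)"
  have B: "B > 0" using a e by (simp add: B_def)
  show ?thesis
  proof (intro exI[of _ B] conjI allI impI B)
    fix f :: "real \<Rightarrow> real" assume [measurable]: "f \<in> borel_measurable borel"
    show "(\<integral>\<^sup>+x. \<integral>\<^sup>+t. ennreal ((LINT y|lborel. f y * phi_dil a t (x - y))\<^sup>2) \<partial>nu \<partial>lborel) \<le> ennreal B * (\<integral>\<^sup>+y. ennreal ((f y)\<^sup>2) \<partial>lborel)"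
    proof (cases "(\<integral>\<^sup>+y. ennreal ((f y)\<^sup>2) \<partial>lborel) = \<infinity>")
      case True
      then show ?thesis using B by (simp add: ennreal_mult_top)
    next
      case False
      interpret pair_sigma_finite nu "lborel :: real measure"
        by (simp add: pair_sigma_finite_def sigma_finite_nu lborel.sigma_finite_measure_axioms)
      let ?M = "nu \<Otimes>\<^sub>M (lborel :: real measure)"
      define I :: "nat \<Rightarrow> real set" where "I n = {1 / real (Suc n)..real (Suc n)}" for n
      define T where "T = (\<lambda>(t, x). LINT y|lborel. f y * phi_dil a t (x - y))"
      have [measurable]: "I n \<in> sets borel" for n by (simp add: I_def)
      have [measurable]: "T \<in> borel_measurable ?M" unfolding T_def by measurable
      have bound: "(\<integral>\<^sup>+p. ennreal ((T p)\<^sup>2) * indicator (I n) (fst p) \<partial>?M) \<le> ennreal B * (\<integral>\<^sup>+y. ennreal ((f y)\<^sup>2) \<partial>lborel)" for n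
      proof -
        let ?k = "\<lambda>p y. indicator (I n) (fst p) * phi_dil a (fst p) (snd p - y) :: real"
        have "(\<integral>\<^sup>+p. ennreal ((T p)\<^sup>2) * indicator (I n) (fst p) \<partial>?M) = (\<integral>\<^sup>+p. ennreal ((LINT y|lborel. ?k p y * f y)\<^sup>2) \<partial>?M)"
          by (intro nn_integral_cong) (auto simp: T_def indicator_def mult.commute)
        also have "\<dots> \<le> ennreal B * (\<integral>\<^sup>+y. ennreal ((f y)\<^sup>2) \<partial>lborel)"
        \<comment> \<open>\<open>2\<close> is the \<open>L^1\<close> bound for the kernel; on
          \<open>I n\<close> the density \<open>1 / t\<close> and the upper end are both at most
          \<open>n + 1\<close>, which gives the column sum.\<close>
        proof (rule TT_star_bound[where ?A1.0 = 2 and ?A2.0 = "2 * (real (Suc n) * real (Suc n))"])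
          show "sigma_finite_measure ?M" by (rule sigma_finite_measure_axioms)
          show "(\<integral>\<^sup>+y. ennreal \<bar>?k p y\<bar> \<partial>lborel) \<le> ennreal 2" for p
          proof -
            have "(\<integral>\<^sup>+y. ennreal \<bar>?k p y\<bar> \<partial>lborel) \<le> (\<integral>\<^sup>+y. ennreal \<bar>phi_dil a (fst p) (snd p - y)\<bar> \<partial>lborel)"
              by (intro nn_integral_mono) (auto simp: indicator_def)
            also have "\<dots> \<le> 2"
              using nn_integral_phi_dil_le[OF a, of "fst p"] nn_integral_reflect[of "\<lambda>y. ennreal \<bar>phi_dil a (fst p) y\<bar>" "snd p"] by simp
            finally show ?thesis by simp
          qed
          show "(\<integral>\<^sup>+p. ennreal \<bar>?k p y\<bar> \<partial>?M) \<le> ennreal (2 * (real (Suc n) * real (Suc n)))" for y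
          proof -
            have "(\<integral>\<^sup>+p. ennreal \<bar>?k p y\<bar> \<partial>?M) = (\<integral>\<^sup>+t. \<integral>\<^sup>+x. ennreal \<bar>?k (t, x) y\<bar> \<partial>lborel \<partial>nu)"
              by (intro lborel.nn_integral_fst[symmetric]) measurable
            also have "\<dots> \<le> (\<integral>\<^sup>+t. 2 * indicator (I n) t \<partial>nu)"
            proof (rule nn_integral_mono)
              fix t
              show "(\<integral>\<^sup>+x. ennreal \<bar>?k (t, x) y\<bar> \<partial>lborel) \<le> 2 * indicator (I n) t"
                using nn_integral_phi_dil_le[OF a, of t] nn_integral_shift[of "\<lambda>y. ennreal \<bar>phi_dil a t y\<bar>" "- y"]
                by (cases "t \<in> I n") auto
            qed
            also have "\<dots> = (\<integral>\<^sup>+t. ennreal (indicator {0<..} t / t) * (2 * indicator (I n) t) \<partial>lborel)"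
              by (intro nn_integral_nu) measurable
            also have "\<dots> \<le> (\<integral>\<^sup>+t. ennreal (2 * real (Suc n)) * indicator {0..real (Suc n)} t \<partial>lborel)"
            proof (rule nn_integral_mono)
              fix t
              show "ennreal (indicator {0<..} t / t) * (2 * indicator (I n) t) \<le> ennreal (2 * real (Suc n)) * indicator {0..real (Suc n)} t"
              proof (cases "t \<in> I n")
                case True
                then have "t > 0" "t \<le> real (Suc n)" "1 / real (Suc n) \<le> t"
                  by (auto simp: I_def intro: less_le_trans[of 0 "1 / real (Suc n)"])
                then have "1 / t \<le> real (Suc n)" by (simp add: field_simps)
                then have "ennreal (1 / t * 2) \<le> ennreal (2 * real (Suc n))" by (intro ennreal_leI) simp
                moreover have "ennreal (1 / t * 2) = ennreal (1 / t) * 2"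
                  using \<open>t > 0\<close> by (subst ennreal_mult) auto
                moreover have "ennreal (indicator {0<..} t / t) * (2 * indicator (I n) t) = ennreal (1 / t) * 2"
                  using True \<open>t > 0\<close> by simp
                moreover have "ennreal (2 * real (Suc n)) * indicator {0..real (Suc n)} t = ennreal (2 * real (Suc n))"
                  using \<open>t > 0\<close> \<open>t \<le> real (Suc n)\<close> by (simp add: indicator_def)
                ultimately show ?thesis by (simp only:)
              qed simp
            qed
            also have "\<dots> = ennreal (2 * (real (Suc n) * real (Suc n)))"
              by (simp add: nn_integral_cmult_indicator mult.assoc del: of_nat_Suc flip: ennreal_mult)
            finally show ?thesis .
          qed
          show "(\<integral>\<^sup>+q. ennreal \<bar>LINT y|lborel. ?k p y * ?k q y\<bar> \<partial>?M) \<le> ennreal B" for p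
          proof (cases "fst p \<in> I n")
            case True
            obtain t x where p: "p = (t, x)" by (cases p)
            have t: "t > 0" using True by (auto simp: p I_def intro: less_le_trans[of 0 "1 / real (Suc n)"])
            have "(\<integral>\<^sup>+q. ennreal \<bar>LINT y|lborel. ?k p y * ?k q y\<bar> \<partial>?M) = (\<integral>\<^sup>+s. \<integral>\<^sup>+v. ennreal \<bar>LINT y|lborel. ?k p y * ?k (s, v) y\<bar> \<partial>lborel \<partial>nu)"
              by (intro lborel.nn_integral_fst[symmetric]) measurable
            also have "\<dots> \<le> (\<integral>\<^sup>+s. ennreal (8 * (a + 1)) * ennreal (min (s / t) (t / s) powr e) \<partial>nu)"
            proof (rule nn_integral_mono_AE, rule AE_mp[OF AE_nu_pos], intro AE_I2 impI)
              fix s :: real assume s: "s > 0"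
              have "(\<integral>\<^sup>+v. ennreal \<bar>LINT y|lborel. ?k p y * ?k (s, v) y\<bar> \<partial>lborel) \<le>
                 (\<integral>\<^sup>+v. ennreal \<bar>LINT y|lborel. phi_dil a t (x - y) * phi_dil a s (v - y)\<bar> \<partial>lborel)"
                by (intro nn_integral_mono) (auto simp: p indicator_def)
              also have "\<dots> \<le> ennreal (8 * (a + 1) * min (s / t) (t / s) powr (min a 1))"
                by (intro nn_integral_phi_dil_kernel_le a s t)
              also have "\<dots> = ennreal (8 * (a + 1)) * ennreal (min (s / t) (t / s) powr e)"
                using a by (simp add: e_def ennreal_mult)
              finally show "(\<integral>\<^sup>+v. ennreal \<bar>LINT y|lborel. ?k p y * ?k (s, v) y\<bar> \<partial>lborel) \<le> ennreal (8 * (a + 1)) * ennreal (min (s / t) (t / s) powr e)" .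
            qed
            also have "\<dots> = ennreal (8 * (a + 1)) * (\<integral>\<^sup>+s. ennreal (min (s / t) (t / s) powr e) \<partial>nu)"
              by (intro nn_integral_cmult) measurable
            also have "\<dots> \<le> ennreal (8 * (a + 1)) * ennreal (2 / e)"
              by (intro mult_left_mono nn_integral_nu_min_powr e t) simp
            also have "\<dots> = ennreal B" unfolding B_def using a e by (intro ennreal_mult[symmetric]) auto
            finally show ?thesis .
          qed simp
          show "(\<integral>\<^sup>+y. ennreal ((f y)\<^sup>2) \<partial>lborel) < \<infinity>" using False by (simp add: top.not_eq_extremum)
        qed (auto intro: lborel.sigma_finite_measure_axioms)
        finally show ?thesis .
      qed
      have I_mono: "I n \<subseteq> I m" if "n \<le> m" for n m
        using that by (auto simp: I_def intro: order_trans[rotated] frac_le)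
      have "(\<integral>\<^sup>+x. \<integral>\<^sup>+t. ennreal ((LINT y|lborel. f y * phi_dil a t (x - y))\<^sup>2) \<partial>nu \<partial>lborel) =
          (\<integral>\<^sup>+x. \<integral>\<^sup>+t. ennreal ((T (t, x))\<^sup>2) \<partial>nu \<partial>lborel)" by (simp add: T_def)
      also have "\<dots> = (\<integral>\<^sup>+p. ennreal ((T p)\<^sup>2) \<partial>?M)"
        by (intro nn_integral_snd) measurable
      also have "\<dots> \<le> (\<integral>\<^sup>+p. (SUP n. ennreal ((T p)\<^sup>2) * indicator (I n) (fst p)) \<partial>?M)"
      proof (rule nn_integral_mono_AE)
        have "AE p in ?M. fst p > 0"
        proof (rule AE_pair_measure)
          show "{p \<in> space ?M. 0 < fst p} \<in> sets ?M" by measurable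
          show "AE t in nu. AE x in lborel. 0 < fst (t, x :: real)"
            by (rule AE_mp[OF AE_nu_pos]) simp
        qed
        then show "AE p in ?M. ennreal ((T p)\<^sup>2) \<le> (SUP n. ennreal ((T p)\<^sup>2) * indicator (I n) (fst p))"
        proof eventually_elim
          case (elim p)
          obtain n where n: "max (fst p) (1 / fst p) < real n" using reals_Archimedean2 by blast
          with elim have "fst p \<in> I n" by (auto simp: I_def field_simps)
          then have "ennreal ((T p)\<^sup>2) \<le> ennreal ((T p)\<^sup>2) * indicator (I n) (fst p)" by simp
          then show ?case by (rule SUP_upper2[OF UNIV_I])
        qed
      qed
      also have "\<dots> = (SUP n. (\<integral>\<^sup>+p. ennreal ((T p)\<^sup>2) * indicator (I n) (fst p) \<partial>?M))"
        using I_mono by (intro nn_integral_monotone_convergence_SUP)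
          (auto simp: incseq_def le_fun_def intro!: mult_left_mono split: split_indicator)
      also have "\<dots> \<le> ennreal B * (\<integral>\<^sup>+y. ennreal ((f y)\<^sup>2) \<partial>lborel)"
        by (intro SUP_least bound)
      finally show ?thesis .
    qed
  qed
qed

section \<open>Calderon-Zygmund decomposition on the line\<close>

text \<open>Cells of generation \<open>n\<close> have side \<open>L / 2 ^ n\<close>. The side
  \<open>L\<close> of generation 0 is a parameter, since the decomposition has to start with cells
  that are large compared with the integral of the given function.\<close>

definition dyadic_cell :: "real \<Rightarrow> nat \<Rightarrow> real \<Rightarrow> int" where
  "dyadic_cell L n x = \<lfloor>x / (L / 2 ^ n)\<rfloor>"

definition dyadic_interval :: "real \<Rightarrow> nat \<times> int \<Rightarrow> real set" where
  "dyadic_interval L = (\<lambda>(n, k). {of_int k * (L / 2 ^ n)..<(of_int k + 1) * (L / 2 ^ n)})"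

lemma mem_dyadic_interval:
  assumes "L > 0"
  shows "x \<in> dyadic_interval L (n, k) \<longleftrightarrow> dyadic_cell L n x = k"
proof -
  have "L / 2 ^ n > 0" using assms by simp
  then show ?thesis
    by (simp add: dyadic_interval_def dyadic_cell_def floor_eq_iff pos_le_divide_eq pos_divide_less_eq del: divide_divide_eq_right)
qed

lemma dyadic_cell_Suc: "dyadic_cell L n x = dyadic_cell L (Suc n) x div 2"
proof -
  have "x / (L / 2 ^ n) = x / (L / 2 ^ Suc n) / real_of_int 2" by simp
  then show ?thesis unfolding dyadic_cell_def by (simp only: floor_divide_real_eq_div)
qed

lemma dyadic_cell_antimono:
  "n \<le> m \<Longrightarrow> dyadic_cell L m x = dyadic_cell L m y \<Longrightarrow> dyadic_cell L n x = dyadic_cell L n y"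
proof (induction rule: inc_induct)
  case (step n)
  then show ?case by (simp only: dyadic_cell_Suc[of L n])
qed

lemma sets_dyadic_interval [measurable]: "dyadic_interval L p \<in> sets borel"
  by (simp add: dyadic_interval_def split: prod.split)

lemma emeasure_dyadic_interval:
  assumes "L > 0"
  shows "emeasure lborel (dyadic_interval L (n, k)) = ennreal (L / 2 ^ n)"
proof -
  have "of_int k * (L / 2 ^ n) \<le> (of_int k + 1) * (L / 2 ^ n)"
    using assms by (intro mult_right_mono) auto
  moreover have "(of_int k + 1) * (L / 2 ^ n) - of_int k * (L / 2 ^ n) = L / 2 ^ n"
    by (simp only: left_diff_distrib[symmetric]) simp
  ultimately show ?thesis
    by (simp only: dyadic_interval_def prod.case emeasure_lborel_Ico)
qed

lemma ex_bij_nat_nat_int: "\<exists>e :: nat \<Rightarrow> nat \<times> int. bij e"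
proof -
  have "infinite (UNIV :: (nat \<times> int) set)" by (simp add: finite_prod)
  then show ?thesis using bij_betw_from_nat_into[of "UNIV :: (nat \<times> int) set"] by auto
qed

text \<open>A selected subfamily is indexed by all of \<open>nat\<close>, with the empty set at the
  other indices, so finite and infinite selections need not be distinguished.\<close>

lemma disjoint_family_dyadic:
  assumes e: "inj e" and T: "\<And>p q x. p \<in> T \<Longrightarrow> q \<in> T \<Longrightarrow> x \<in> dyadic_interval L p \<Longrightarrow> x \<in> dyadic_interval L q \<Longrightarrow> p = q"
  shows "disjoint_family (\<lambda>i::nat. if e i \<in> T then dyadic_interval L (e i) else {})"
  unfolding disjoint_family_on_def
proof (intro ballI impI)
  fix m n :: nat assume "m \<noteq> n"
  then have "e m \<noteq> e n" using e by (simp add: inj_eq)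
  then show "(if e m \<in> T then dyadic_interval L (e m) else {}) \<inter> (if e n \<in> T then dyadic_interval L (e n) else {}) = {}"
    using T[of "e m" "e n"] by auto
qed

text \<open>This replaces the Lebesgue differentiation theorem: cover an open set slightly larger than \<open>E\<close>
  by maximal dyadic intervals; on those meeting \<open>E\<close> the average of \<open>h\<close> is at most one, although
  \<open>h \<ge> 1 + d\<close> on \<open>E\<close>.\<close>

lemma dyadic_density:
  fixes h :: "real \<Rightarrow> ennreal"
  assumes L: "L > 0" and [measurable]: "h \<in> borel_measurable borel" and fin: "(\<integral>\<^sup>+x. h x \<partial>lborel) < \<infinity>"
    and d: "d > 0"
    and E [measurable]: "E \<in> sets borel"
    and hE: "\<And>x. x \<in> E \<Longrightarrow> h x \<ge> ennreal (1 + d)"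
    and le: "\<And>x n. x \<in> E \<Longrightarrow> (\<integral>\<^sup>+y\<in>dyadic_interval L (n, dyadic_cell L n x). h y \<partial>lborel) \<le> ennreal (L / 2 ^ n)"
  shows "emeasure lborel E = 0"
proof -
  obtain e :: "nat \<Rightarrow> nat \<times> int" where e: "bij e" using ex_bij_nat_nat_int by blast
  have "emeasure lborel E = (\<integral>\<^sup>+x. indicator E x \<partial>lborel)" by simp
  also have "\<dots> \<le> (\<integral>\<^sup>+x. h x \<partial>lborel)"
  proof (rule nn_integral_mono)
    fix x
    have "1 \<le> h x" if "x \<in> E"
      using order_trans[OF _ hE[OF that], of 1] d by (simp add: ennreal_leI flip: ennreal_1)
    then show "indicator E x \<le> h x" by (auto simp: indicator_def)
  qed
  finally obtain r where r: "r \<ge> 0" "emeasure lborel E = ennreal r"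
    using fin by (cases "emeasure lborel E") (auto simp: top_unique)
  have small: "d * r \<le> \<epsilon>" if \<epsilon>: "\<epsilon> > 0" for \<epsilon>
  proof -
    obtain U where U: "open U" "E \<subseteq> U" "emeasure lborel (U - E) < ennreal \<epsilon>"
      using outer_regular_lborel[OF E \<epsilon>] by blast
    have [measurable]: "U \<in> sets borel" using U by simp
    have ex: "\<exists>n. dyadic_interval L (n, dyadic_cell L n x) \<subseteq> U" if xU: "x \<in> U" for x
    proof -
      obtain \<eta> where \<eta>: "\<eta> > 0" "ball x \<eta> \<subseteq> U" using openE[OF U(1) xU] by blast
      obtain n where "L / \<eta> < 2 ^ n" using real_arch_pow[of 2 "L / \<eta>"] by auto
      then have n: "L / 2 ^ n < \<eta>" using \<eta> by (simp add: field_simps)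
      have "dyadic_interval L (n, dyadic_cell L n x) \<subseteq> ball x \<eta>"
      proof
        fix y assume y: "y \<in> dyadic_interval L (n, dyadic_cell L n x)"
        moreover have "x \<in> dyadic_interval L (n, dyadic_cell L n x)" using L by (simp add: mem_dyadic_interval)
        moreover have "(of_int k + 1) * l = of_int k * l + l" for k :: int and l :: real
          by (simp add: algebra_simps)
        ultimately have "\<bar>x - y\<bar> < L / 2 ^ n"
          by (simp only: dyadic_interval_def prod.case atLeastLessThan_iff) linarith
        with n show "y \<in> ball x \<eta>" by (simp add: dist_real_def)
      qed
      with \<eta> show ?thesis by blast
    qed
    define M where "M x = (LEAST n. dyadic_interval L (n, dyadic_cell L n x) \<subseteq> U)" for x
    define T where "T = (\<lambda>x. (M x, dyadic_cell L (M x) x)) ` E"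
    have M: "dyadic_interval L (M x, dyadic_cell L (M x) x) \<subseteq> U" if "x \<in> U" for x
      unfolding M_def using ex[OF that] by (rule LeastI_ex)
    \<comment> \<open>Every point of the maximal interval of \<open>x\<close> has this same maximal
      interval, because a larger one would also contain \<open>x\<close>. Hence selected intervals
      that meet are equal.\<close>
    have M_eq: "M y = M x" if xU: "x \<in> U" and cell_eq: "dyadic_cell L (M x) y = dyadic_cell L (M x) x" for x y
      unfolding M_def[of y]
    proof (rule Least_equality)
      show "dyadic_interval L (M x, dyadic_cell L (M x) y) \<subseteq> U" using M[OF xU] cell_eq by simp
      show "M x \<le> n" if n_sub: "dyadic_interval L (n, dyadic_cell L n y) \<subseteq> U" for n
      proof (rule ccontr)
        assume n: "\<not> M x \<le> n"
        then have "dyadic_cell L n y = dyadic_cell L n x"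
          by (intro dyadic_cell_antimono[OF _ cell_eq]) simp
        with n_sub have "M x \<le> n" unfolding M_def by (intro Least_le) simp
        with n show False by simp
      qed
    qed
    define J where "J = (\<lambda>i. if e i \<in> T then dyadic_interval L (e i) else {})"
    have J [measurable]: "J i \<in> sets borel" for i by (simp add: J_def)
    have disj: "disjoint_family J"
      unfolding J_def
    proof (rule disjoint_family_dyadic)
      show "inj e" using e by (rule bij_is_inj)
      fix p q z assume *: "p \<in> T" "q \<in> T" "z \<in> dyadic_interval L p" "z \<in> dyadic_interval L q"
      have "p = (M z, dyadic_cell L (M z) z)" if pT: "p \<in> T" and zp: "z \<in> dyadic_interval L p" for p
      proof -
        obtain x where x: "x \<in> E" "p = (M x, dyadic_cell L (M x) x)" using pT by (auto simp: T_def)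
        then have cell: "dyadic_cell L (M x) z = dyadic_cell L (M x) x" using zp L by (simp add: mem_dyadic_interval)
        then have "M z = M x" using x U(2) by (intro M_eq) auto
        with x cell show ?thesis by simp
      qed
      from this[OF *(1,3)] this[OF *(2,4)] show "p = q" by simp
    qed
    have EJ: "E \<subseteq> (\<Union>i. J i)"
    proof
      fix x assume "x \<in> E"
      then have "(M x, dyadic_cell L (M x) x) \<in> T" by (simp add: T_def)
      moreover obtain i where "e i = (M x, dyadic_cell L (M x) x)" using e by (metis bij_pointE)
      ultimately have "x \<in> J i" using L by (simp add: J_def mem_dyadic_interval)
      then show "x \<in> (\<Union>i. J i)" by blast
    qed
    have JU: "(\<Union>i. J i) \<subseteq> U"
      using M U(2) by (auto simp: J_def T_def split: if_splits) blast
    \<comment> \<open>With \<open>r\<close> the measure of \<open>E\<close>: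
      \<open>(1 + d) * r\<close> is at most the integral of \<open>h\<close> over the intervals,
      hence at most their total length, hence at most \<open>r + \<epsilon>\<close>.\<close>
    have "ennreal ((1 + d) * r) = (\<integral>\<^sup>+x. ennreal (1 + d) * indicator E x \<partial>lborel)"
      using r d by (simp add: nn_integral_cmult_indicator ennreal_mult)
    also have "\<dots> \<le> (\<integral>\<^sup>+x\<in>(\<Union>i. J i). h x \<partial>lborel)"
      using EJ hE by (intro nn_integral_mono) (auto simp: indicator_def)
    also have "\<dots> = (\<Sum>i. \<integral>\<^sup>+x\<in>J i. h x \<partial>lborel)"
      by (intro nn_integral_disjoint_family disj) auto
    also have "\<dots> \<le> (\<Sum>i. emeasure lborel (J i))"
      using le L by (intro suminf_le) (auto simp: J_def T_def emeasure_dyadic_interval)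
    also have "\<dots> = emeasure lborel (\<Union>i. J i)"
      using disj by (intro suminf_emeasure) auto
    also have "\<dots> \<le> emeasure lborel (E \<union> (U - E))"
      using JU by (intro emeasure_mono) auto
    also have "\<dots> \<le> emeasure lborel E + emeasure lborel (U - E)"
      by (intro emeasure_subadditive) auto
    also have "\<dots> \<le> ennreal r + ennreal \<epsilon>"
      using r U(3) by (intro add_mono) auto
    also have "\<dots> = ennreal (r + \<epsilon>)" using r \<epsilon> by simp
    finally have "(1 + d) * r \<le> r + \<epsilon>" using r \<epsilon> by (subst (asm) ennreal_le_iff) auto
    then show ?thesis by (simp add: algebra_simps)
  qed
  then have "d * r \<le> 0" by (rule field_le_epsilon[of _ 0, simplified])
  then have "r = 0" using d r by (simp add: mult_le_0_iff)
  then show ?thesis using r by simp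
qed

text \<open>The intervals are the maximal dyadic ones on which the average of \<open>h\<close>
  exceeds 1; the parent of such an interval has average at most 1, so its own average is at most 2.
  In terms of the half length \<open>r i\<close> the bounds read \<open>2 * r i\<close> and
  \<open>4 * r i\<close>. Empty intervals are allowed, which is why the lower bound is not
  strict.\<close>

lemma Calderon_Zygmund_intervals:
  fixes h :: "real \<Rightarrow> ennreal"
  assumes h [measurable]: "h \<in> borel_measurable borel" and fin: "(\<integral>\<^sup>+x. h x \<partial>lborel) < \<infinity>"
  obtains c r :: "nat \<Rightarrow> real" where
    "\<And>i. r i \<ge> 0" "disjoint_family (\<lambda>i. {c i - r i..<c i + r i})"
    "\<And>i. ennreal (2 * r i) \<le> (\<integral>\<^sup>+x\<in>{c i - r i..<c i + r i}. h x \<partial>lborel)"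
    "\<And>i. (\<integral>\<^sup>+x\<in>{c i - r i..<c i + r i}. h x \<partial>lborel) \<le> ennreal (4 * r i)"
    "AE x in lborel. x \<notin> (\<Union>i. {c i - r i..<c i + r i}) \<longrightarrow> h x \<le> 1"
proof -
  obtain L0 where L0: "(\<integral>\<^sup>+x. h x \<partial>lborel) = ennreal L0" "L0 \<ge> 0"
    using fin by (cases "\<integral>\<^sup>+x. h x \<partial>lborel") auto
  \<comment> \<open>With \<open>L\<close> at least the total integral no interval of generation 0 is
    selected, so every selected one has a parent; adding 1 keeps \<open>L\<close> positive if
    \<open>h\<close> vanishes.\<close>
  define L where "L = L0 + 1"
  have L: "L > 0" "(\<integral>\<^sup>+x. h x \<partial>lborel) \<le> ennreal L" using L0 by (auto simp: L_def intro!: ennreal_leI)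
  obtain e :: "nat \<Rightarrow> nat \<times> int" where e: "bij e" using ex_bij_nat_nat_int by blast
  define H where "H p = (\<integral>\<^sup>+x\<in>dyadic_interval L p. h x \<partial>lborel)" for p
  define big where "big n k \<longleftrightarrow> ennreal (L / 2 ^ n) < H (n, k)" for n k
  define T where "T = {(n, k). big n k \<and> (\<forall>m<n. \<forall>x\<in>dyadic_interval L (n, k). \<not> big m (dyadic_cell L m x))}"
  have T_unique: "p = q" if "p \<in> T" "q \<in> T" "x \<in> dyadic_interval L p" "x \<in> dyadic_interval L q" for p q x
  proof -
    obtain n k m j where pq: "p = (n, k)" "q = (m, j)" by (cases p, cases q)
    have "\<not> n < m" "\<not> m < n" using that L by (auto simp: pq T_def mem_dyadic_interval)
    then show ?thesis using that L by (auto simp: pq mem_dyadic_interval)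
  qed
  have H_le: "H (n, k) \<le> ennreal (2 * (L / 2 ^ n))" if "(n, k) \<in> T" for n k
  proof (cases n)
    case 0
    have "H (n, k) \<le> (\<integral>\<^sup>+x. h x \<partial>lborel)" unfolding H_def by (intro nn_integral_mono) (auto simp: indicator_def)
    with L have "H (n, k) \<le> ennreal L" by simp
    then show ?thesis using that by (simp add: 0 T_def big_def)
  next
    case (Suc m)
    \<comment> \<open>The left end point serves as a representative to name the parent
      interval.\<close>
    define x where "x = of_int k * (L / 2 ^ n)"
    have x: "x \<in> dyadic_interval L (n, k)" using L by (simp add: x_def mem_dyadic_interval dyadic_cell_def)
    have sub: "dyadic_interval L (n, k) \<subseteq> dyadic_interval L (m, dyadic_cell L m x)"
    proof
      fix y assume "y \<in> dyadic_interval L (n, k)"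
      then have "dyadic_cell L n y = dyadic_cell L n x" using x L by (simp add: mem_dyadic_interval)
      then have "dyadic_cell L m y = dyadic_cell L m x" by (rule dyadic_cell_antimono[rotated]) (simp add: Suc)
      then show "y \<in> dyadic_interval L (m, dyadic_cell L m x)" using L by (simp add: mem_dyadic_interval)
    qed
    have "H (n, k) \<le> H (m, dyadic_cell L m x)"
      unfolding H_def using sub by (intro nn_integral_mono) (auto simp: indicator_def)
    also have "\<dots> \<le> ennreal (L / 2 ^ m)" using that x Suc by (force simp: T_def big_def not_less)
    finally show ?thesis by (simp add: Suc)
  qed
  \<comment> \<open>Indices that are not selected get half length 0, that is, an empty half-open
    interval.\<close>
  define r where "r i = (if e i \<in> T then L / 2 ^ fst (e i) / 2 else 0)" for i
  define c where "c i = (if e i \<in> T then (of_int (snd (e i)) + 1 / 2) * (L / 2 ^ fst (e i)) else 0)" for i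
  have J: "{c i - r i..<c i + r i} = (if e i \<in> T then dyadic_interval L (e i) else {})" for i
  proof (cases "e i")
    case (Pair n k)
    define l where "l = L / 2 ^ n"
    have "(of_int k + 1 / 2) * l - l / 2 = of_int k * l" "(of_int k + 1 / 2) * l + l / 2 = (of_int k + 1) * l"
      by (simp_all add: algebra_simps)
    then have "{(of_int k + 1 / 2) * l - l / 2..<(of_int k + 1 / 2) * l + l / 2} = dyadic_interval L (n, k)"
      by (simp only: dyadic_interval_def prod.case l_def)
    then show ?thesis by (simp only: c_def r_def Pair fst_conv snd_conv l_def) simp
  qed
  have U: "x \<notin> (\<Union>i. {c i - r i..<c i + r i}) \<Longrightarrow> \<not> big n (dyadic_cell L n x)" for x n
  proof
    assume x: "x \<notin> (\<Union>i. {c i - r i..<c i + r i})" and "big n (dyadic_cell L n x)"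
    define m where "m = (LEAST n. big n (dyadic_cell L n x))"
    have m: "big m (dyadic_cell L m x)" unfolding m_def using \<open>big n _\<close> by (rule LeastI)
    have "\<not> big j (dyadic_cell L j y)" if "j < m" "y \<in> dyadic_interval L (m, dyadic_cell L m x)" for j y
    proof -
      have "dyadic_cell L j y = dyadic_cell L j x"
        using that L by (intro dyadic_cell_antimono[of j m]) (auto simp: mem_dyadic_interval)
      moreover have "\<not> big j (dyadic_cell L j x)"
        using that(1) unfolding m_def by (rule not_less_Least)
      ultimately show ?thesis by simp
    qed
    with m have "(m, dyadic_cell L m x) \<in> T" by (auto simp: T_def)
    moreover obtain i where "e i = (m, dyadic_cell L m x)" using e by (metis bij_pointE)
    ultimately have "x \<in> {c i - r i..<c i + r i}" unfolding J using L by (simp add: mem_dyadic_interval)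
    with x show False by blast
  qed
  show thesis
  proof
    show "r i \<ge> 0" for i using L by (simp add: r_def)
    show "disjoint_family (\<lambda>i. {c i - r i..<c i + r i})"
      unfolding J using T_unique e by (intro disjoint_family_dyadic) (auto simp: bij_is_inj)
    show "ennreal (2 * r i) \<le> (\<integral>\<^sup>+x\<in>{c i - r i..<c i + r i}. h x \<partial>lborel)" for i
      unfolding J by (cases "e i") (auto simp: r_def T_def big_def H_def less_imp_le)
    show "(\<integral>\<^sup>+x\<in>{c i - r i..<c i + r i}. h x \<partial>lborel) \<le> ennreal (4 * r i)" for i
      unfolding J using H_le[of "fst (e i)" "snd (e i)"] by (auto simp: r_def H_def)
    \<comment> \<open>Off the union no dyadic interval around a point has average above 1, so the
      density lemma makes each of these countably many sets null.\<close>
    define E where "E m = {x. x \<notin> (\<Union>i. {c i - r i..<c i + r i}) \<and> ennreal (1 + 1 / real (Suc m)) \<le> h x}" for m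
    have "E m \<in> null_sets lborel" for m
    proof -
      have [measurable]: "E m \<in> sets borel" unfolding E_def by measurable
      have "emeasure lborel (E m) = 0"
      proof (rule dyadic_density[OF L(1) h fin, of "1 / real (Suc m)"])
        show "(\<integral>\<^sup>+y\<in>dyadic_interval L (n, dyadic_cell L n x). h y \<partial>lborel) \<le> ennreal (L / 2 ^ n)" if "x \<in> E m" for x n
          using U[of x n] that by (auto simp: E_def big_def H_def not_less)
      qed (auto simp: E_def)
      then show ?thesis by auto
    qed
    then have "AE x in lborel. \<forall>m. x \<notin> E m"
      by (simp add: AE_all_countable AE_not_in)
    then show "AE x in lborel. x \<notin> (\<Union>i. {c i - r i..<c i + r i}) \<longrightarrow> h x \<le> 1"
    proof (rule AE_mp, intro AE_I2 impI)
      fix x assume x: "\<forall>m. x \<notin> E m" "x \<notin> (\<Union>i. {c i - r i..<c i + r i})"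
      then have *: "h x \<le> ennreal (1 + 1 / real (Suc m))" for m
        by (auto simp: E_def not_le less_imp_le)
      show "h x \<le> 1"
      proof (rule LIMSEQ_le_const)
        have "(\<lambda>m. 1 + 1 / real (Suc m)) \<longlonglongrightarrow> 1 + 0"
          by (intro tendsto_add tendsto_const LIMSEQ_inverse_real_of_nat[unfolded inverse_eq_divide])
        then show "(\<lambda>m. ennreal (1 + 1 / real (Suc m))) \<longlonglongrightarrow> 1"
          using tendsto_ennrealI by fastforce
      qed (use * in blast)
    qed
  qed
qed

section \<open>The weak type estimate in one variable\<close>

lemma nn_integral_conv_phi_dil_finite:
  assumes a: "a > 0" and f: "integrable lborel f"
  shows "(\<integral>\<^sup>+x. \<integral>\<^sup>+y. ennreal \<bar>f y\<bar> * ennreal \<bar>phi_dil a t (x - y)\<bar> \<partial>lborel \<partial>lborel) < \<infinity>"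
proof -
  have [measurable]: "f \<in> borel_measurable borel" using f by simp
  have "(\<integral>\<^sup>+x. \<integral>\<^sup>+y. ennreal \<bar>f y\<bar> * ennreal \<bar>phi_dil a t (x - y)\<bar> \<partial>lborel \<partial>lborel) =
    (\<integral>\<^sup>+y. \<integral>\<^sup>+x. ennreal \<bar>f y\<bar> * ennreal \<bar>phi_dil a t (x - y)\<bar> \<partial>lborel \<partial>lborel)"
    by (intro nn_integral_swap lborel.sigma_finite_measure_axioms) measurable
  also have "\<dots> = (\<integral>\<^sup>+y. ennreal \<bar>f y\<bar> * (\<integral>\<^sup>+x. ennreal \<bar>phi_dil a t (x - y)\<bar> \<partial>lborel) \<partial>lborel)"
    by (intro nn_integral_cong nn_integral_cmult) measurable
  also have "\<dots> \<le> (\<integral>\<^sup>+y. ennreal \<bar>f y\<bar> * 2 \<partial>lborel)"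
    using nn_integral_phi_dil_le[OF a, of t] nn_integral_shift[of "\<lambda>x. ennreal \<bar>phi_dil a t x\<bar>" "- _"]
    by (intro nn_integral_mono mult_left_mono) simp_all
  also have "\<dots> = (\<integral>\<^sup>+y. ennreal \<bar>f y\<bar> \<partial>lborel) * 2"
    by (intro nn_integral_multc) measurable
  also have "\<dots> < \<infinity>" using f by (simp add: integrable_iff_bounded ennreal_mult_less_top)
  finally show ?thesis .
qed

text \<open>Absolute values are taken only after integrating over each \<open>J i\<close>, so
  cancellation within a single interval survives. Off the union the integrand vanishes, and
  countable additivity applies since \<open>f\<close> is integrable.\<close>

lemma ennreal_abs_integral_le_suminf:
  fixes f :: "'a \<Rightarrow> real"
  assumes f: "integrable M f" and J [measurable]: "\<And>i::nat. J i \<in> sets M" and disj: "disjoint_family J"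
    and zero: "\<And>x. x \<in> space M \<Longrightarrow> x \<notin> (\<Union>i. J i) \<Longrightarrow> f x = 0"
  shows "ennreal \<bar>integral\<^sup>L M f\<bar> \<le> (\<Sum>i. ennreal \<bar>LINT x|M. indicator (J i) x * f x\<bar>)"
proof -
  define u where "u i = (LINT x|M. indicator (J i) x * f x)" for i
  have "integral\<^sup>L M f = (LINT x:(\<Union>i. J i)|M. f x)"
    unfolding set_lebesgue_integral_def using zero by (intro Bochner_Integration.integral_cong) (auto simp: indicator_def)
  also have "\<dots> = (\<Sum>i. LINT x:J i|M. f x)"
    using f disj by (intro lebesgue_integral_countable_add) (auto simp: disjoint_family_on_def set_integrable_def simp del: real_scaleR_def intro!: integrable_mult_indicator)
  also have "\<dots> = (\<Sum>i. u i)" by (simp add: u_def set_lebesgue_integral_def)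
  finally have eq: "integral\<^sup>L M f = (\<Sum>i. u i)" .
  show ?thesis
  proof (cases "(\<Sum>i. ennreal \<bar>u i\<bar>) = top")
    case True
    then show ?thesis by (simp add: u_def)
  next
    case False
    then have s: "summable (\<lambda>i. \<bar>u i\<bar>)" by (intro summable_suminf_not_top) auto
    have "\<bar>\<Sum>i. u i\<bar> \<le> (\<Sum>i. \<bar>u i\<bar>)" using s by (rule summable_rabs)
    then have "ennreal \<bar>\<Sum>i. u i\<bar> \<le> ennreal (\<Sum>i. \<bar>u i\<bar>)" by (rule ennreal_leI)
    also have "\<dots> = (\<Sum>i. ennreal \<bar>u i\<bar>)" using s by (intro suminf_ennreal2[symmetric]) auto
    finally show ?thesis by (simp add: eq u_def)
  qed
qed

lemma emeasure_less_le_nn_integral: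
  assumes [measurable]: "u \<in> borel_measurable M" and k: "0 < k"
  shows "emeasure M {x\<in>space M. ennreal (1 / k) < u x} \<le> ennreal k * (\<integral>\<^sup>+x. u x \<partial>M)"
proof -
  have "emeasure M {x\<in>space M. ennreal (1 / k) < u x} \<le> emeasure M {x\<in>space M. 1 \<le> ennreal k * u x}"
  proof (intro emeasure_mono subsetI)
    fix x assume "x \<in> {x\<in>space M. ennreal (1 / k) < u x}"
    then have x: "x \<in> space M" "ennreal (1 / k) \<le> u x" by auto
    have "1 = ennreal k * ennreal (1 / k)" using k by (simp flip: ennreal_mult)
    also have "\<dots> \<le> ennreal k * u x" using x by (intro mult_left_mono) auto
    finally show "x \<in> {x\<in>space M. 1 \<le> ennreal k * u x}" using x by simp
  qed measurable
  also have "\<dots> \<le> ennreal k * (\<integral>\<^sup>+x. u x * indicator (space M) x \<partial>M)"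
    by (intro nn_integral_Markov_inequality) measurable
  also have "(\<integral>\<^sup>+x. u x * indicator (space M) x \<partial>M) = (\<integral>\<^sup>+x. u x \<partial>M)"
    by (intro nn_integral_cong) simp
  finally show ?thesis .
qed

text \<open>For an \<open>L^2\<close> bound, values in \<open>L^2(N)\<close> cost nothing: the
  scalar bound holds for each \<open>w\<close>, and integrating it over \<open>w\<close> keeps the
  constant.\<close>

lemma square_function_L2_bound_vector:
  assumes a: "a > 0"
  shows "\<exists>B>0. \<forall>(N :: 'w measure) F. sigma_finite_measure N \<longrightarrow> (\<lambda>(x, w). F x w) \<in> borel_measurable (lborel \<Otimes>\<^sub>M N) \<longrightarrow>
    (\<integral>\<^sup>+x. \<integral>\<^sup>+w. \<integral>\<^sup>+t. ennreal ((LINT y|lborel. F y w * phi_dil a t (x - y))\<^sup>2) \<partial>nu \<partial>N \<partial>lborel) \<le> ennreal B * (\<integral>\<^sup>+x. \<integral>\<^sup>+w. ennreal ((F x w)\<^sup>2) \<partial>N \<partial>lborel)"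
proof -
  obtain B where B: "B > 0" "\<And>f. f \<in> borel_measurable borel \<Longrightarrow>
    (\<integral>\<^sup>+x. \<integral>\<^sup>+t. ennreal ((LINT y|lborel. f y * phi_dil a t (x - y))\<^sup>2) \<partial>nu \<partial>lborel) \<le> ennreal B * (\<integral>\<^sup>+y. ennreal ((f y)\<^sup>2) \<partial>lborel)"
    using square_function_L2_bound[OF a] by blast
  show ?thesis
  proof (intro exI[of _ B] conjI allI impI B)
    fix N :: "'w measure" and F :: "real \<Rightarrow> 'w \<Rightarrow> real" assume N: "sigma_finite_measure N"
      and F [measurable]: "(\<lambda>(x, w). F x w) \<in> borel_measurable (lborel \<Otimes>\<^sub>M N)"
    interpret N: sigma_finite_measure N by fact
    interpret nu: sigma_finite_measure nu by (rule sigma_finite_nu)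
    note sf = N sigma_finite_nu lborel.sigma_finite_measure_axioms
    have "(\<integral>\<^sup>+x. \<integral>\<^sup>+w. \<integral>\<^sup>+t. ennreal ((LINT y|lborel. F y w * phi_dil a t (x - y))\<^sup>2) \<partial>nu \<partial>N \<partial>lborel) =
      (\<integral>\<^sup>+w. \<integral>\<^sup>+x. \<integral>\<^sup>+t. ennreal ((LINT y|lborel. F y w * phi_dil a t (x - y))\<^sup>2) \<partial>nu \<partial>lborel \<partial>N)"
      by (intro nn_integral_swap sf) measurable
    also have "\<dots> \<le> (\<integral>\<^sup>+w. ennreal B * (\<integral>\<^sup>+x. ennreal ((F x w)\<^sup>2) \<partial>lborel) \<partial>N)"
      by (intro nn_integral_mono B(2)) measurable
    also have "\<dots> = ennreal B * (\<integral>\<^sup>+w. \<integral>\<^sup>+x. ennreal ((F x w)\<^sup>2) \<partial>lborel \<partial>N)"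
      by (intro nn_integral_cmult) measurable
    also have "(\<integral>\<^sup>+w. \<integral>\<^sup>+x. ennreal ((F x w)\<^sup>2) \<partial>lborel \<partial>N) = (\<integral>\<^sup>+x. \<integral>\<^sup>+w. ennreal ((F x w)\<^sup>2) \<partial>N \<partial>lborel)"
      by (intro nn_integral_swap sf) measurable
    finally show "(\<integral>\<^sup>+x. \<integral>\<^sup>+w. \<integral>\<^sup>+t. ennreal ((LINT y|lborel. F y w * phi_dil a t (x - y))\<^sup>2) \<partial>nu \<partial>N \<partial>lborel) \<le>
      ennreal B * (\<integral>\<^sup>+x. \<integral>\<^sup>+w. ennreal ((F x w)\<^sup>2) \<partial>N \<partial>lborel)" .
  qed
qed

lemma ennreal_add_power2_le:
  fixes p q :: ennreal
  shows "(p + q)\<^sup>2 \<le> 2 * p\<^sup>2 + 2 * q\<^sup>2"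
proof (cases p; cases q)
  fix r s assume "0 \<le> r" "p = ennreal r" "0 \<le> s" "q = ennreal s"
  moreover have "(r + s)\<^sup>2 \<le> 2 * r\<^sup>2 + 2 * s\<^sup>2" using sum_squares_bound[of r s] by (simp add: power2_sum)
  ultimately show ?thesis
    by (simp add: ennreal_power ennreal_leI flip: ennreal_plus ennreal_mult ennreal_numeral)
qed (auto simp: power2_eq_square ennreal_top_mult ennreal_mult_top)

text \<open>The argument \<open>q\<close> is the square of a norm, so \<open>Psi\<close> is \<open>min(|F|, |F|\<^sup>2)\<close> as a function of
  \<open>|F|\<^sup>2\<close>.\<close>

definition Psi :: "ennreal \<Rightarrow> ennreal" where
  "Psi q = min q (ennreal_sqrt q)"

lemma measurable_Psi [measurable]: "Psi \<in> borel_measurable borel"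
  unfolding Psi_def by measurable

lemma Psi_eq_sqrt: "1 \<le> ennreal_sqrt q \<Longrightarrow> Psi q = ennreal_sqrt q"
  using mult_left_mono[of 1 "ennreal_sqrt q" "ennreal_sqrt q"] ennreal_sqrt_power2[of q]
  by (simp add: Psi_def power2_eq_square min_absorb2)

lemma Psi_eq: "ennreal_sqrt q \<le> 1 \<Longrightarrow> Psi q = q"
  using mult_left_mono[of "ennreal_sqrt q" 1 "ennreal_sqrt q"] ennreal_sqrt_power2[of q]
  by (simp add: Psi_def power2_eq_square min_absorb1)

text \<open>The intervals \<open>J i\<close> come from the part of the norm \<open>S\<close> of \<open>F\<close> above height one, while on each
  \<open>J i\<close> the whole of \<open>F\<close> is replaced by its average. The good part thus keeps the values of norm at
  most one, which enter quadratically.\<close>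

locale CZ_setup =
  fixes a :: real and N :: "'w measure" and F :: "real \<Rightarrow> 'w \<Rightarrow> real" and c r :: "nat \<Rightarrow> real"
    and H S h :: "real \<Rightarrow> ennreal" and J :: "nat \<Rightarrow> real set" and U :: "real set"
  defines "H \<equiv> \<lambda>x. \<integral>\<^sup>+w. ennreal ((F x w)\<^sup>2) \<partial>N"
    and "S \<equiv> \<lambda>x. ennreal_sqrt (H x)"
    and "h \<equiv> \<lambda>x. S x * indicator {x. 1 < S x} x"
    and "J \<equiv> \<lambda>i. {c i - r i..<c i + r i}"
    and "U \<equiv> \<Union>i. J i"
  assumes a: "a > 1/2" and N: "sigma_finite_measure N"
    and F [measurable]: "(\<lambda>(x, w). F x w) \<in> borel_measurable (lborel \<Otimes>\<^sub>M N)"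
    and Fint: "AE w in N. integrable lborel (\<lambda>x. F x w)"
    and r: "\<And>i. r i \<ge> 0"
    and disj: "disjoint_family J"
    and lower: "\<And>i. ennreal (2 * r i) \<le> (\<integral>\<^sup>+x\<in>J i. h x \<partial>lborel)"
    and upper: "\<And>i. (\<integral>\<^sup>+x\<in>J i. h x \<partial>lborel) \<le> ennreal (4 * r i)"
    and off: "AE x in lborel. x \<notin> U \<longrightarrow> h x \<le> 1"
begin

sublocale N: sigma_finite_measure N by (rule N)
sublocale nu: sigma_finite_measure nu by (rule sigma_finite_nu)

lemma measurable_F_section [measurable]: "w \<in> space N \<Longrightarrow> (\<lambda>x. F x w) \<in> borel_measurable borel"
  using measurable_compose_Pair1[OF _ measurable_pair_swap[OF F], of w] by simp

lemma measurable_H [measurable]: "H \<in> borel_measurable borel"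
proof -
  have "H \<in> borel_measurable lborel" unfolding H_def by measurable
  then show ?thesis by simp
qed

lemma measurable_S [measurable]: "S \<in> borel_measurable borel"
  unfolding S_def by measurable

lemma measurable_h [measurable]: "h \<in> borel_measurable borel"
  unfolding h_def by measurable

lemma sets_J [measurable]: "J i \<in> sets borel" by (simp add: J_def)

lemma sets_U [measurable]: "U \<in> sets borel" unfolding U_def by measurable

lemma emeasure_J: "emeasure lborel (J i) = ennreal (2 * r i)"
  using r[of i] by (simp add: J_def)

definition K :: ennreal where "K = (\<integral>\<^sup>+x. Psi (H x) \<partial>lborel)"

lemma h_le_Psi: "h x \<le> Psi (H x)"
  using Psi_eq_sqrt[of "H x"] by (auto simp: h_def S_def indicator_def)

lemma S_le: "S x \<le> h x + 1"
  by (auto simp: h_def indicator_def not_less)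

lemma sum_int_h: "(\<Sum>i. \<integral>\<^sup>+x\<in>J i. h x \<partial>lborel) \<le> K"
proof -
  have "(\<Sum>i. \<integral>\<^sup>+x\<in>J i. h x \<partial>lborel) = (\<integral>\<^sup>+x\<in>(\<Union>i. J i). h x \<partial>lborel)"
    by (intro nn_integral_disjoint_family[symmetric] disj) auto
  also have "\<dots> \<le> K" unfolding K_def
    using h_le_Psi by (intro nn_integral_mono) (auto simp: indicator_def)
  finally show ?thesis .
qed

text \<open>The lower stopping bound converts length into mass of \<open>h\<close>, and
  \<open>h\<close> lies below the gauge.\<close>

lemma sum_r: "(\<Sum>i. ennreal (2 * r i)) \<le> K"
  by (rule order_trans[OF suminf_le sum_int_h]) (auto simp: lower)

lemma emeasure_U: "emeasure lborel U \<le> K"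
proof -
  have "emeasure lborel U = (\<Sum>i. emeasure lborel (J i))"
    unfolding U_def using disj by (intro suminf_emeasure[symmetric]) auto
  then show ?thesis using sum_r by (simp add: emeasure_J)
qed

text \<open>The part of the norm above height one contributes \<open>4 * r i\<close>, the rest at
  most the length \<open>2 * r i\<close>; on nonempty intervals the norm thus averages at most
  3.\<close>

lemma int_S: "(\<integral>\<^sup>+x\<in>J i. S x \<partial>lborel) \<le> ennreal (6 * r i)"
proof -
  have "(\<integral>\<^sup>+x\<in>J i. S x \<partial>lborel) \<le> (\<integral>\<^sup>+x. h x * indicator (J i) x + indicator (J i) x \<partial>lborel)"
    using S_le by (intro nn_integral_mono) (auto simp: indicator_def)
  also have "\<dots> = (\<integral>\<^sup>+x\<in>J i. h x \<partial>lborel) + emeasure lborel (J i)"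
    by (subst nn_integral_add) auto
  also have "\<dots> \<le> ennreal (4 * r i) + ennreal (2 * r i)"
    using upper[of i] by (intro add_mono) (auto simp: emeasure_J)
  also have "\<dots> = ennreal (6 * r i)" using r[of i] by (simp flip: ennreal_plus)
  finally show ?thesis .
qed

section \<open>Replacement of the function by its averages: good and bad part\<close>

definition idx :: "real \<Rightarrow> nat" where "idx x = (LEAST i. x \<in> J i)"

text \<open>By disjointness the least index is the only one. Outside \<open>U\<close> the value of
  \<open>idx\<close> is unspecified, so the estimates involve it only for points of
  \<open>U\<close>.\<close>

lemma idx_eq: "x \<in> J i \<Longrightarrow> idx x = i"
  unfolding idx_def using disj unfolding disjoint_family_on_def disjoint_iff
  by (intro Least_equality) (auto, metis order_refl)

lemma measurable_idx [measurable]: "idx \<in> borel \<rightarrow>\<^sub>M count_space UNIV"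
  unfolding idx_def by measurable

text \<open>For an empty interval, where \<open>r i = 0\<close>, the quotient has the value
  0.\<close>

definition avg :: "nat \<Rightarrow> 'w \<Rightarrow> real" where
  "avg i w = (LINT y|lborel. indicator (J i) y * F y w) / (2 * r i)"

definition good :: "real \<Rightarrow> 'w \<Rightarrow> real" where
  "good x w = (if x \<in> U then avg (idx x) w else F x w)"

definition bad :: "real \<Rightarrow> 'w \<Rightarrow> real" where "bad x w = F x w - good x w"

lemma measurable_avg [measurable]: "avg i \<in> borel_measurable N"
  unfolding avg_def by measurable

lemma measurable_avg_idx [measurable]: "(\<lambda>(x, w). avg (idx x) w) \<in> borel_measurable (lborel \<Otimes>\<^sub>M N)"
  unfolding case_prod_beta
  by (rule measurable_compose_countable[where f = "\<lambda>i p. avg i (snd p)" and g = "\<lambda>p. idx (fst p)"]) measurable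

lemma measurable_good [measurable]: "(\<lambda>(x, w). good x w) \<in> borel_measurable (lborel \<Otimes>\<^sub>M N)"
  unfolding good_def by measurable

lemma measurable_bad [measurable]: "(\<lambda>(x, w). bad x w) \<in> borel_measurable (lborel \<Otimes>\<^sub>M N)"
  unfolding bad_def by measurable

lemma bad_eq_0: "x \<notin> U \<Longrightarrow> bad x w = 0"
  by (simp add: bad_def good_def)

lemma mem_U: "x \<in> J i \<Longrightarrow> x \<in> U"
  by (auto simp: U_def)

text \<open>By Minkowski the norm of an average is at most the average of the norms, which is at
  most 3.\<close>

lemma avg_sq: "(\<integral>\<^sup>+w. ennreal ((avg i w)\<^sup>2) \<partial>N) \<le> 9"
proof (cases "r i = 0")
  case False
  then have ri: "r i > 0" using r[of i] by simp
  let ?A = "\<lambda>w. \<integral>\<^sup>+y. ennreal \<bar>F y w\<bar> * indicator (J i) y \<partial>lborel"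
  have "(\<integral>\<^sup>+w. ennreal ((avg i w)\<^sup>2) \<partial>N) \<le> (\<integral>\<^sup>+w. (ennreal (1 / (2 * r i)))\<^sup>2 * (?A w)\<^sup>2 \<partial>N)"
  proof (rule nn_integral_mono)
    fix w
    have "ennreal \<bar>avg i w\<bar> = ennreal (1 / (2 * r i)) * ennreal \<bar>LINT y|lborel. indicator (J i) y * F y w\<bar>"
      using ri by (simp add: avg_def flip: ennreal_mult)
    also have "\<dots> \<le> ennreal (1 / (2 * r i)) * ?A w"
      using ennreal_abs_integral_le[of lborel "\<lambda>y. indicator (J i) y * F y w"]
      by (intro mult_left_mono) (auto simp: abs_mult ennreal_mult mult.commute ennreal_indicator)
    finally have "(ennreal \<bar>avg i w\<bar>)\<^sup>2 \<le> (ennreal (1 / (2 * r i)) * ?A w)\<^sup>2"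
      by (rule power_mono_ennreal)
    then show "ennreal ((avg i w)\<^sup>2) \<le> (ennreal (1 / (2 * r i)))\<^sup>2 * (?A w)\<^sup>2"
      by (simp only: ennreal_abs_power2 power_mult_distrib)
  qed
  also have "\<dots> = (ennreal (1 / (2 * r i)))\<^sup>2 * (\<integral>\<^sup>+w. (?A w)\<^sup>2 \<partial>N)"
    by (intro nn_integral_cmult) measurable
  also have "(\<integral>\<^sup>+w. (?A w)\<^sup>2 \<partial>N) \<le> (\<integral>\<^sup>+y. ennreal_sqrt (\<integral>\<^sup>+w. (ennreal \<bar>F y w\<bar> * indicator (J i) y)\<^sup>2 \<partial>N) \<partial>lborel)\<^sup>2"
    by (intro Minkowski_nn_integral lborel.sigma_finite_measure_axioms N) measurable
  also have "(\<integral>\<^sup>+y. ennreal_sqrt (\<integral>\<^sup>+w. (ennreal \<bar>F y w\<bar> * indicator (J i) y)\<^sup>2 \<partial>N) \<partial>lborel) = (\<integral>\<^sup>+y\<in>J i. S y \<partial>lborel)"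
    by (intro nn_integral_cong) (auto simp: indicator_def S_def H_def ennreal_abs_power2 ennreal_sqrt_def)
  also have "(\<integral>\<^sup>+y\<in>J i. S y \<partial>lborel)\<^sup>2 \<le> (ennreal (6 * r i))\<^sup>2"
    by (intro power_mono_ennreal int_S)
  also have "(ennreal (1 / (2 * r i)))\<^sup>2 * (ennreal (6 * r i))\<^sup>2 = (ennreal 3)\<^sup>2"
    using ri by (simp add: power_mult_distrib[symmetric] flip: ennreal_mult)
  also have "(ennreal 3)\<^sup>2 = 9" by (simp add: ennreal_power)
  finally show ?thesis by (simp add: mult_left_mono)
qed (simp add: avg_def)

text \<open>On \<open>U\<close> the squared norm is at most 9 and the measure is at most
  \<open>K\<close>. Off \<open>U\<close> the bound \<open>h <= 1\<close> forces
  \<open>S <= 1\<close>, because \<open>h\<close> equals \<open>S\<close> wherever \<open>S\<close>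
  exceeds 1; for such values the gauge is the square itself.\<close>

lemma good_sq: "(\<integral>\<^sup>+x. \<integral>\<^sup>+w. ennreal ((good x w)\<^sup>2) \<partial>N \<partial>lborel) \<le> 10 * K"
proof -
  have "(\<integral>\<^sup>+x. \<integral>\<^sup>+w. ennreal ((good x w)\<^sup>2) \<partial>N \<partial>lborel) \<le> (\<integral>\<^sup>+x. 9 * indicator U x + Psi (H x) \<partial>lborel)"
  proof (rule nn_integral_mono_AE, rule AE_mp[OF off], intro AE_I2 impI)
    fix x assume x: "x \<notin> U \<longrightarrow> h x \<le> 1"
    show "(\<integral>\<^sup>+w. ennreal ((good x w)\<^sup>2) \<partial>N) \<le> 9 * indicator U x + Psi (H x)"
    proof (cases "x \<in> U")
      case True
      then show ?thesis using avg_sq[of "idx x"] by (auto simp: good_def intro: add_increasing2)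
    next
      case False
      with x have "S x \<le> 1" by (auto simp: h_def indicator_def not_less[symmetric] split: if_splits)
      then have "Psi (H x) = H x" by (simp add: S_def Psi_eq)
      then show ?thesis using False by (simp add: good_def H_def)
    qed
  qed
  also have "\<dots> = 9 * emeasure lborel U + K"
    unfolding K_def by (subst nn_integral_add) (auto simp: nn_integral_cmult_indicator)
  also have "\<dots> \<le> 9 * K + 1 * K"
    by (intro add_mono mult_left_mono emeasure_U) auto
  also have "\<dots> = 10 * K" by (simp only: distrib_right[symmetric]) simp
  finally show ?thesis .
qed

section \<open>Norm of the bad part and its convolution with the kernel\<close>

definition beta :: "real \<Rightarrow> ennreal" where
  "beta y = ennreal_sqrt (\<integral>\<^sup>+w. ennreal ((bad y w)\<^sup>2) \<partial>N)"

lemma measurable_beta [measurable]: "beta \<in> borel_measurable borel"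
proof -
  have "beta \<in> borel_measurable lborel" unfolding beta_def by measurable
  then show ?thesis by simp
qed

text \<open>A crude triangle inequality, carried out with squares to remain inside
  \<open>ennreal\<close>: \<open>2 * S^2 + 2 * 9 <= (2 * S + 6)^2\<close>.\<close>

lemma beta_le: "y \<in> U \<Longrightarrow> beta y \<le> 2 * S y + 6"
proof -
  assume y: "y \<in> U"
  have [measurable]: "(\<lambda>w. F y w) \<in> borel_measurable N" by measurable
  have "(\<integral>\<^sup>+w. ennreal ((bad y w)\<^sup>2) \<partial>N) \<le> (\<integral>\<^sup>+w. 2 * ennreal ((F y w)\<^sup>2) + 2 * ennreal ((avg (idx y) w)\<^sup>2) \<partial>N)"
  proof (rule nn_integral_mono)
    fix w
    have "(bad y w)\<^sup>2 \<le> 2 * (F y w)\<^sup>2 + 2 * (avg (idx y) w)\<^sup>2"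
      using y sum_squares_bound[of "F y w" "- avg (idx y) w"] by (simp add: bad_def good_def power2_diff)
    then show "ennreal ((bad y w)\<^sup>2) \<le> 2 * ennreal ((F y w)\<^sup>2) + 2 * ennreal ((avg (idx y) w)\<^sup>2)"
      by (simp add: ennreal_leI flip: ennreal_plus ennreal_mult ennreal_numeral)
  qed
  also have "\<dots> = 2 * H y + 2 * (\<integral>\<^sup>+w. ennreal ((avg (idx y) w)\<^sup>2) \<partial>N)"
    unfolding H_def by (subst nn_integral_add) (auto simp: nn_integral_cmult)
  also have "\<dots> \<le> 2 * H y + 2 * 9"
    by (intro add_mono mult_left_mono avg_sq) auto
  also have "\<dots> \<le> (2 * S y + 6)\<^sup>2"
  proof -
    have H_eq: "H y = (S y)\<^sup>2" by (simp add: S_def)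
    show ?thesis
    proof (cases "S y")
      case (real s)
      then have "2 * s\<^sup>2 + 2 * 9 \<le> (2 * s + 6)\<^sup>2" by (simp add: power2_eq_square algebra_simps)
      then show ?thesis unfolding H_eq using real
        by (simp add: ennreal_power ennreal_leI flip: ennreal_plus ennreal_mult ennreal_numeral)
    qed (simp add: power2_eq_square ennreal_mult_top)
  qed
  finally have "ennreal_sqrt (\<integral>\<^sup>+w. ennreal ((bad y w)\<^sup>2) \<partial>N) \<le> ennreal_sqrt ((2 * S y + 6)\<^sup>2)"
    by (simp only: ennreal_sqrt_le_iff)
  then show ?thesis unfolding beta_def by (simp only: ennreal_sqrt_of_power2)
qed

lemma int_beta: "(\<integral>\<^sup>+y\<in>U. beta y \<partial>lborel) \<le> 12 * K"
proof -
  have "(\<integral>\<^sup>+y\<in>U. beta y \<partial>lborel) = (\<Sum>i. \<integral>\<^sup>+y\<in>J i. beta y \<partial>lborel)"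
    unfolding U_def by (intro nn_integral_disjoint_family disj) auto
  also have "\<dots> \<le> (\<Sum>i. 12 * ennreal (2 * r i))"
  proof (rule suminf_le)
    fix i
    have "(\<integral>\<^sup>+y\<in>J i. beta y \<partial>lborel) \<le> (\<integral>\<^sup>+y. 2 * (S y * indicator (J i) y) + 6 * indicator (J i) y \<partial>lborel)"
      using beta_le mem_U by (intro nn_integral_mono) (auto simp: indicator_def)
    also have "\<dots> = 2 * (\<integral>\<^sup>+y\<in>J i. S y \<partial>lborel) + 6 * emeasure lborel (J i)"
      by (subst nn_integral_add) (auto simp: nn_integral_cmult nn_integral_cmult_indicator)
    also have "\<dots> \<le> 2 * ennreal (6 * r i) + 6 * ennreal (2 * r i)"
      by (intro add_mono mult_left_mono int_S) (auto simp: emeasure_J)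
    \<comment> \<open>Both terms equal \<open>12 * r i\<close>; the sum is written as a multiple of
      the interval length \<open>2 * r i\<close>.\<close>
    also have "\<dots> = 12 * ennreal (2 * r i)"
      using r[of i] by (simp flip: ennreal_numeral ennreal_mult ennreal_plus)
    finally show "(\<integral>\<^sup>+y\<in>J i. beta y \<partial>lborel) \<le> 12 * ennreal (2 * r i)" .
  qed auto
  also have "\<dots> = 12 * (\<Sum>i. ennreal (2 * r i))" by (rule ennreal_suminf_cmult)
  also have "\<dots> \<le> 12 * K" by (intro mult_left_mono sum_r) auto
  finally show ?thesis .
qed

text \<open>Majorant of the convolution with the bad part once the mean zero property has been
  spent: on each interval the kernel at the centre is subtracted, and the absolute value stands
  inside, ready for Minkowski's inequality.\<close>

definition Bmaj :: "real \<Rightarrow> 'w \<Rightarrow> real \<Rightarrow> ennreal" where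
  "Bmaj x w t = (\<integral>\<^sup>+y\<in>U. ennreal \<bar>bad y w\<bar> * ennreal \<bar>phi_dil a t (x - y) - phi_dil a t (x - c (idx y))\<bar> \<partial>lborel)"

text \<open>Absolute convergence at the point, as needed to split the convolution into good and bad
  part and the latter into intervals. The first condition makes the averages meaningful.\<close>

definition regular :: "real \<Rightarrow> 'w \<Rightarrow> real \<Rightarrow> bool" where
  "regular x w t \<longleftrightarrow> (\<integral>\<^sup>+y. ennreal \<bar>F y w\<bar> \<partial>lborel) < \<infinity> \<and>
     (\<integral>\<^sup>+y. ennreal \<bar>good y w\<bar> * ennreal \<bar>phi_dil a t (x - y)\<bar> \<partial>lborel) < \<infinity> \<and>
     (\<integral>\<^sup>+y. ennreal \<bar>bad y w\<bar> * ennreal \<bar>phi_dil a t (x - y)\<bar> \<partial>lborel) < \<infinity>"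

lemma measurable_c_idx [measurable]: "(\<lambda>y. c (idx y)) \<in> borel_measurable borel"
  by (rule measurable_compose_countable[where f = "\<lambda>i _. c i"]) measurable

lemma bad_mean_zero:
  assumes w: "integrable lborel (\<lambda>x. F x w)"
  shows "integrable lborel (\<lambda>y. indicator (J i) y * bad y w)" "(LINT y|lborel. indicator (J i) y * bad y w) = 0"
proof -
  have eq: "indicator (J i) y * bad y w = indicator (J i) y *\<^sub>R F y w - avg i w * indicator (J i) y" for y
    using idx_eq[of y i] mem_U[of y i] by (auto simp: indicator_def bad_def good_def)
  have 1: "integrable lborel (\<lambda>y. indicator (J i) y *\<^sub>R F y w)"
    using w by (intro integrable_mult_indicator) auto
  have 2: "integrable lborel (\<lambda>y. avg i w * indicator (J i) y)"
    by (intro integrable_mult_right integrable_real_indicator) (auto simp: emeasure_J)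
  show "integrable lborel (\<lambda>y. indicator (J i) y * bad y w)" unfolding eq using 1 2 by (rule Bochner_Integration.integrable_diff)
  have "(LINT y|lborel. indicator (J i) y * bad y w) = (LINT y|lborel. indicator (J i) y * F y w) - avg i w * measure lborel (J i)"
    unfolding eq using 1 2 by (subst Bochner_Integration.integral_diff) auto
  also have "\<dots> = 0"
  proof (cases "r i = 0")
    case True
    then show ?thesis by (simp add: J_def)
  next
    case False
    then show ?thesis using r[of i] by (simp add: avg_def J_def)
  qed
  finally show "(LINT y|lborel. indicator (J i) y * bad y w) = 0" .
qed

text \<open>On each \<open>J i\<close> the bad part has mean zero, so the constant
  \<open>phi_dil a t (x - c i)\<close> may be subtracted under the integral before absolute values
  are taken.\<close>

lemma bad_part_le:
  assumes w: "w \<in> space N" and reg: "regular x w t"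
  shows "ennreal \<bar>LINT y|lborel. bad y w * phi_dil a t (x - y)\<bar> \<le> Bmaj x w t"
proof -
  note [measurable] = w
  have [measurable]: "(\<lambda>y. bad y w) \<in> borel_measurable borel"
    using measurable_compose_Pair1[OF w measurable_pair_swap[OF measurable_bad]] by simp
  have Fw: "integrable lborel (\<lambda>x. F x w)"
    using reg by (intro integrableI_bounded) (auto simp: regular_def)
  have int: "integrable lborel (\<lambda>y. bad y w * phi_dil a t (x - y))"
    using reg by (intro integrableI_bounded) (auto simp: regular_def abs_mult ennreal_mult)
  have "ennreal \<bar>LINT y|lborel. bad y w * phi_dil a t (x - y)\<bar> \<le>
      (\<Sum>i. ennreal \<bar>LINT y|lborel. indicator (J i) y * (bad y w * phi_dil a t (x - y))\<bar>)"
    using int disj by (intro ennreal_abs_integral_le_suminf) (auto simp: bad_eq_0 U_def)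
  also have "\<dots> \<le> (\<Sum>i. \<integral>\<^sup>+y\<in>J i. ennreal \<bar>bad y w\<bar> * ennreal \<bar>phi_dil a t (x - y) - phi_dil a t (x - c (idx y))\<bar> \<partial>lborel)"
  proof (rule suminf_le)
    fix i
    have int_i: "integrable lborel (\<lambda>y. indicator (J i) y * (bad y w * phi_dil a t (x - y)))"
      using integrable_mult_indicator[OF _ int, of "J i"] by simp
    have int_c: "integrable lborel (\<lambda>y. indicator (J i) y * bad y w * phi_dil a t (x - c i))"
      using bad_mean_zero(1)[OF Fw, of i] by (rule integrable_mult_left)
    have "(LINT y|lborel. indicator (J i) y * bad y w * phi_dil a t (x - c i)) = 0"
      using bad_mean_zero(2)[OF Fw, of i] by simp
    then have "(LINT y|lborel. indicator (J i) y * (bad y w * phi_dil a t (x - y))) =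
        (LINT y|lborel. indicator (J i) y * (bad y w * phi_dil a t (x - y)) - indicator (J i) y * bad y w * phi_dil a t (x - c i))"
      using int_i int_c by (subst Bochner_Integration.integral_diff) auto
    also have "\<dots> = (LINT y|lborel. indicator (J i) y * (bad y w * (phi_dil a t (x - y) - phi_dil a t (x - c (idx y)))))"
      by (intro Bochner_Integration.integral_cong) (auto simp: indicator_def idx_eq algebra_simps)
    finally have "ennreal \<bar>LINT y|lborel. indicator (J i) y * (bad y w * phi_dil a t (x - y))\<bar> \<le>
        (\<integral>\<^sup>+y. ennreal \<bar>indicator (J i) y * (bad y w * (phi_dil a t (x - y) - phi_dil a t (x - c (idx y))))\<bar> \<partial>lborel)"
      by (simp only: ennreal_abs_integral_le)
    also have "\<dots> = (\<integral>\<^sup>+y\<in>J i. ennreal \<bar>bad y w\<bar> * ennreal \<bar>phi_dil a t (x - y) - phi_dil a t (x - c (idx y))\<bar> \<partial>lborel)"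
      by (intro nn_integral_cong) (auto simp: indicator_def abs_mult ennreal_mult)
    finally show "ennreal \<bar>LINT y|lborel. indicator (J i) y * (bad y w * phi_dil a t (x - y))\<bar> \<le>
      (\<integral>\<^sup>+y\<in>J i. ennreal \<bar>bad y w\<bar> * ennreal \<bar>phi_dil a t (x - y) - phi_dil a t (x - c (idx y))\<bar> \<partial>lborel)" .
  qed auto
  also have "\<dots> = Bmaj x w t"
    unfolding Bmaj_def U_def by (intro nn_integral_disjoint_family[symmetric] disj) auto
  finally show ?thesis .
qed

lemma conv_split:
  assumes w: "w \<in> space N" and reg: "regular x w t"
  shows "ennreal ((LINT y|lborel. F y w * phi_dil a t (x - y))\<^sup>2) \<le>
    2 * ennreal ((LINT y|lborel. good y w * phi_dil a t (x - y))\<^sup>2) + 2 * (Bmaj x w t)\<^sup>2"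
proof -
  note [measurable] = w
  have [measurable]: "(\<lambda>y. bad y w) \<in> borel_measurable borel" "(\<lambda>y. good y w) \<in> borel_measurable borel"
    using measurable_compose_Pair1[OF w measurable_pair_swap[OF measurable_bad]]
      measurable_compose_Pair1[OF w measurable_pair_swap[OF measurable_good]] by simp_all
  let ?g = "LINT y|lborel. good y w * phi_dil a t (x - y)" and ?b = "LINT y|lborel. bad y w * phi_dil a t (x - y)"
  have "integrable lborel (\<lambda>y. bad y w * phi_dil a t (x - y))" "integrable lborel (\<lambda>y. good y w * phi_dil a t (x - y))"
    using reg by (auto intro!: integrableI_bounded simp: regular_def abs_mult ennreal_mult)
  then have "?g + ?b = (LINT y|lborel. good y w * phi_dil a t (x - y) + bad y w * phi_dil a t (x - y))"
    by simp
  also have "\<dots> = (LINT y|lborel. F y w * phi_dil a t (x - y))"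
    by (simp add: bad_def algebra_simps)
  finally have eq: "(LINT y|lborel. F y w * phi_dil a t (x - y)) = ?g + ?b" by simp
  have "ennreal \<bar>?g + ?b\<bar> \<le> ennreal \<bar>?g\<bar> + ennreal \<bar>?b\<bar>"
    by (simp add: ennreal_leI flip: ennreal_plus)
  also have "\<dots> \<le> ennreal \<bar>?g\<bar> + Bmaj x w t"
    by (intro add_mono bad_part_le assms) simp
  finally have "(ennreal \<bar>?g + ?b\<bar>)\<^sup>2 \<le> (ennreal \<bar>?g\<bar> + Bmaj x w t)\<^sup>2" by (rule power_mono_ennreal)
  also have "\<dots> \<le> 2 * (ennreal \<bar>?g\<bar>)\<^sup>2 + 2 * (Bmaj x w t)\<^sup>2" by (rule ennreal_add_power2_le)
  finally show ?thesis by (simp only: ennreal_abs_power2 eq)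
qed

text \<open>For fixed \<open>w\<close>, averaging over each \<open>J i\<close> does not increase the
  \<open>L^1\<close> norm there, and off \<open>U\<close> nothing is changed.\<close>

lemma good_bad_integrable:
  assumes w: "w \<in> space N" and Fw: "integrable lborel (\<lambda>x. F x w)"
  shows "integrable lborel (\<lambda>x. good x w)" "integrable lborel (\<lambda>x. bad x w)"
proof -
  note [measurable] = w
  have [measurable]: "(\<lambda>y. good y w) \<in> borel_measurable borel"
    using measurable_compose_Pair1[OF w measurable_pair_swap[OF measurable_good]] by simp
  have Ffin: "(\<integral>\<^sup>+x. ennreal \<bar>F x w\<bar> \<partial>lborel) < \<infinity>" using Fw by (simp add: integrable_iff_bounded)
  have "(\<integral>\<^sup>+x. ennreal \<bar>good x w\<bar> \<partial>lborel) \<le> (\<integral>\<^sup>+x. ennreal \<bar>good x w\<bar> * indicator U x + ennreal \<bar>F x w\<bar> \<partial>lborel)"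
    by (intro nn_integral_mono) (auto simp: good_def)
  also have "\<dots> = (\<integral>\<^sup>+x\<in>U. ennreal \<bar>good x w\<bar> \<partial>lborel) + (\<integral>\<^sup>+x. ennreal \<bar>F x w\<bar> \<partial>lborel)"
    by (intro nn_integral_add) measurable
  also have "(\<integral>\<^sup>+x\<in>U. ennreal \<bar>good x w\<bar> \<partial>lborel) = (\<Sum>i. \<integral>\<^sup>+x\<in>J i. ennreal \<bar>good x w\<bar> \<partial>lborel)"
    unfolding U_def by (intro nn_integral_disjoint_family disj) auto
  also have "\<dots> \<le> (\<Sum>i. \<integral>\<^sup>+x\<in>J i. ennreal \<bar>F x w\<bar> \<partial>lborel)"
  proof (rule suminf_le)
    fix i
    have "(\<integral>\<^sup>+x\<in>J i. ennreal \<bar>good x w\<bar> \<partial>lborel) = (\<integral>\<^sup>+x. ennreal \<bar>avg i w\<bar> * indicator (J i) x \<partial>lborel)"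
      by (intro nn_integral_cong) (auto simp: indicator_def good_def idx_eq mem_U)
    also have "\<dots> = ennreal \<bar>avg i w\<bar> * ennreal (2 * r i)"
      by (simp add: nn_integral_cmult_indicator emeasure_J)
    also have "\<dots> \<le> ennreal \<bar>LINT y|lborel. indicator (J i) y * F y w\<bar>"
      using r[of i] by (cases "r i = 0") (auto simp: avg_def simp flip: ennreal_mult)
    also have "\<dots> \<le> (\<integral>\<^sup>+x. ennreal \<bar>indicator (J i) x * F x w\<bar> \<partial>lborel)" by (rule ennreal_abs_integral_le)
    also have "\<dots> = (\<integral>\<^sup>+x\<in>J i. ennreal \<bar>F x w\<bar> \<partial>lborel)"
      by (intro nn_integral_cong) (auto simp: indicator_def)
    finally show "(\<integral>\<^sup>+x\<in>J i. ennreal \<bar>good x w\<bar> \<partial>lborel) \<le> (\<integral>\<^sup>+x\<in>J i. ennreal \<bar>F x w\<bar> \<partial>lborel)" .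
  qed auto
  also have "\<dots> = (\<integral>\<^sup>+x\<in>(\<Union>i. J i). ennreal \<bar>F x w\<bar> \<partial>lborel)"
    by (intro nn_integral_disjoint_family[symmetric] disj) auto
  also have "\<dots> \<le> (\<integral>\<^sup>+x. ennreal \<bar>F x w\<bar> \<partial>lborel)"
    by (intro nn_integral_mono) (auto simp: indicator_def)
  finally have "(\<integral>\<^sup>+x. ennreal \<bar>good x w\<bar> \<partial>lborel) \<le> (\<integral>\<^sup>+x. ennreal \<bar>F x w\<bar> \<partial>lborel) + (\<integral>\<^sup>+x. ennreal \<bar>F x w\<bar> \<partial>lborel)"
    by (simp add: add_mono)
  also have "\<dots> < \<infinity>" using Ffin by simp
  finally show g: "integrable lborel (\<lambda>x. good x w)" by (intro integrableI_bounded) auto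
  show "integrable lborel (\<lambda>x. bad x w)"
    unfolding bad_def using Fw g by (rule Bochner_Integration.integrable_diff)
qed

lemma measurable_regular [measurable (raw)]:
  assumes [measurable]: "f \<in> borel_measurable M" "g \<in> M \<rightarrow>\<^sub>M N" "t \<in> borel_measurable M"
  shows "Measurable.pred M (\<lambda>x. regular (f x) (g x) (t x))"
  unfolding regular_def by measurable

text \<open>\<open>zeta\<close> vanishes unless the convolution integrals diverge on a set of positive measure; \<open>\<infinity> * zeta\<close>
  is added to estimates in order to state them without exceptional sets.\<close>

definition zeta :: "real \<Rightarrow> ennreal" where
  "zeta x = (\<integral>\<^sup>+w. \<integral>\<^sup>+t. (if regular x w t then 0 else 1) \<partial>nu \<partial>N)"

text \<open>For almost every \<open>w\<close> and every \<open>t\<close> the good and bad parts are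
  integrable, hence their convolutions with the integrable \<open>phi_dil a t\<close> converge
  absolutely for almost every \<open>x\<close>; Tonelli moves the integral over \<open>x\<close>
  inside.\<close>

lemma zeta_AE: "AE x in lborel. zeta x = 0"
proof -
  note sf = N sigma_finite_nu lborel.sigma_finite_measure_axioms
  let ?Z = "\<lambda>x w t. (if regular x w t then 0 else 1) :: ennreal"
  have [measurable]: "zeta \<in> borel_measurable lborel" unfolding zeta_def by measurable
  have "(\<integral>\<^sup>+x. zeta x \<partial>lborel) = (\<integral>\<^sup>+w. \<integral>\<^sup>+x. \<integral>\<^sup>+t. ?Z x w t \<partial>nu \<partial>lborel \<partial>N)"
    unfolding zeta_def by (intro nn_integral_swap sf) measurable
  also have "\<dots> = (\<integral>\<^sup>+w. \<integral>\<^sup>+t. \<integral>\<^sup>+x. ?Z x w t \<partial>lborel \<partial>nu \<partial>N)"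
    by (intro nn_integral_cong nn_integral_swap sf) measurable
  also have "\<dots> = (\<integral>\<^sup>+w. 0 \<partial>N)"
  proof (rule nn_integral_cong_AE, rule AE_mp[OF Fint], intro AE_I2 impI)
    fix w assume w [measurable]: "w \<in> space N" and Fw: "integrable lborel (\<lambda>x. F x w)"
    note gb = good_bad_integrable[OF w Fw]
    have [measurable]: "(\<lambda>y. good y w) \<in> borel_measurable borel" "(\<lambda>y. bad y w) \<in> borel_measurable borel"
      using gb by auto
    have "(\<integral>\<^sup>+x. ?Z x w t \<partial>lborel) = 0" for t
    proof -
      have a0: "a > 0" using a by simp
      have "AE x in lborel. (\<integral>\<^sup>+y. ennreal \<bar>good y w\<bar> * ennreal \<bar>phi_dil a t (x - y)\<bar> \<partial>lborel) \<noteq> \<infinity>"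
        by (rule nn_integral_PInf_AE, measurable) (use nn_integral_conv_phi_dil_finite[OF a0 gb(1), of t] in simp)
      moreover have "AE x in lborel. (\<integral>\<^sup>+y. ennreal \<bar>bad y w\<bar> * ennreal \<bar>phi_dil a t (x - y)\<bar> \<partial>lborel) \<noteq> \<infinity>"
        by (rule nn_integral_PInf_AE, measurable) (use nn_integral_conv_phi_dil_finite[OF a0 gb(2), of t] in simp)
      ultimately have "AE x in lborel. ?Z x w t = 0"
        by eventually_elim (use Fw in \<open>auto simp: regular_def integrable_iff_bounded top.not_eq_extremum\<close>)
      then have "(\<integral>\<^sup>+x. ?Z x w t \<partial>lborel) = (\<integral>\<^sup>+x. 0 \<partial>(lborel :: real measure))"
        by (rule nn_integral_cong_AE)
      then show ?thesis by simp
    qed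
    then show "(\<integral>\<^sup>+t. \<integral>\<^sup>+x. ?Z x w t \<partial>lborel \<partial>nu) = 0" by simp
  qed
  finally have "(\<integral>\<^sup>+x. zeta x \<partial>lborel) = 0" by simp
  then show ?thesis by (simp add: nn_integral_0_iff_AE)
qed

definition Dsq :: "real \<Rightarrow> ennreal" where
  "Dsq x = (\<integral>\<^sup>+w. \<integral>\<^sup>+t. (Bmaj x w t)\<^sup>2 \<partial>nu \<partial>N)"

definition kern :: "real \<Rightarrow> real \<Rightarrow> ennreal" where
  "kern x y = ennreal_sqrt (\<integral>\<^sup>+t. ennreal ((phi_dil a t (x - y) - phi_dil a t (x - c (idx y)))\<^sup>2) \<partial>nu)"

lemma measurable_kern [measurable]: "(\<lambda>(x, y). kern x y) \<in> borel_measurable (borel \<Otimes>\<^sub>M borel)"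
  unfolding kern_def by measurable

lemma measurable_Bmaj [measurable (raw)]:
  assumes [measurable]: "f \<in> borel_measurable M" "g \<in> M \<rightarrow>\<^sub>M N" "t \<in> borel_measurable M"
  shows "(\<lambda>x. Bmaj (f x) (g x) (t x)) \<in> borel_measurable M"
  unfolding Bmaj_def by measurable

text \<open>Minkowski's inequality in the product of \<open>N\<close> and \<open>nu\<close>. For
  fixed \<open>y\<close> the integrand is a function of \<open>w\<close> times a function of
  \<open>t\<close>, so its norm factors into \<open>beta y\<close> and
  \<open>kern x y\<close>.\<close>

lemma Dsq_le: "ennreal_sqrt (Dsq x) \<le> (\<integral>\<^sup>+y\<in>U. beta y * kern x y \<partial>lborel)"
proof -
  interpret P: pair_sigma_finite N nu by (simp add: pair_sigma_finite_def N sigma_finite_nu)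
  let ?f = "\<lambda>y p. ennreal \<bar>bad y (fst p)\<bar> * ennreal \<bar>phi_dil a (snd p) (x - y) - phi_dil a (snd p) (x - c (idx y))\<bar> * indicator U y"
  have "Dsq x = (\<integral>\<^sup>+p. (\<integral>\<^sup>+y. ?f y p \<partial>lborel)\<^sup>2 \<partial>(N \<Otimes>\<^sub>M nu))"
    unfolding Dsq_def Bmaj_def by (subst nu.nn_integral_fst[symmetric]) auto
  also have "\<dots> \<le> (\<integral>\<^sup>+y. ennreal_sqrt (\<integral>\<^sup>+p. (?f y p)\<^sup>2 \<partial>(N \<Otimes>\<^sub>M nu)) \<partial>lborel)\<^sup>2"
    by (intro Minkowski_nn_integral lborel.sigma_finite_measure_axioms P.sigma_finite_measure_axioms) measurable
  also have "(\<integral>\<^sup>+y. ennreal_sqrt (\<integral>\<^sup>+p. (?f y p)\<^sup>2 \<partial>(N \<Otimes>\<^sub>M nu)) \<partial>lborel) = (\<integral>\<^sup>+y\<in>U. beta y * kern x y \<partial>lborel)"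
  proof (rule nn_integral_cong)
    fix y :: real
    have "(\<integral>\<^sup>+p. (?f y p)\<^sup>2 \<partial>(N \<Otimes>\<^sub>M nu)) = (\<integral>\<^sup>+w. \<integral>\<^sup>+t. (?f y (w, t))\<^sup>2 \<partial>nu \<partial>N)"
      by (intro nu.nn_integral_fst[symmetric]) measurable
    also have "\<dots> = (\<integral>\<^sup>+w. \<integral>\<^sup>+t. ennreal ((bad y w)\<^sup>2) * indicator U y * ennreal ((phi_dil a t (x - y) - phi_dil a t (x - c (idx y)))\<^sup>2) \<partial>nu \<partial>N)"
      by (intro nn_integral_cong) (auto simp: indicator_def power_mult_distrib ennreal_abs_power2)
    also have "\<dots> = (\<integral>\<^sup>+w. ennreal ((bad y w)\<^sup>2) * indicator U y * (\<integral>\<^sup>+t. ennreal ((phi_dil a t (x - y) - phi_dil a t (x - c (idx y)))\<^sup>2) \<partial>nu) \<partial>N)"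
      by (intro nn_integral_cong nn_integral_cmult) measurable
    also have "\<dots> = (\<integral>\<^sup>+w. ennreal ((bad y w)\<^sup>2) \<partial>N) * indicator U y * (\<integral>\<^sup>+t. ennreal ((phi_dil a t (x - y) - phi_dil a t (x - c (idx y)))\<^sup>2) \<partial>nu)"
      by (subst nn_integral_multc, measurable, subst nn_integral_multc, measurable)
    finally have eq: "(\<integral>\<^sup>+p. (?f y p)\<^sup>2 \<partial>(N \<Otimes>\<^sub>M nu)) = \<dots>" .
    show "ennreal_sqrt (\<integral>\<^sup>+p. (?f y p)\<^sup>2 \<partial>(N \<Otimes>\<^sub>M nu)) = beta y * kern x y * indicator U y"
      unfolding eq ennreal_sqrt_mult by (auto simp: beta_def kern_def indicator_def ennreal_sqrt_def)
  qed
  finally have "ennreal_sqrt (Dsq x) \<le> ennreal_sqrt ((\<integral>\<^sup>+y\<in>U. beta y * kern x y \<partial>lborel)\<^sup>2)"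
    by (simp only: ennreal_sqrt_le_iff)
  then show ?thesis by (simp only: ennreal_sqrt_of_power2)
qed

section \<open>Level sets outside the enlarged intervals\<close>

definition Ustar :: "real set" where "Ustar = (\<Union>i. {c i - 2 * r i..c i + 2 * r i})"

lemma sets_Ustar [measurable]: "Ustar \<in> sets borel" unfolding Ustar_def by measurable

text \<open>The enlarged intervals have length \<open>4 * r i\<close>, twice that of
  \<open>J i\<close>. Points outside them satisfy \<open>|x - c i| >= 2 * r i\<close> for every
  \<open>i\<close>, where Hoermander's condition applies.\<close>

lemma emeasure_Ustar: "emeasure lborel Ustar \<le> 2 * K"
proof -
  have "emeasure lborel Ustar \<le> (\<Sum>i. emeasure lborel {c i - 2 * r i..c i + 2 * r i})"
    unfolding Ustar_def by (intro emeasure_subadditive_countably) auto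
  also have "\<dots> = (\<Sum>i. 2 * ennreal (2 * r i))"
    using r by (intro suminf_cong) (simp add: ennreal_mult[symmetric] flip: ennreal_numeral)
  also have "\<dots> = 2 * (\<Sum>i. ennreal (2 * r i))" by (rule ennreal_suminf_cmult)
  also have "\<dots> \<le> 2 * K" by (intro mult_left_mono sum_r) auto
  finally show ?thesis .
qed

text \<open>After Tonelli the integral of \<open>kern x y\<close> over \<open>x\<close> comes first.
  For \<open>y\<close> in \<open>J i\<close> it is at most \<open>C\<close> by Hoermander's
  condition around the centre of \<open>J i\<close>, and the mass of \<open>beta\<close>
  remains.\<close>

lemma int_Dsq:
  assumes CH: "\<And>c y r. 0 < r \<Longrightarrow> \<bar>y - c\<bar> \<le> r \<Longrightarrow>
     (\<integral>\<^sup>+x. ennreal_sqrt (\<integral>\<^sup>+t. ennreal ((phi_dil a t (x - y) - phi_dil a t (x - c))\<^sup>2) \<partial>nu) *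
        indicator {x. 2 * r \<le> \<bar>x - c\<bar>} x \<partial>lborel) \<le> ennreal C"
  shows "(\<integral>\<^sup>+x\<in>- Ustar. ennreal_sqrt (Dsq x) \<partial>lborel) \<le> ennreal C * (12 * K)"
proof -
  have "(\<integral>\<^sup>+x\<in>- Ustar. ennreal_sqrt (Dsq x) \<partial>lborel) \<le> (\<integral>\<^sup>+x. (\<integral>\<^sup>+y\<in>U. beta y * kern x y \<partial>lborel) * indicator (- Ustar) x \<partial>lborel)"
    by (intro nn_integral_mono mult_right_mono Dsq_le) auto
  also have "\<dots> = (\<integral>\<^sup>+x. \<integral>\<^sup>+y. beta y * indicator U y * (kern x y * indicator (- Ustar) x) \<partial>lborel \<partial>lborel)"
    by (intro nn_integral_cong, subst nn_integral_multc[symmetric]) (auto simp: mult_ac)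
  also have "\<dots> = (\<integral>\<^sup>+y. \<integral>\<^sup>+x. beta y * indicator U y * (kern x y * indicator (- Ustar) x) \<partial>lborel \<partial>lborel)"
    by (intro nn_integral_swap lborel.sigma_finite_measure_axioms) measurable
  also have "\<dots> = (\<integral>\<^sup>+y. beta y * indicator U y * (\<integral>\<^sup>+x. kern x y * indicator (- Ustar) x \<partial>lborel) \<partial>lborel)"
    by (intro nn_integral_cong nn_integral_cmult) measurable
  also have "\<dots> \<le> (\<integral>\<^sup>+y. beta y * indicator U y * ennreal C \<partial>lborel)"
  proof (rule nn_integral_mono)
    fix y :: real
    show "beta y * indicator U y * (\<integral>\<^sup>+x. kern x y * indicator (- Ustar) x \<partial>lborel) \<le> beta y * indicator U y * ennreal C"
    proof (cases "y \<in> U")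
      case True
      then obtain i where i: "y \<in> J i" by (auto simp: U_def)
      have ri: "r i > 0" "\<bar>y - c i\<bar> \<le> r i" using i by (auto simp: J_def)
      have "(\<integral>\<^sup>+x. kern x y * indicator (- Ustar) x \<partial>lborel) \<le> (\<integral>\<^sup>+x. ennreal_sqrt (\<integral>\<^sup>+t. ennreal ((phi_dil a t (x - y) - phi_dil a t (x - c i))\<^sup>2) \<partial>nu) *
        indicator {x. 2 * r i \<le> \<bar>x - c i\<bar>} x \<partial>lborel)"
      proof (rule nn_integral_mono)
        fix x
        have "2 * r i \<le> \<bar>x - c i\<bar>" if "x \<notin> Ustar"
        proof -
          have "\<not> (c i - 2 * r i \<le> x \<and> x \<le> c i + 2 * r i)" using that by (auto simp: Ustar_def)
          then show ?thesis by linarith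
        qed
        then show "kern x y * indicator (- Ustar) x \<le> ennreal_sqrt (\<integral>\<^sup>+t. ennreal ((phi_dil a t (x - y) - phi_dil a t (x - c i))\<^sup>2) \<partial>nu) *
          indicator {x. 2 * r i \<le> \<bar>x - c i\<bar>} x"
          by (simp add: kern_def idx_eq[OF i] indicator_def)
      qed
      also have "\<dots> \<le> ennreal C" by (rule CH[OF ri])
      finally show ?thesis by (rule mult_left_mono) simp
    qed simp
  qed
  also have "\<dots> = (\<integral>\<^sup>+y\<in>U. beta y \<partial>lborel) * ennreal C"
    by (intro nn_integral_multc) measurable
  also have "\<dots> \<le> 12 * K * ennreal C" by (intro mult_right_mono int_beta) auto
  finally show ?thesis by (simp add: mult.commute)
qed

text \<open>The square function is at most \<open>2 * A x + 2 * Dsq x\<close> wherever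
  \<open>zeta\<close> vanishes, so it exceeds 1 only if \<open>A x > 1/4\<close> or
  \<open>ennreal_sqrt (Dsq x) > 1/2\<close>. Chebyshev with these thresholds gives
  \<open>4 * 10 * B\<close> and \<open>2 * 12 * C\<close>; the 2 is the measure of
  \<open>Ustar\<close>.\<close>

lemma weak_type_CZ:
  assumes CH: "\<And>c y r. 0 < r \<Longrightarrow> \<bar>y - c\<bar> \<le> r \<Longrightarrow>
     (\<integral>\<^sup>+x. ennreal_sqrt (\<integral>\<^sup>+t. ennreal ((phi_dil a t (x - y) - phi_dil a t (x - c))\<^sup>2) \<partial>nu) *
        indicator {x. 2 * r \<le> \<bar>x - c\<bar>} x \<partial>lborel) \<le> ennreal C"
    and B: "(\<integral>\<^sup>+x. \<integral>\<^sup>+w. \<integral>\<^sup>+t. ennreal ((LINT y|lborel. good y w * phi_dil a t (x - y))\<^sup>2) \<partial>nu \<partial>N \<partial>lborel) \<le>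
      ennreal B * (\<integral>\<^sup>+x. \<integral>\<^sup>+w. ennreal ((good x w)\<^sup>2) \<partial>N \<partial>lborel)"
  shows "emeasure lborel {x. 1 < (\<integral>\<^sup>+w. \<integral>\<^sup>+t. ennreal ((LINT y|lborel. F y w * phi_dil a t (x - y))\<^sup>2) \<partial>nu \<partial>N)}
     \<le> (40 * ennreal B + 2 + 24 * ennreal C) * K"
proof -
  define T where "T x = (\<integral>\<^sup>+w. \<integral>\<^sup>+t. ennreal ((LINT y|lborel. F y w * phi_dil a t (x - y))\<^sup>2) \<partial>nu \<partial>N)" for x
  define A where "A x = (\<integral>\<^sup>+w. \<integral>\<^sup>+t. ennreal ((LINT y|lborel. good y w * phi_dil a t (x - y))\<^sup>2) \<partial>nu \<partial>N)" for x
  have "T \<in> borel_measurable lborel" "A \<in> borel_measurable lborel" "Dsq \<in> borel_measurable lborel" "zeta \<in> borel_measurable lborel"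
    unfolding T_def A_def Dsq_def zeta_def by measurable
  then have [measurable]: "T \<in> borel_measurable borel" "A \<in> borel_measurable borel" "Dsq \<in> borel_measurable borel" "zeta \<in> borel_measurable borel"
    by simp_all
  have T_le: "T x \<le> 2 * A x + 2 * Dsq x + \<infinity> * zeta x" for x
  proof -
    have "T x \<le> (\<integral>\<^sup>+w. \<integral>\<^sup>+t. 2 * ennreal ((LINT y|lborel. good y w * phi_dil a t (x - y))\<^sup>2) + 2 * (Bmaj x w t)\<^sup>2 + \<infinity> * (if regular x w t then 0 else 1) \<partial>nu \<partial>N)"
      unfolding T_def
    proof (intro nn_integral_mono)
      fix w t assume "w \<in> space N"
      then show "ennreal ((LINT y|lborel. F y w * phi_dil a t (x - y))\<^sup>2) \<le>
        2 * ennreal ((LINT y|lborel. good y w * phi_dil a t (x - y))\<^sup>2) + 2 * (Bmaj x w t)\<^sup>2 + \<infinity> * (if regular x w t then 0 else 1)"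
        using conv_split[of w x t] by (cases "regular x w t") auto
    qed
    also have "\<dots> = (\<integral>\<^sup>+w. 2 * (\<integral>\<^sup>+t. ennreal ((LINT y|lborel. good y w * phi_dil a t (x - y))\<^sup>2) \<partial>nu) + 2 * (\<integral>\<^sup>+t. (Bmaj x w t)\<^sup>2 \<partial>nu) +
        \<infinity> * (\<integral>\<^sup>+t. (if regular x w t then 0 else 1) \<partial>nu) \<partial>N)"
      by (intro nn_integral_cong) (simp add: nn_integral_add nn_integral_cmult del: infinity_ennreal_def)
    also have "\<dots> = 2 * A x + 2 * Dsq x + \<infinity> * zeta x"
      unfolding A_def Dsq_def zeta_def by (simp add: nn_integral_add nn_integral_cmult del: infinity_ennreal_def)
    finally show ?thesis .
  qed
  have "{x\<in>space lborel. 0 < zeta x} \<in> sets lborel" by measurable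
  moreover have "{x\<in>space lborel. ennreal (1 / 4) < A x} \<in> sets lborel" by measurable
  moreover have "{x\<in>space lborel. ennreal (1 / 2) < ennreal_sqrt (Dsq x) * indicator (- Ustar) x} \<in> sets lborel"
    by measurable
  ultimately have sets: "{x. zeta x \<noteq> 0} \<in> sets lborel" "{x. ennreal (1 / 4) < A x} \<in> sets lborel" "Ustar \<in> sets lborel"
    "{x. ennreal (1 / 2) < ennreal_sqrt (Dsq x) * indicator (- Ustar) x} \<in> sets lborel"
    by (simp_all add: zero_less_iff_neq_zero)
  have "{x. 1 < T x} \<subseteq> {x. zeta x \<noteq> 0} \<union> {x. ennreal (1 / 4) < A x} \<union> Ustar \<union> {x. ennreal (1 / 2) < ennreal_sqrt (Dsq x) * indicator (- Ustar) x}"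
  proof (rule ccontr)
    assume "\<not> ?thesis"
    then obtain x where x: "1 < T x" "zeta x = 0" "A x \<le> ennreal (1 / 4)" "ennreal_sqrt (Dsq x) \<le> ennreal (1 / 2)"
      by (auto simp: not_less indicator_def split: if_splits)
    have "(ennreal_sqrt (Dsq x))\<^sup>2 \<le> (ennreal (1 / 2))\<^sup>2" using x(4) by (rule power_mono_ennreal)
    also have "(ennreal (1 / 2))\<^sup>2 = ennreal (1 / 4)" by (subst ennreal_power) (auto simp: power2_eq_square)
    finally have "Dsq x \<le> ennreal (1 / 4)" by (simp only: ennreal_sqrt_power2)
    then have "2 * A x + 2 * Dsq x \<le> 2 * ennreal (1 / 4) + 2 * ennreal (1 / 4)"
      using x by (intro add_mono mult_left_mono) auto
    also have "2 * ennreal (1 / 4) = ennreal (1 / 2)"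
      by (subst ennreal_numeral[symmetric], subst ennreal_mult[symmetric]) auto
    also have "ennreal (1 / 2) + ennreal (1 / 2) = 1" by (subst ennreal_plus[symmetric]) auto
    finally have "2 * A x + 2 * Dsq x \<le> 1" .
    with T_le[of x] x(1,2) show False by simp
  qed
  then have "emeasure lborel {x. 1 < T x} \<le> emeasure lborel ({x. zeta x \<noteq> 0} \<union> {x. ennreal (1 / 4) < A x} \<union> Ustar \<union> {x. ennreal (1 / 2) < ennreal_sqrt (Dsq x) * indicator (- Ustar) x})"
    by (intro emeasure_mono sets.Un sets)
  also have "\<dots> \<le> emeasure lborel {x. zeta x \<noteq> 0} + emeasure lborel {x. ennreal (1 / 4) < A x} + emeasure lborel Ustar + emeasure lborel {x. ennreal (1 / 2) < ennreal_sqrt (Dsq x) * indicator (- Ustar) x}"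
    by (intro order_trans[OF emeasure_subadditive] add_mono order_refl sets.Un sets)
  also have "\<dots> \<le> 0 + 4 * (ennreal B * (10 * K)) + 2 * K + 2 * (ennreal C * (12 * K))"
  proof (intro add_mono emeasure_Ustar)
    show "emeasure lborel {x. zeta x \<noteq> 0} \<le> 0"
      using AE_iff_measurable[of "{x. zeta x \<noteq> 0}" lborel "\<lambda>x. zeta x = 0"] zeta_AE by simp
    have "emeasure lborel {x. ennreal (1 / 4) < A x} \<le> ennreal 4 * (\<integral>\<^sup>+x. A x \<partial>lborel)"
      using emeasure_less_le_nn_integral[of A lborel 4] by simp
    also have "\<dots> \<le> ennreal 4 * (ennreal B * (10 * K))"
      unfolding A_def by (intro mult_left_mono order_trans[OF B] good_sq) auto
    finally show "emeasure lborel {x. ennreal (1 / 4) < A x} \<le> 4 * (ennreal B * (10 * K))" by simp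
    have "emeasure lborel {x. ennreal (1 / 2) < ennreal_sqrt (Dsq x) * indicator (- Ustar) x} \<le> ennreal 2 * (\<integral>\<^sup>+x\<in>- Ustar. ennreal_sqrt (Dsq x) \<partial>lborel)"
      using emeasure_less_le_nn_integral[of "\<lambda>x. ennreal_sqrt (Dsq x) * indicator (- Ustar) x" lborel 2] by simp
    also have "\<dots> \<le> ennreal 2 * (ennreal C * (12 * K))"
      by (intro mult_left_mono int_Dsq[OF CH]) auto
    finally show "emeasure lborel {x. ennreal (1 / 2) < ennreal_sqrt (Dsq x) * indicator (- Ustar) x} \<le> 2 * (ennreal C * (12 * K))" by simp
  qed
  also have "\<dots> = (40 * ennreal B + 2 + 24 * ennreal C) * K"
  proof -
    have "4 * (ennreal B * (10 * K)) = (4 * 10) * (ennreal B * K)" "2 * (ennreal C * (12 * K)) = (2 * 12) * (ennreal C * K)"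
      by (simp_all only: mult_ac)
    then show ?thesis by (simp add: distrib_left distrib_right mult_ac)
  qed
  finally show ?thesis by (simp add: T_def)
qed

end

text \<open>The constant is chosen before \<open>N\<close> and \<open>F\<close>, as the induction
  over variables demands. If the right side is finite, the truncated norm \<open>h\<close> is
  integrable and the stopping intervals exist; otherwise the claim is trivial since the constant is
  positive.\<close>

lemma weak_type_1D:
  assumes a: "a > 1/2"
  shows "\<exists>C>0. \<forall>(N :: 'w measure) F. sigma_finite_measure N \<longrightarrow>
    (\<lambda>(x, w). F x w) \<in> borel_measurable (lborel \<Otimes>\<^sub>M N) \<longrightarrow>
    (AE w in N. integrable lborel (\<lambda>x. F x w)) \<longrightarrow>
    emeasure lborel {x. 1 < (\<integral>\<^sup>+w. \<integral>\<^sup>+t. ennreal ((LINT y|lborel. F y w * phi_dil a t (x - y))\<^sup>2) \<partial>nu \<partial>N)}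
      \<le> ennreal C * (\<integral>\<^sup>+x. Psi (\<integral>\<^sup>+w. ennreal ((F x w)\<^sup>2) \<partial>N) \<partial>lborel)"
proof -
  have a0: "a > 0" using a by simp
  obtain CH where CH: "CH \<ge> 0" "\<And>c y r. 0 < r \<Longrightarrow> \<bar>y - c\<bar> \<le> r \<Longrightarrow>
     (\<integral>\<^sup>+x. ennreal_sqrt (\<integral>\<^sup>+t. ennreal ((phi_dil a t (x - y) - phi_dil a t (x - c))\<^sup>2) \<partial>nu) *
        indicator {x. 2 * r \<le> \<bar>x - c\<bar>} x \<partial>lborel) \<le> ennreal CH"
    using nn_integral_phi_dil_Hormander[OF a] by blast
  obtain B where B: "B > 0" "\<And>(N :: 'w measure) F. sigma_finite_measure N \<Longrightarrow> (\<lambda>(x, w). F x w) \<in> borel_measurable (lborel \<Otimes>\<^sub>M N) \<Longrightarrow>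
    (\<integral>\<^sup>+x. \<integral>\<^sup>+w. \<integral>\<^sup>+t. ennreal ((LINT y|lborel. F y w * phi_dil a t (x - y))\<^sup>2) \<partial>nu \<partial>N \<partial>lborel) \<le> ennreal B * (\<integral>\<^sup>+x. \<integral>\<^sup>+w. ennreal ((F x w)\<^sup>2) \<partial>N \<partial>lborel)"
    using square_function_L2_bound_vector[OF a0, where ?'w = 'w] by blast
  show ?thesis
  proof (intro exI[of _ "40 * B + 2 + 24 * CH"] conjI allI impI)
    show "0 < 40 * B + 2 + 24 * CH" using B(1) CH(1) by simp
    fix N :: "'w measure" and F :: "real \<Rightarrow> 'w \<Rightarrow> real"
    assume N: "sigma_finite_measure N" and F [measurable]: "(\<lambda>(x, w). F x w) \<in> borel_measurable (lborel \<Otimes>\<^sub>M N)"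
      and Fint: "AE w in N. integrable lborel (\<lambda>x. F x w)"
    interpret N: sigma_finite_measure N by fact
    define H where "H x = (\<integral>\<^sup>+w. ennreal ((F x w)\<^sup>2) \<partial>N)" for x
    define h where "h x = ennreal_sqrt (H x) * indicator {x. 1 < ennreal_sqrt (H x)} x" for x
    have "H \<in> borel_measurable lborel" unfolding H_def by measurable
    then have H [measurable]: "H \<in> borel_measurable borel" by simp
    have h [measurable]: "h \<in> borel_measurable borel" unfolding h_def by measurable
    have K40: "ennreal (40 * B + 2 + 24 * CH) = 40 * ennreal B + 2 + 24 * ennreal CH"
      using B(1) CH(1) by (simp add: ennreal_mult)
    show "emeasure lborel {x. 1 < (\<integral>\<^sup>+w. \<integral>\<^sup>+t. ennreal ((LINT y|lborel. F y w * phi_dil a t (x - y))\<^sup>2) \<partial>nu \<partial>N)}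
      \<le> ennreal (40 * B + 2 + 24 * CH) * (\<integral>\<^sup>+x. Psi (\<integral>\<^sup>+w. ennreal ((F x w)\<^sup>2) \<partial>N) \<partial>lborel)"
    proof (cases "(\<integral>\<^sup>+x. Psi (H x) \<partial>lborel) = \<infinity>")
      case True
      moreover have "40 * B + 2 + 24 * CH > 0" using B(1) CH(1) by simp
      ultimately show ?thesis by (simp add: H_def ennreal_mult_top)
    next
      case False
      have "(\<integral>\<^sup>+x. h x \<partial>lborel) \<le> (\<integral>\<^sup>+x. Psi (H x) \<partial>lborel)"
        using Psi_eq_sqrt by (intro nn_integral_mono) (auto simp: h_def indicator_def)
      also have "\<dots> < \<infinity>" using False by (simp add: top.not_eq_extremum)
      finally have hfin: "(\<integral>\<^sup>+x. h x \<partial>lborel) < \<infinity>" .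
      obtain c r :: "nat \<Rightarrow> real" where cr: "\<And>i. r i \<ge> 0" "disjoint_family (\<lambda>i. {c i - r i..<c i + r i})"
        "\<And>i. ennreal (2 * r i) \<le> (\<integral>\<^sup>+x\<in>{c i - r i..<c i + r i}. h x \<partial>lborel)"
        "\<And>i. (\<integral>\<^sup>+x\<in>{c i - r i..<c i + r i}. h x \<partial>lborel) \<le> ennreal (4 * r i)"
        "AE x in lborel. x \<notin> (\<Union>i. {c i - r i..<c i + r i}) \<longrightarrow> h x \<le> 1"
        by (rule Calderon_Zygmund_intervals[OF h hfin]) (rule that; assumption)
      interpret CZ_setup a N F c r "\<lambda>x. \<integral>\<^sup>+w. ennreal ((F x w)\<^sup>2) \<partial>N" "\<lambda>x. ennreal_sqrt (\<integral>\<^sup>+w. ennreal ((F x w)\<^sup>2) \<partial>N)"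
        "\<lambda>x. ennreal_sqrt (\<integral>\<^sup>+w. ennreal ((F x w)\<^sup>2) \<partial>N) * indicator {x. 1 < ennreal_sqrt (\<integral>\<^sup>+w. ennreal ((F x w)\<^sup>2) \<partial>N)} x"
        "\<lambda>i. {c i - r i..<c i + r i}" "\<Union>i. {c i - r i..<c i + r i}"
        by unfold_locales (rule a N F Fint cr[unfolded h_def H_def] reflexive)+
      show ?thesis
        unfolding K40 using weak_type_CZ[OF CH(2) B(2)[OF N measurable_good]] by (simp add: K_def H_def)
    qed
  qed
qed

section \<open>Iterated logarithms\<close>

text \<open>The gauge after \<open>k\<close> variables. The form \<open>1 + ln u\<close> is at least
  1 for \<open>u >= 1\<close> and nearly multiplicative: for \<open>s <= 1\<close> the value at
  \<open>u / s\<close> is at most the product of the values at \<open>u\<close> and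
  \<open>1 / s\<close>.\<close>

definition Psi_log :: "nat \<Rightarrow> real \<Rightarrow> real" where
  "Psi_log k u = (if u \<le> 1 then u powr (3 / 2) else u * (1 + ln u) ^ k)"

lemma measurable_Psi_log [measurable]: "Psi_log k \<in> borel_measurable borel"
  unfolding Psi_log_def by measurable

lemma Psi_log_nonneg: "0 \<le> u \<Longrightarrow> 0 \<le> Psi_log k u"
  by (simp add: Psi_log_def)

lemma one_plus_ln_power_le: "\<exists>M\<ge>(1::real). \<forall>u\<ge>(1::real). (1 + ln u) ^ k \<le> M * u powr (1 / 2)"
proof (intro exI[of _ "(2 * real k + 3) ^ k"] conjI allI impI)
  show "1 \<le> (2 * real k + 3) ^ k" by (rule one_le_power) simp
  fix u :: real assume u: "1 \<le> u"
  \<comment> \<open>The exponent is small enough for \<open>e * k <= 1/2\<close>; its reciprocal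
    \<open>2 * k + 2\<close>, plus one for the summand 1, is the base of the constant.\<close>
  define e where "e = 1 / (2 * (real k + 1))"
  have e: "e > 0" by (simp add: e_def)
  have "ln u \<le> u powr e / e" using u e by (rule ln_powr_bound)
  also have "\<dots> = (2 * real k + 2) * u powr e" by (simp add: e_def field_simps)
  finally have "1 + ln u \<le> (2 * real k + 3) * u powr e"
    using ge_one_powr_ge_zero[OF u, of e] e by (simp add: algebra_simps)
  then have "(1 + ln u) ^ k \<le> ((2 * real k + 3) * u powr e) ^ k"
    using u by (intro power_mono) auto
  also have "\<dots> = (2 * real k + 3) ^ k * u powr (e * real k)"
  proof -
    have "(u powr e) ^ k = (u powr e) powr real k" using u by (simp add: powr_realpow)
    then show ?thesis by (simp add: power_mult_distrib powr_powr)
  qed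
  also have "\<dots> \<le> (2 * real k + 3) ^ k * u powr (1 / 2)"
    using u by (intro mult_left_mono powr_mono) (auto simp: e_def field_simps)
  finally show "(1 + ln u) ^ k \<le> (2 * real k + 3) ^ k * u powr (1 / 2)" .
qed

lemma Psi_log_le_powr: "\<exists>M\<ge>(1::real). \<forall>u\<ge>0. Psi_log k u \<le> M * u powr (3 / 2)"
proof -
  obtain M :: real where M: "M \<ge> 1" "\<And>u. u \<ge> 1 \<Longrightarrow> (1 + ln u) ^ k \<le> M * u powr (1 / 2)"
    using one_plus_ln_power_le by blast
  show ?thesis
  proof (intro exI[of _ M] conjI allI impI M(1))
    fix u :: real assume "0 \<le> u"
    show "Psi_log k u \<le> M * u powr (3 / 2)"
    proof (cases "u \<le> 1")
      case True
      then show ?thesis using M(1) mult_right_mono[of 1 M "u powr (3 / 2)"] by (simp add: Psi_log_def)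
    next
      case False
      have "u * (1 + ln u) ^ k \<le> u * (M * u powr (1 / 2))"
        using False M(2)[of u] by (intro mult_left_mono) auto
      also have "u * (M * u powr (1 / 2)) = M * (u powr 1 * u powr (1 / 2))" using False by simp
      also have "u powr 1 * u powr (1 / 2) = u powr (3 / 2)" by (simp only: powr_add[symmetric]) simp
      finally show ?thesis using False by (simp add: Psi_log_def)
    qed
  qed
qed

text \<open>Twice this weight dominates the derivative of \<open>min(s, s^2)\<close>, which is
  \<open>2 * s\<close> below 1 and 1 above.\<close>

definition layer_weight :: "real \<Rightarrow> real" where
  "layer_weight s = min s 1 * indicator {0<..} s"

lemma measurable_layer_weight [measurable]: "layer_weight \<in> borel_measurable borel"
  unfolding layer_weight_def by measurable

lemma layer_weight_nonneg: "0 \<le> layer_weight s"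
  by (simp add: layer_weight_def indicator_def)

text \<open>For small arguments the exponent of \<open>Psi_log\<close> is \<open>3/2\<close> and not \<open>2\<close>: with \<open>u\<^sup>2\<close> the integral below would
  produce \<open>u\<^sup>2 ln (1/u)\<close>, whereas any exponent strictly between 1 and 2 is reproduced.\<close>

lemma nn_integral_layer_Psi_log:
  "\<exists>C>0. \<forall>u\<ge>0. (\<integral>\<^sup>+s. ennreal (layer_weight s) * ennreal (Psi_log k (u / s)) \<partial>lborel) \<le> ennreal (C * Psi_log (Suc k) u)"
proof -
  obtain M :: real where M: "M \<ge> 1" "\<And>u. u \<ge> 1 \<Longrightarrow> (1 + ln u) ^ k \<le> M * u powr (1 / 2)"
    using one_plus_ln_power_le by blast
  obtain D :: real where D: "D \<ge> 1" "\<And>u. u \<ge> 0 \<Longrightarrow> Psi_log k u \<le> D * u powr (3 / 2)"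
    using Psi_log_le_powr by blast
  let ?a = "\<lambda>s. ennreal (s powr (- 1 / 2) * indicator {0..1} s)" and ?b = "\<lambda>c s. ennreal (s powr (- (3 / 2))) * indicator {c..} s"
  have int_a: "(\<integral>\<^sup>+s. ?a s \<partial>lborel) = ennreal 2"
    using nn_integral_powr_from_0[of "- 1 / 2" 1] by simp
  have int_b: "(\<integral>\<^sup>+s. ?b c s \<partial>lborel) = ennreal (2 * c powr (- 1 / 2))" if "c > 0" for c
    using nn_integral_powr_at_top[of "3 / 2" c] that by simp
  \<comment> \<open>\<open>4 * D\<close> is for \<open>u <= 1\<close>; for \<open>u > 1\<close> the
    ranges \<open>s <= 1\<close>, \<open>1 < s < u\<close> and \<open>s >= u\<close> account for
    \<open>2 * M\<close>, 1 and 2.\<close>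
  define C where "C = 4 * D + 2 * M + 3"
  show ?thesis
  proof (intro exI[of _ C] conjI allI impI)
    show "C > 0" using D M by (simp add: C_def)
    fix u :: real assume u: "u \<ge> 0"
    have quot: "(u / s) powr (3 / 2) = u powr (3 / 2) * s powr (- (3 / 2))" if "s > 0" for s
    proof -
      have "(u / s) powr (3 / 2) = u powr (3 / 2) / s powr (3 / 2)"
        using u that by (intro powr_divide)
      then show ?thesis by (simp only: powr_minus divide_inverse)
    qed
    show "(\<integral>\<^sup>+s. ennreal (layer_weight s) * ennreal (Psi_log k (u / s)) \<partial>lborel) \<le> ennreal (C * Psi_log (Suc k) u)"
    proof (cases "u \<le> 1")
      case True
      have "(\<integral>\<^sup>+s. ennreal (layer_weight s) * ennreal (Psi_log k (u / s)) \<partial>lborel) \<le> (\<integral>\<^sup>+s. ennreal (D * u powr (3 / 2)) * (?a s + ?b 1 s) \<partial>lborel)"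
      proof (rule nn_integral_mono)
        fix s :: real
        show "ennreal (layer_weight s) * ennreal (Psi_log k (u / s)) \<le> ennreal (D * u powr (3 / 2)) * (?a s + ?b 1 s)"
        proof (cases "s > 0")
          case s: True
          have "Psi_log k (u / s) \<le> D * u powr (3 / 2) * s powr (- (3 / 2))"
            using D(2)[of "u / s"] u s by (simp add: quot)
          then have *: "layer_weight s * Psi_log k (u / s) \<le> min s 1 * (D * u powr (3 / 2) * s powr (- (3 / 2)))"
            using s unfolding layer_weight_def by (simp add: mult_left_mono)
          show ?thesis
          proof (cases "s \<le> 1")
            case True
            have "s * s powr (- (3 / 2)) = s powr 1 * s powr (- (3 / 2))" using s by simp
            also have "\<dots> = s powr (- 1 / 2)" by (simp only: powr_add[symmetric]) simp
            finally have "min s 1 * (D * u powr (3 / 2) * s powr (- (3 / 2))) = D * u powr (3 / 2) * s powr (- 1 / 2)"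
              using True by simp
            with * have "ennreal (layer_weight s * Psi_log k (u / s)) \<le> ennreal (D * u powr (3 / 2) * s powr (- 1 / 2))"
              by (intro ennreal_leI) simp
            also have "\<dots> = ennreal (D * u powr (3 / 2)) * ?a s" using True s D by (simp add: ennreal_mult)
            also have "\<dots> \<le> ennreal (D * u powr (3 / 2)) * (?a s + ?b 1 s)" by (intro mult_left_mono) auto
            finally show ?thesis using u s by (simp add: ennreal_mult layer_weight_nonneg Psi_log_nonneg)
          next
            case False
            with * have "ennreal (layer_weight s * Psi_log k (u / s)) \<le> ennreal (D * u powr (3 / 2) * s powr (- (3 / 2)))"
              by (intro ennreal_leI) simp
            also have "\<dots> = ennreal (D * u powr (3 / 2)) * ?b 1 s" using False s D by (simp add: ennreal_mult)
            also have "\<dots> \<le> ennreal (D * u powr (3 / 2)) * (?a s + ?b 1 s)" by (intro mult_left_mono) auto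
            finally show ?thesis using u s by (simp add: ennreal_mult layer_weight_nonneg Psi_log_nonneg)
          qed
        qed (simp add: layer_weight_def)
      qed
      also have "\<dots> = ennreal (D * u powr (3 / 2)) * (ennreal 2 + ennreal (2 * 1 powr (- 1 / 2)))"
        by (subst nn_integral_cmult, measurable, subst nn_integral_add, measurable) (simp only: int_a int_b[OF zero_less_one])
      also have "\<dots> = ennreal (4 * D * u powr (3 / 2))"
        using D by (subst ennreal_plus[symmetric], simp, simp, subst ennreal_mult[symmetric]) (auto simp: mult_ac)
      also have "\<dots> \<le> ennreal (C * Psi_log (Suc k) u)"
        using True M D by (intro ennreal_leI) (simp add: Psi_log_def C_def mult_right_mono)
      finally show ?thesis .
    next
      case False
      define L where "L = 1 + ln u"
      have L: "L \<ge> 1" using False by (simp add: L_def)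
      \<comment> \<open>The range \<open>1 < s < u\<close> carries the density \<open>1 / s\<close>,
        whose integral \<open>ln u\<close> is the logarithm lost in this step. The other two ranges
        reproduce the gauge up to constants.\<close>
      let ?c = "\<lambda>s. ennreal (1 / s) * indicator {1..u} s"
      have upos: "u > 0" using False by simp
      have "(\<integral>\<^sup>+s. ?c s \<partial>lborel) = ennreal (ln u - ln 1)"
        using False by (intro nn_integral_FTC_Icc) (auto intro!: derivative_eq_intros simp: inverse_eq_divide)
      then have int_c: "(\<integral>\<^sup>+s. ?c s \<partial>lborel) = ennreal (ln u)" by (simp only: ln_one diff_zero)
      have "(\<integral>\<^sup>+s. ennreal (layer_weight s) * ennreal (Psi_log k (u / s)) \<partial>lborel) \<le>
        (\<integral>\<^sup>+s. ennreal (M * (u * L ^ k)) * ?a s + ennreal (u * L ^ k) * ?c s + ennreal (u powr (3 / 2)) * ?b u s \<partial>lborel)"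
      proof (rule nn_integral_mono)
        fix s :: real
        consider "s \<le> 0" | "0 < s" "s \<le> 1" | "1 < s" "s < u" | "u \<le> s" "1 < s" by linarith
        then show "ennreal (layer_weight s) * ennreal (Psi_log k (u / s)) \<le>
          ennreal (M * (u * L ^ k)) * ?a s + ennreal (u * L ^ k) * ?c s + ennreal (u powr (3 / 2)) * ?b u s"
        proof cases
          case 1
          then show ?thesis by (simp add: layer_weight_def)
        next
          case 2
          have us: "1 < u / s" using 2 False by (simp add: less_divide_eq)
          have "1 + ln (u / s) = L + ln (1 / s)" using 2 False by (simp add: L_def ln_div)
          \<comment> \<open>From \<open>L >= 1\<close>, a sum is at most a product; this separates
            \<open>u\<close> from \<open>s\<close>, and the powers of \<open>ln (1 / s)\<close> are
            absorbed by \<open>s powr (- 1 / 2)\<close>.\<close>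
          also have "\<dots> \<le> L * (1 + ln (1 / s))"
            using L 2 mult_right_mono[of 1 L "ln (1 / s)"] by (simp add: algebra_simps)
          finally have "(1 + ln (u / s)) ^ k \<le> (L * (1 + ln (1 / s))) ^ k"
            using us by (intro power_mono) auto
          also have "\<dots> \<le> L ^ k * (M * (1 / s) powr (1 / 2))"
            using L 2 M(2)[of "1 / s"] unfolding power_mult_distrib by (intro mult_left_mono) auto
          also have "(1 / s) powr (1 / 2) = s powr (- 1 / 2)" using 2 by (simp add: powr_divide powr_minus_divide)
          finally have *: "(1 + ln (u / s)) ^ k \<le> L ^ k * (M * s powr (- 1 / 2))" .
          have "layer_weight s * Psi_log k (u / s) = u * (1 + ln (u / s)) ^ k"
            using us 2 by (simp add: layer_weight_def Psi_log_def)
          also have "\<dots> \<le> u * (L ^ k * (M * s powr (- 1 / 2)))" using * u by (intro mult_left_mono)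
          finally have "ennreal (layer_weight s * Psi_log k (u / s)) \<le> ennreal (M * (u * L ^ k) * s powr (- 1 / 2))"
            by (intro ennreal_leI) (simp add: mult_ac)
          also have "\<dots> = ennreal (M * (u * L ^ k)) * ?a s" using 2 M u L by (simp add: ennreal_mult)
          finally show ?thesis using u 2
            by (simp add: ennreal_mult layer_weight_nonneg Psi_log_nonneg add.assoc add_increasing2)
        next
          case 3
          have us: "1 < u / s" using 3 by (simp add: less_divide_eq)
          have "(1 + ln (u / s)) ^ k \<le> L ^ k"
            using 3 us False by (intro power_mono) (auto simp: L_def ln_div)
          then have "layer_weight s * Psi_log k (u / s) \<le> u * L ^ k * (1 / s)"
            using us 3 by (simp add: layer_weight_def Psi_log_def divide_right_mono mult_left_mono)
          then have "ennreal (layer_weight s * Psi_log k (u / s)) \<le> ennreal (u * L ^ k * (1 / s))"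
            by (rule ennreal_leI)
          also have "\<dots> = ennreal (u * L ^ k) * ?c s" using 3 u L by (simp add: ennreal_mult[symmetric])
          finally show ?thesis using u 3
            by (simp add: ennreal_mult layer_weight_nonneg Psi_log_nonneg add_increasing add_increasing2)
        next
          case 4
          have us: "u / s \<le> 1" using 4 by simp
          have "layer_weight s * Psi_log k (u / s) = u powr (3 / 2) * s powr (- (3 / 2))"
            using us 4 by (simp add: layer_weight_def Psi_log_def quot)
          then have "ennreal (layer_weight s * Psi_log k (u / s)) = ennreal (u powr (3 / 2)) * ?b u s"
            using 4 by (simp add: ennreal_mult)
          then show ?thesis using u 4
            by (simp add: ennreal_mult layer_weight_nonneg Psi_log_nonneg add_increasing)
        qed
      qed
      also have "\<dots> = ennreal (M * (u * L ^ k)) * ennreal 2 + ennreal (u * L ^ k) * ennreal (ln u) + ennreal (u powr (3 / 2)) * ennreal (2 * u powr (- 1 / 2))"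
        by (subst nn_integral_add, measurable, subst nn_integral_add, measurable, subst nn_integral_cmult, measurable,
            subst nn_integral_cmult, measurable, subst nn_integral_cmult, measurable) (simp only: int_a int_c int_b[OF upos])
      also have "\<dots> = ennreal (M * (u * L ^ k) * 2 + u * L ^ k * ln u + u powr (3 / 2) * (2 * u powr (- 1 / 2)))"
        using M u L False by (simp only: ennreal_mult[symmetric] ennreal_plus[symmetric] mult_nonneg_nonneg add_nonneg_nonneg
            zero_le_power powr_ge_zero zero_le_numeral order_trans[OF zero_le_one] ln_ge_zero less_imp_le not_le)
      also have "u powr (3 / 2) * (2 * u powr (- 1 / 2)) = 2 * (u powr (3 / 2) * u powr (- 1 / 2))" by simp
      also have "u powr (3 / 2) * u powr (- 1 / 2) = u powr 1" by (simp only: powr_add[symmetric]) simp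
      also have "u powr 1 = u" using u by simp
      also have "M * (u * L ^ k) * 2 + u * L ^ k * ln u + 2 * u \<le> C * (u * L ^ Suc k)"
      proof -
        have Lk: "1 \<le> L ^ k" "L ^ k \<le> L ^ Suc k" using L by (auto intro: one_le_power)
        then have uL: "u * L ^ k \<le> u * L ^ Suc k" "u * 1 \<le> u * L ^ Suc k" using u by (intro mult_left_mono; linarith)+
        have "u * L ^ k * ln u \<le> u * L ^ k * L" using u L by (intro mult_left_mono) (auto simp: L_def)
        moreover have "M * (u * L ^ k) * 2 \<le> M * (u * L ^ Suc k) * 2" using mult_left_mono[OF uL(1), of M] M(1) by simp
        moreover have "0 \<le> D * (u * L ^ Suc k)" using D u L by simp
        ultimately have "M * (u * L ^ k) * 2 + u * L ^ k * ln u + 2 * u \<le> M * (u * L ^ Suc k) * 2 + u * L ^ Suc k + 2 * (u * L ^ Suc k) + 4 * (D * (u * L ^ Suc k))"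
          using uL by (simp add: mult_ac)
        also have "\<dots> = C * (u * L ^ Suc k)" by (simp add: C_def algebra_simps)
        finally show ?thesis .
      qed
      also have "u * L ^ Suc k = Psi_log (Suc k) u" using False by (simp add: Psi_log_def L_def)
      finally show ?thesis by (simp add: ennreal_leI)
    qed
  qed
qed

text \<open>For \<open>q = r^2\<close> and \<open>m = min r 1\<close> the integral of the weight up
  to \<open>r\<close> is \<open>m^2 / 2 + (r - m)\<close>, at least half of
  \<open>min(r, r^2)\<close>. The value \<open>q = \<infinity>\<close> follows by monotonicity from
  arbitrarily large finite values.\<close>

lemma Psi_le_layer: "Psi q \<le> 2 * (\<integral>\<^sup>+s. ennreal (layer_weight s) * indicator {s. ennreal (s\<^sup>2) < q} s \<partial>lborel)"
proof -
  let ?R = "\<lambda>q. 2 * (\<integral>\<^sup>+s. ennreal (layer_weight s) * indicator {s. ennreal (s\<^sup>2) < q} s \<partial>lborel)"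
  have fin: "Psi (ennreal (r\<^sup>2)) \<le> ?R (ennreal (r\<^sup>2))" if r: "r \<ge> 0" for r :: real
  proof -
    define m where "m = min r 1"
    have m: "0 \<le> m" "m \<le> r" "m \<le> 1" using r by (auto simp: m_def)
    have 1: "(\<integral>\<^sup>+s. ennreal s * indicator {0..m} s \<partial>lborel) = ennreal (m\<^sup>2 / 2 - 0\<^sup>2 / 2)"
      using m by (intro nn_integral_FTC_Icc) (auto intro!: derivative_eq_intros)
    have "ennreal (m\<^sup>2 / 2 + (r - m)) = (\<integral>\<^sup>+s. ennreal s * indicator {0..m} s \<partial>lborel) + emeasure lborel {m..r}"
      using m 1 by simp
    also have "\<dots> = (\<integral>\<^sup>+s. ennreal s * indicator {0..m} s + indicator {m..r} s \<partial>lborel)"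
      by (subst nn_integral_add) auto
    also have "\<dots> \<le> (\<integral>\<^sup>+s. ennreal (layer_weight s) * indicator {s. ennreal (s\<^sup>2) < ennreal (r\<^sup>2)} s \<partial>lborel)"
    proof (rule nn_integral_mono_AE)
      have "AE s in lborel. s \<noteq> m" "AE s in lborel. s \<noteq> r" "AE s in lborel. s \<noteq> (0::real)"
        by (rule AE_lborel_singleton)+
      then show "AE s in lborel. ennreal s * indicator {0..m} s + indicator {m..r} s \<le> ennreal (layer_weight s) * indicator {s. ennreal (s\<^sup>2) < ennreal (r\<^sup>2)} s"
      proof eventually_elim
        case (elim s)
        show ?case
        proof (cases "0 < s \<and> s < r")
          case True
          then have "s\<^sup>2 < r\<^sup>2" by (intro power_strict_mono) auto
          then have "ennreal (s\<^sup>2) < ennreal (r\<^sup>2)" by (simp add: ennreal_less_iff)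
          moreover have "m = r \<or> m = 1" by (auto simp: m_def)
          ultimately show ?thesis using True elim m by (auto simp: indicator_def layer_weight_def ennreal_leI)
        next
          case False
          then show ?thesis using elim m by (auto simp: indicator_def)
        qed
      qed
    qed
    finally have *: "2 * ennreal (m\<^sup>2 / 2 + (r - m)) \<le> ?R (ennreal (r\<^sup>2))" by (rule mult_left_mono) simp
    have "Psi (ennreal (r\<^sup>2)) = min (ennreal (r\<^sup>2)) (ennreal r)"
      using r by (simp add: Psi_def ennreal_sqrt_ennreal)
    also have "\<dots> \<le> ennreal (2 * (m\<^sup>2 / 2 + (r - m)))"
    proof (cases "r \<le> 1")
      case True
      then show ?thesis by (simp add: m_def min.coboundedI1)
    next
      case False
      then have "r \<le> 2 * (m\<^sup>2 / 2 + (r - m))" by (simp add: m_def)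
      then show ?thesis by (intro min.coboundedI2 ennreal_leI)
    qed
    also have "\<dots> = 2 * ennreal (m\<^sup>2 / 2 + (r - m))"
      using m by (subst ennreal_mult) auto
    finally show ?thesis using * by simp
  qed
  have mono: "?R q \<le> ?R q'" if "q \<le> q'" for q q'
    using that by (intro mult_left_mono nn_integral_mono) (auto simp: indicator_def)
  show ?thesis
  proof (cases q)
    case (real r)
    then show ?thesis using fin[of "sqrt r"] by simp
  next
    case top
    have "of_nat n \<le> ?R top" for n
    proof (cases "n = 0")
      case False
      then have "of_nat n = Psi (ennreal ((real n)\<^sup>2))"
        by (simp add: Psi_def ennreal_sqrt_ennreal min_absorb2 ennreal_of_nat_eq_real_of_nat ennreal_leI self_le_power del: of_nat_power)
      also have "\<dots> \<le> ?R (ennreal ((real n)\<^sup>2))" by (rule fin) simp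
      also have "\<dots> \<le> ?R top" by (rule mono) simp
      finally show ?thesis .
    qed simp
    then have R: "ennreal (real n) \<le> ?R top" for n by (simp add: ennreal_of_nat_eq_real_of_nat)
    have "?R top = top"
    proof (cases "?R top")
      case (real r)
      obtain n where n: "r < real n" using reals_Archimedean2 by blast
      have "real n \<le> r" using R[of n] real by (simp only: ennreal_le_iff)
      with n show ?thesis by simp
    qed
    then show ?thesis by (simp add: top)
  qed
qed

lemma nn_integral_Psi_le_layer:
  assumes X: "sigma_finite_measure X" and Q [measurable]: "Q \<in> borel_measurable X"
  shows "(\<integral>\<^sup>+x. Psi (Q x) \<partial>X) \<le> 2 * (\<integral>\<^sup>+s. ennreal (layer_weight s) * emeasure X {x\<in>space X. ennreal (s\<^sup>2) < Q x} \<partial>lborel)"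
proof -
  interpret X: sigma_finite_measure X by fact
  have "(\<integral>\<^sup>+x. Psi (Q x) \<partial>X) \<le> (\<integral>\<^sup>+x. 2 * (\<integral>\<^sup>+s. ennreal (layer_weight s) * indicator {s. ennreal (s\<^sup>2) < Q x} s \<partial>lborel) \<partial>X)"
    by (intro nn_integral_mono Psi_le_layer)
  \<comment> \<open>Written as the indicator of a measurable set in the product space, the integrand
    is visibly jointly measurable.\<close>
  also have "\<dots> = (\<integral>\<^sup>+x. 2 * (\<integral>\<^sup>+s. ennreal (layer_weight s) * indicator {p\<in>space (X \<Otimes>\<^sub>M lborel). ennreal ((snd p)\<^sup>2) < Q (fst p)} (x, s) \<partial>lborel) \<partial>X)"
    by (intro nn_integral_cong) (auto simp: indicator_def space_pair_measure intro!: arg_cong[where f = "(*) 2"] nn_integral_cong)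
  also have "\<dots> = 2 * (\<integral>\<^sup>+x. \<integral>\<^sup>+s. ennreal (layer_weight s) * indicator {p\<in>space (X \<Otimes>\<^sub>M lborel). ennreal ((snd p)\<^sup>2) < Q (fst p)} (x, s) \<partial>lborel \<partial>X)"
    by (intro nn_integral_cmult) measurable
  also have "(\<integral>\<^sup>+x. \<integral>\<^sup>+s. ennreal (layer_weight s) * indicator {p\<in>space (X \<Otimes>\<^sub>M lborel). ennreal ((snd p)\<^sup>2) < Q (fst p)} (x, s) \<partial>lborel \<partial>X) =
      (\<integral>\<^sup>+s. \<integral>\<^sup>+x. ennreal (layer_weight s) * indicator {p\<in>space (X \<Otimes>\<^sub>M lborel). ennreal ((snd p)\<^sup>2) < Q (fst p)} (x, s) \<partial>X \<partial>lborel)"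
    by (intro nn_integral_swap X lborel.sigma_finite_measure_axioms) measurable
  also have "\<dots> = (\<integral>\<^sup>+s. ennreal (layer_weight s) * emeasure X {x\<in>space X. ennreal (s\<^sup>2) < Q x} \<partial>lborel)"
  proof (rule nn_integral_cong)
    fix s :: real
    have "(\<integral>\<^sup>+x. ennreal (layer_weight s) * indicator {p\<in>space (X \<Otimes>\<^sub>M lborel). ennreal ((snd p)\<^sup>2) < Q (fst p)} (x, s) \<partial>X) =
      (\<integral>\<^sup>+x. ennreal (layer_weight s) * indicator {x\<in>space X. ennreal (s\<^sup>2) < Q x} x \<partial>X)"
      by (intro nn_integral_cong) (auto simp: indicator_def space_pair_measure)
    also have "\<dots> = ennreal (layer_weight s) * emeasure X {x\<in>space X. ennreal (s\<^sup>2) < Q x}"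
      by (rule nn_integral_cmult_indicator) measurable
    finally show "(\<integral>\<^sup>+x. ennreal (layer_weight s) * indicator {p\<in>space (X \<Otimes>\<^sub>M lborel). ennreal ((snd p)\<^sup>2) < Q (fst p)} (x, s) \<partial>X) =
      ennreal (layer_weight s) * emeasure X {x\<in>space X. ennreal (s\<^sup>2) < Q x}" .
  qed
  finally show ?thesis .
qed

text \<open>For all \<open>u >= 0\<close> one has \<open>1 <= 2 * ln (2 + u)\<close>, and for
  \<open>u > 1\<close> also \<open>1 + ln u <= 2 * ln (2 + u)\<close>, since then
  \<open>2 + u >= exp 1\<close>.\<close>

lemma Psi_log_le:
  assumes "0 \<le> u"
  shows "Psi_log k u \<le> 2 ^ k * (u * ln (2 + u) ^ k)"
proof -
  have ln2: "1 / 2 \<le> ln (2::real)" using ln2_ge_two_thirds by simp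
  show ?thesis
  proof (cases "u \<le> 1")
    case True
    have "u powr (3 / 2) \<le> u powr 1" using assms True by (intro powr_mono') auto
    also have "\<dots> = u * 1" using assms by simp
    also have "1 \<le> (2 * ln (2 + u)) ^ k"
    proof (rule one_le_power)
      have "ln 2 \<le> ln (2 + u)" using assms by simp
      with ln2 show "1 \<le> 2 * ln (2 + u)" by linarith
    qed
    then have "u * 1 \<le> u * (2 * ln (2 + u)) ^ k" using assms by (rule mult_left_mono)
    finally show ?thesis using True by (simp add: Psi_log_def power_mult_distrib mult_ac)
  next
    case False
    have "exp 1 \<le> 2 + u" using exp_le False by simp
    then have "1 \<le> ln (2 + u)" using False by (simp add: ln_ge_iff)
    moreover have "ln u \<le> ln (2 + u)" using False by (intro ln_mono) auto
    ultimately have "1 + ln u \<le> 2 * ln (2 + u)" by linarith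
    then have "(1 + ln u) ^ k \<le> (2 * ln (2 + u)) ^ k" using False by (intro power_mono) auto
    then have "u * (1 + ln u) ^ k \<le> u * (2 * ln (2 + u)) ^ k" using assms by (rule mult_left_mono)
    then show ?thesis using False by (simp add: Psi_log_def power_mult_distrib mult_ac)
  qed
qed

text \<open>Start of the induction over variables: values below 1 pass from the square to the
  exponent of \<open>Psi_log\<close>.\<close>

lemma Psi_power2_le: "Psi (ennreal (r\<^sup>2)) \<le> ennreal (Psi_log 0 \<bar>r\<bar>)"
proof (cases "\<bar>r\<bar> \<le> 1")
  case True
  have "r\<^sup>2 = \<bar>r\<bar> powr 2" by (cases "r = 0") (auto simp: powr_numeral)
  also have "\<dots> \<le> \<bar>r\<bar> powr (3 / 2)" using True by (intro powr_mono') auto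
  finally show ?thesis using True by (simp add: Psi_def Psi_log_def min.coboundedI1 ennreal_leI)
next
  case False
  then show ?thesis by (simp add: Psi_def Psi_log_def ennreal_sqrt_ennreal)
qed

section \<open>Several variables\<close>

text \<open>Points are functions on an index set instead of vectors, because the induction adds one
  variable at a time and needs product measures over arbitrary sets of indices.\<close>

abbreviation lborel_n :: "'n set \<Rightarrow> ('n \<Rightarrow> real) measure" where
  "lborel_n I \<equiv> Pi\<^sub>M I (\<lambda>_. lborel)"

abbreviation nu_n :: "'n set \<Rightarrow> ('n \<Rightarrow> real) measure" where
  "nu_n I \<equiv> Pi\<^sub>M I (\<lambda>_. nu)"

interpretation lborel_n: product_sigma_finite "\<lambda>_. lborel :: real measure"
  by (simp add: product_sigma_finite_def lborel.sigma_finite_measure_axioms)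

interpretation nu_n: product_sigma_finite "\<lambda>_. nu"
  by (simp add: product_sigma_finite_def sigma_finite_nu)

definition splice_on :: "'n set \<Rightarrow> ('n \<Rightarrow> real) \<Rightarrow> ('n \<Rightarrow> real) \<Rightarrow> 'n \<Rightarrow> real" where
  "splice_on I x y = (\<lambda>i. if i \<in> I then y i else x i)"

lemma measurable_splice_on [measurable (raw)]:
  assumes g: "g \<in> M \<rightarrow>\<^sub>M lborel_n UNIV" and h: "h \<in> M \<rightarrow>\<^sub>M lborel_n I"
  shows "(\<lambda>p. splice_on I (g p) (h p)) \<in> M \<rightarrow>\<^sub>M lborel_n UNIV"
proof (rule measurable_PiM_single')
  show "(\<lambda>p. splice_on I (g p) (h p) i) \<in> M \<rightarrow>\<^sub>M lborel" for i
  proof (cases "i \<in> I")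
    case True
    then show ?thesis using measurable_compose[OF h measurable_component_singleton[OF True]] by (simp add: splice_on_def)
  next
    case False
    then show ?thesis using measurable_compose[OF g measurable_component_singleton[of i UNIV]] by (simp add: splice_on_def)
  qed
qed auto

lemma measurable_component_lborel_n:
  assumes "g \<in> M \<rightarrow>\<^sub>M lborel_n I" "i \<in> I"
  shows "(\<lambda>p. g p i) \<in> borel_measurable M"
  using measurable_compose[OF assms(1) measurable_component_singleton[OF assms(2)]] by simp

lemma measurable_component_nu_n:
  assumes "g \<in> M \<rightarrow>\<^sub>M nu_n I" "i \<in> I"
  shows "(\<lambda>p. g p i) \<in> borel_measurable M"
  using measurable_compose[OF assms(1) measurable_component_singleton[OF assms(2)]] by (simp add: measurable_cong_sets[OF refl sets_nu])

lemma measurable_fun_upd_lborel_n [measurable (raw)]: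
  assumes "g \<in> M \<rightarrow>\<^sub>M lborel_n UNIV" "h \<in> borel_measurable M"
  shows "(\<lambda>p. (g p)(j := h p)) \<in> M \<rightarrow>\<^sub>M lborel_n UNIV"
proof (rule measurable_PiM_single')
  show "(\<lambda>p. ((g p)(j := h p)) i) \<in> M \<rightarrow>\<^sub>M lborel" for i
    using assms(2) measurable_compose[OF assms(1) measurable_component_singleton[of i UNIV]] by (cases "i = j") simp_all
qed auto

lemma measurable_fun_upd_lborel_n_remove [measurable (raw)]:
  assumes "g \<in> M \<rightarrow>\<^sub>M lborel_n (UNIV - {j})" "h \<in> borel_measurable M"
  shows "(\<lambda>p. (g p)(j := h p)) \<in> M \<rightarrow>\<^sub>M lborel_n UNIV"
proof (rule measurable_PiM_single')
  show "(\<lambda>p. ((g p)(j := h p)) i) \<in> M \<rightarrow>\<^sub>M lborel" for i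
    using assms(2) measurable_compose[OF assms(1) measurable_component_singleton[of i "UNIV - {j}"]] by (cases "i = j") simp_all
qed auto

lemma nn_integral_lborel_n_split:
  fixes g :: "('n::finite \<Rightarrow> real) \<Rightarrow> ennreal"
  assumes "g \<in> borel_measurable (lborel_n UNIV)"
  shows "(\<integral>\<^sup>+x. g x \<partial>lborel_n UNIV) = (\<integral>\<^sup>+x. \<integral>\<^sup>+u. g (x(j := u)) \<partial>lborel \<partial>lborel_n (UNIV - {j}))"
proof -
  have "insert j (UNIV - {j}) = (UNIV :: 'n set)" by auto
  then show ?thesis
    using lborel_n.product_nn_integral_insert[of "UNIV - {j}" j g] assms by simp
qed

section \<open>Convolution in some of the variables\<close>

locale product_kernel =
  fixes \<alpha> :: "'n::finite \<Rightarrow> real"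
  assumes \<alpha>: "\<And>i. \<alpha> i > 1/2"
begin

text \<open>Convolution in the variables of \<open>I\<close> only, the other coordinates of
  \<open>x\<close> being frozen. As a function of \<open>x\<close> with values in the functions of
  \<open>t\<close> on \<open>I\<close>, this is the vector-valued function to which the next
  variable is applied.\<close>

definition conv_on :: "'n set \<Rightarrow> (('n \<Rightarrow> real) \<Rightarrow> real) \<Rightarrow> ('n \<Rightarrow> real) \<Rightarrow> ('n \<Rightarrow> real) \<Rightarrow> real" where
  "conv_on I f x t = (LINT y|lborel_n I. f (splice_on I x y) * (\<Prod>i\<in>I. phi_dil (\<alpha> i) (t i) (x i - y i)))"

text \<open>Its finiteness is the condition under which the variables may be integrated one after
  the other.\<close>

definition abs_conv_on :: "'n set \<Rightarrow> (('n \<Rightarrow> real) \<Rightarrow> real) \<Rightarrow> ('n \<Rightarrow> real) \<Rightarrow> ('n \<Rightarrow> real) \<Rightarrow> ennreal" where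
  "abs_conv_on I f x t = (\<integral>\<^sup>+y. ennreal \<bar>f (splice_on I x y) * (\<Prod>i\<in>I. phi_dil (\<alpha> i) (t i) (x i - y i))\<bar> \<partial>lborel_n I)"

definition square_on :: "'n set \<Rightarrow> (('n \<Rightarrow> real) \<Rightarrow> real) \<Rightarrow> ('n \<Rightarrow> real) \<Rightarrow> ennreal" where
  "square_on I f x = (\<integral>\<^sup>+t. ennreal ((conv_on I f x t)\<^sup>2) \<partial>nu_n I)"

lemma sigma_finite_lborel_n: "sigma_finite_measure (lborel_n I :: ('n \<Rightarrow> real) measure)"
  by (rule lborel_n.sigma_finite) simp

lemma sigma_finite_nu_n: "sigma_finite_measure (nu_n I :: ('n \<Rightarrow> real) measure)"
  by (rule nu_n.sigma_finite) simp

context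
  fixes f :: "('n \<Rightarrow> real) \<Rightarrow> real"
  assumes f [measurable]: "f \<in> borel_measurable (lborel_n UNIV)"
begin

lemma measurable_integrand [measurable (raw)]:
  assumes [measurable]: "g \<in> M \<rightarrow>\<^sub>M lborel_n UNIV" "h \<in> M \<rightarrow>\<^sub>M lborel_n I" "t \<in> M \<rightarrow>\<^sub>M nu_n I"
  shows "(\<lambda>p. f (splice_on I (g p) (h p)) * (\<Prod>i\<in>I. phi_dil (\<alpha> i) (t p i) (g p i - h p i))) \<in> borel_measurable M"
proof (rule borel_measurable_times)
  show "(\<lambda>p. f (splice_on I (g p) (h p))) \<in> borel_measurable M"
    by (rule measurable_compose[OF _ f]) measurable
  show "(\<lambda>p. \<Prod>i\<in>I. phi_dil (\<alpha> i) (t p i) (g p i - h p i)) \<in> borel_measurable M"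
    using measurable_component_lborel_n[OF assms(1) UNIV_I] measurable_component_lborel_n[OF assms(2)] measurable_component_nu_n[OF assms(3)]
    by (intro borel_measurable_prod measurable_phi_dil borel_measurable_diff) auto
qed

lemma measurable_conv_on [measurable (raw)]:
  assumes [measurable]: "g \<in> M \<rightarrow>\<^sub>M lborel_n UNIV" "t \<in> M \<rightarrow>\<^sub>M nu_n I"
  shows "(\<lambda>p. conv_on I f (g p) (t p)) \<in> borel_measurable M"
proof -
  interpret S: sigma_finite_measure "lborel_n I :: ('n \<Rightarrow> real) measure" by (rule sigma_finite_lborel_n)
  show ?thesis
    unfolding conv_on_def
    by (intro S.borel_measurable_lebesgue_integral, unfold case_prod_beta, intro measurable_integrand) measurable
qed

lemma measurable_abs_conv_on [measurable (raw)]: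
  assumes [measurable]: "g \<in> M \<rightarrow>\<^sub>M lborel_n UNIV" "t \<in> M \<rightarrow>\<^sub>M nu_n I"
  shows "(\<lambda>p. abs_conv_on I f (g p) (t p)) \<in> borel_measurable M"
proof -
  interpret S: sigma_finite_measure "lborel_n I :: ('n \<Rightarrow> real) measure" by (rule sigma_finite_lborel_n)
  have "(\<lambda>p. \<bar>f (splice_on I (g (fst p)) (snd p)) * (\<Prod>i\<in>I. phi_dil (\<alpha> i) (t (fst p) i) (g (fst p) i - snd p i))\<bar>) \<in> borel_measurable (M \<Otimes>\<^sub>M lborel_n I)"
    by (intro borel_measurable_abs measurable_integrand) measurable
  from measurable_compose[OF this measurable_ennreal] show ?thesis
    unfolding abs_conv_on_def by (intro S.borel_measurable_nn_integral) (simp add: case_prod_beta)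
qed

lemma measurable_square_on [measurable (raw)]:
  assumes [measurable]: "g \<in> M \<rightarrow>\<^sub>M lborel_n UNIV"
  shows "(\<lambda>p. square_on I f (g p)) \<in> borel_measurable M"
proof -
  interpret S: sigma_finite_measure "nu_n I :: ('n \<Rightarrow> real) measure" by (rule sigma_finite_nu_n)
  show ?thesis unfolding square_on_def by measurable
qed

lemma abs_conv_on_upper_bound: "ennreal \<bar>conv_on I f x t\<bar> \<le> abs_conv_on I f x t"
  unfolding conv_on_def abs_conv_on_def by (rule ennreal_abs_integral_le)

lemma integrand_insert:
  assumes j: "j \<notin> I"
  shows "f (splice_on (insert j I) x (y(j := u))) * (\<Prod>i\<in>insert j I. phi_dil (\<alpha> i) (t i) (x i - (y(j := u)) i)) =
    phi_dil (\<alpha> j) (t j) (x j - u) * (f (splice_on I (x(j := u)) y) * (\<Prod>i\<in>I. phi_dil (\<alpha> i) (t i) ((x(j := u)) i - y i)))"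
proof -
  have "splice_on (insert j I) x (y(j := u)) = splice_on I (x(j := u)) y"
    using j by (auto simp: splice_on_def fun_eq_iff)
  moreover have "(\<Prod>i\<in>I. phi_dil (\<alpha> i) (t i) (x i - (y(j := u)) i)) = (\<Prod>i\<in>I. phi_dil (\<alpha> i) (t i) ((x(j := u)) i - y i))"
    using j by (intro prod.cong) auto
  ultimately show ?thesis using j by simp
qed

lemma restrict_in_space_nu_n:
  "t \<in> space (nu_n (insert j I)) \<Longrightarrow> restrict t I \<in> space (nu_n I)"
  by (auto simp: space_PiM)

text \<open>Elements of \<open>space (nu_n I)\<close> are extensional; a \<open>t\<close> from a
  larger index set has to be restricted before the measurability rules apply, and this does not
  change the value.\<close>

lemma conv_on_restrict: "conv_on I f x (restrict t I) = conv_on I f x t"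
  unfolding conv_on_def by (intro Bochner_Integration.integral_cong refl arg_cong2[where f = "(*)"] prod.cong) auto

lemma abs_conv_on_restrict: "abs_conv_on I f x (restrict t I) = abs_conv_on I f x t"
  unfolding abs_conv_on_def
  by (intro nn_integral_cong arg_cong[where f = "\<lambda>z. ennreal \<bar>_ * z\<bar>"] prod.cong) auto

lemma abs_conv_on_insert:
  assumes j: "j \<notin> I" and x [measurable]: "x \<in> space (lborel_n UNIV)" and t: "t \<in> space (nu_n (insert j I))"
  shows "abs_conv_on (insert j I) f x t = (\<integral>\<^sup>+u. ennreal \<bar>phi_dil (\<alpha> j) (t j) (x j - u)\<bar> * abs_conv_on I f (x(j := u)) t \<partial>lborel)"
proof -
  have [measurable]: "(\<lambda>_. t) \<in> M \<rightarrow>\<^sub>M nu_n (insert j I)" "(\<lambda>_. x) \<in> M \<rightarrow>\<^sub>M lborel_n UNIV" for M :: "'x measure"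
    using t x by auto
  have t': "restrict t I \<in> space (nu_n I)" using t by (rule restrict_in_space_nu_n)
  have [measurable]: "(\<lambda>_. restrict t I) \<in> M \<rightarrow>\<^sub>M nu_n I" for M :: "'y measure"
    using t' by auto
  have eq: "(\<Prod>i\<in>I. phi_dil (\<alpha> i) (t i) (z i - y i)) = (\<Prod>i\<in>I. phi_dil (\<alpha> i) (restrict t I i) (z i - y i))" for z y
    by (intro prod.cong) auto
  have "abs_conv_on (insert j I) f x t = (\<integral>\<^sup>+u. \<integral>\<^sup>+y. ennreal \<bar>f (splice_on (insert j I) x (y(j := u))) * (\<Prod>i\<in>insert j I. phi_dil (\<alpha> i) (t i) (x i - (y(j := u)) i))\<bar> \<partial>lborel_n I \<partial>lborel)"
    unfolding abs_conv_on_def using j by (intro lborel_n.product_nn_integral_insert_rev) (auto intro!: measurable_compose[OF _ measurable_ennreal] borel_measurable_abs measurable_integrand)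
  also have "\<dots> = (\<integral>\<^sup>+u. \<integral>\<^sup>+y. ennreal \<bar>phi_dil (\<alpha> j) (t j) (x j - u)\<bar> * ennreal \<bar>f (splice_on I (x(j := u)) y) * (\<Prod>i\<in>I. phi_dil (\<alpha> i) (t i) ((x(j := u)) i - y i))\<bar> \<partial>lborel_n I \<partial>lborel)"
    unfolding integrand_insert[OF j] by (simp only: abs_mult ennreal_mult abs_ge_zero mult_nonneg_nonneg)
  also have "\<dots> = (\<integral>\<^sup>+u. ennreal \<bar>phi_dil (\<alpha> j) (t j) (x j - u)\<bar> * abs_conv_on I f (x(j := u)) t \<partial>lborel)"
    unfolding abs_conv_on_def eq
    by (intro nn_integral_cong nn_integral_cmult) (auto intro!: measurable_compose[OF _ measurable_ennreal] borel_measurable_abs measurable_integrand)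
  finally show ?thesis .
qed

text \<open>The factor of the new variable depends on \<open>u\<close> alone and leaves the inner
  integral, which is then the convolution in the old variables at \<open>x(j := u)\<close>. The
  interchange rests on absolute convergence at this particular \<open>x\<close> and
  \<open>t\<close>.\<close>

lemma conv_on_insert:
  assumes j: "j \<notin> I" and x [measurable]: "x \<in> space (lborel_n UNIV)" and t: "t \<in> space (nu_n (insert j I))"
    and fin: "abs_conv_on (insert j I) f x t < \<infinity>"
  shows "conv_on (insert j I) f x t = (LINT u|lborel. conv_on I f (x(j := u)) t * phi_dil (\<alpha> j) (t j) (x j - u))"
proof -
  have [measurable]: "(\<lambda>_. t) \<in> M \<rightarrow>\<^sub>M nu_n (insert j I)" "(\<lambda>_. x) \<in> M \<rightarrow>\<^sub>M lborel_n UNIV" for M :: "'x measure"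
    using t x by auto
  have t': "restrict t I \<in> space (nu_n I)" using t by (rule restrict_in_space_nu_n)
  have [measurable]: "(\<lambda>_. restrict t I) \<in> M \<rightarrow>\<^sub>M nu_n I" for M :: "'y measure"
    using t' by auto
  have eq: "(\<Prod>i\<in>I. phi_dil (\<alpha> i) (t i) (z i - y i)) = (\<Prod>i\<in>I. phi_dil (\<alpha> i) (restrict t I i) (z i - y i))" for z y
    by (intro prod.cong) auto
  let ?g = "\<lambda>y. f (splice_on (insert j I) x y) * (\<Prod>i\<in>insert j I. phi_dil (\<alpha> i) (t i) (x i - y i))"
  have [measurable]: "?g \<in> borel_measurable (lborel_n (insert j I))"
    by (rule measurable_integrand[where g = "\<lambda>_. x" and h = "\<lambda>y. y" and t = "\<lambda>_. t"]) (use x t in auto)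
  have int: "integrable (lborel_n (insert j I)) ?g"
    using fin by (intro integrableI_bounded) (auto simp: abs_conv_on_def)
  have meas: "(\<lambda>(y, u). phi_dil (\<alpha> j) (t j) (x j - u) * (f (splice_on I (x(j := u)) y) * (\<Prod>i\<in>I. phi_dil (\<alpha> i) (t i) ((x(j := u)) i - y i)))) \<in> borel_measurable (lborel_n I \<Otimes>\<^sub>M lborel)"
  proof -
    have 1: "(\<lambda>p. phi_dil (\<alpha> j) (t j) (x j - snd p)) \<in> borel_measurable (lborel_n I \<Otimes>\<^sub>M lborel)"
      by measurable
    have 2: "(\<lambda>p. f (splice_on I (x(j := snd p)) (fst p)) * (\<Prod>i\<in>I. phi_dil (\<alpha> i) (restrict t I i) ((x(j := snd p)) i - fst p i))) \<in> borel_measurable (lborel_n I \<Otimes>\<^sub>M lborel)"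
    proof (rule measurable_integrand[where g = "\<lambda>p. x(j := snd p)" and h = fst and t = "\<lambda>_. restrict t I"])
      show "(\<lambda>p. x(j := snd p)) \<in> lborel_n I \<Otimes>\<^sub>M lborel \<rightarrow>\<^sub>M lborel_n UNIV"
        by (rule measurable_fun_upd_lborel_n[OF measurable_const[OF x]]) measurable
    qed (use t' in auto)
    show ?thesis unfolding eq case_prod_beta by (rule borel_measurable_times[OF 1 2])
  qed
  have "conv_on (insert j I) f x t = (LINT y|lborel_n I. LINT u|lborel. ?g (y(j := u)))"
    unfolding conv_on_def using j int by (intro lborel_n.product_integral_insert) auto
  also have "\<dots> = (LINT y|lborel_n I. LINT u|lborel. phi_dil (\<alpha> j) (t j) (x j - u) * (f (splice_on I (x(j := u)) y) * (\<Prod>i\<in>I. phi_dil (\<alpha> i) (t i) ((x(j := u)) i - y i))))"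
    unfolding integrand_insert[OF j] ..
  also have "\<dots> = (LINT u|lborel. LINT y|lborel_n I. phi_dil (\<alpha> j) (t j) (x j - u) * (f (splice_on I (x(j := u)) y) * (\<Prod>i\<in>I. phi_dil (\<alpha> i) (t i) ((x(j := u)) i - y i))))"
  proof (intro integral_swap sigma_finite_lborel_n lborel.sigma_finite_measure_axioms meas)
    have "(\<integral>\<^sup>+y. \<integral>\<^sup>+u. ennreal \<bar>?g (y(j := u))\<bar> \<partial>lborel \<partial>lborel_n I) = abs_conv_on (insert j I) f x t"
      unfolding abs_conv_on_def using j by (intro lborel_n.product_nn_integral_insert[symmetric]) auto
    then show "(\<integral>\<^sup>+y. \<integral>\<^sup>+u. ennreal \<bar>phi_dil (\<alpha> j) (t j) (x j - u) * (f (splice_on I (x(j := u)) y) * (\<Prod>i\<in>I. phi_dil (\<alpha> i) (t i) ((x(j := u)) i - y i)))\<bar> \<partial>lborel \<partial>lborel_n I) < \<infinity>"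
      unfolding integrand_insert[OF j] using fin by simp
  qed
  also have "\<dots> = (LINT u|lborel. conv_on I f (x(j := u)) t * phi_dil (\<alpha> j) (t j) (x j - u))"
    by (simp add: conv_on_def mult.commute)
  finally show ?thesis .
qed

text \<open>Each variable costs the factor 2 that bounds the \<open>L^1\<close> norm of
  \<open>phi_dil\<close>. The statement is for every fixed \<open>t\<close>, so an integrable
  \<open>f\<close> gives absolute convergence at almost every \<open>x\<close>.\<close>

lemma nn_integral_abs_conv_on_le:
  assumes t: "t \<in> space (nu_n UNIV)"
  shows "(\<integral>\<^sup>+x. abs_conv_on I f x t \<partial>lborel_n UNIV) \<le> 2 ^ card I * (\<integral>\<^sup>+x. ennreal \<bar>f x\<bar> \<partial>lborel_n UNIV)"
  using finite[of I]
proof (induction I)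
  case empty
  have "abs_conv_on {} f x t = ennreal \<bar>f x\<bar>" for x
    by (simp add: abs_conv_on_def splice_on_def PiM_empty nn_integral_count_space_finite)
  then show ?case by simp
next
  case (insert j I)
  have tr: "restrict t K \<in> space (nu_n K)" for K using t by (auto simp: space_PiM)
  have tm [measurable]: "(\<lambda>_. restrict t K) \<in> M \<rightarrow>\<^sub>M nu_n K" for M :: "'x measure" and K
    using tr by auto
  have A [measurable]: "(\<lambda>p. abs_conv_on K f (g p) t) \<in> borel_measurable M" if "g \<in> M \<rightarrow>\<^sub>M lborel_n UNIV" for K M and g :: "'y \<Rightarrow> _"
    using measurable_abs_conv_on[OF that measurable_const[OF tr]] by (simp add: abs_conv_on_restrict)
  have "(\<integral>\<^sup>+x. abs_conv_on (insert j I) f x t \<partial>lborel_n UNIV) =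
    (\<integral>\<^sup>+x. \<integral>\<^sup>+v. abs_conv_on (insert j I) f (x(j := v)) t \<partial>lborel \<partial>lborel_n (UNIV - {j}))"
    by (rule nn_integral_lborel_n_split[OF A]) measurable
  also have "\<dots> = (\<integral>\<^sup>+x. \<integral>\<^sup>+v. \<integral>\<^sup>+u. ennreal \<bar>phi_dil (\<alpha> j) (t j) (v - u)\<bar> * abs_conv_on I f (x(j := u)) t \<partial>lborel \<partial>lborel \<partial>lborel_n (UNIV - {j}))"
  proof (intro nn_integral_cong)
    fix x :: "'n \<Rightarrow> real" and v :: real
    have "abs_conv_on (insert j I) f (x(j := v)) t = abs_conv_on (insert j I) f (x(j := v)) (restrict t (insert j I))"
      by (simp only: abs_conv_on_restrict)
    also have "\<dots> = (\<integral>\<^sup>+u. ennreal \<bar>phi_dil (\<alpha> j) (t j) (v - u)\<bar> * abs_conv_on I f (x(j := u)) (restrict t (insert j I)) \<partial>lborel)"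
      using insert(2) tr by (subst abs_conv_on_insert) (auto simp: space_PiM)
    also have "\<dots> = (\<integral>\<^sup>+u. ennreal \<bar>phi_dil (\<alpha> j) (t j) (v - u)\<bar> * abs_conv_on I f (x(j := u)) t \<partial>lborel)"
      by (subst (1 2) abs_conv_on_restrict[symmetric]) (simp add: Int_absorb1 subset_insertI)
    finally show "abs_conv_on (insert j I) f (x(j := v)) t = (\<integral>\<^sup>+u. ennreal \<bar>phi_dil (\<alpha> j) (t j) (v - u)\<bar> * abs_conv_on I f (x(j := u)) t \<partial>lborel)" .
  qed
  also have "\<dots> = (\<integral>\<^sup>+x. \<integral>\<^sup>+u. \<integral>\<^sup>+v. ennreal \<bar>phi_dil (\<alpha> j) (t j) (v - u)\<bar> * abs_conv_on I f (x(j := u)) t \<partial>lborel \<partial>lborel \<partial>lborel_n (UNIV - {j}))"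
  proof (rule nn_integral_cong)
    fix x assume x: "x \<in> space (lborel_n (UNIV - {j}) :: ('n \<Rightarrow> real) measure)"
    have xj: "(\<lambda>p. x(j := snd p)) \<in> lborel \<Otimes>\<^sub>M lborel \<rightarrow>\<^sub>M lborel_n UNIV"
      by (rule measurable_fun_upd_lborel_n_remove[OF measurable_const[OF x]]) measurable
    have m1: "(\<lambda>p. ennreal \<bar>phi_dil (\<alpha> j) (t j) (fst p - snd p)\<bar>) \<in> borel_measurable (lborel \<Otimes>\<^sub>M lborel)"
      by measurable
    show "(\<integral>\<^sup>+v. \<integral>\<^sup>+u. ennreal \<bar>phi_dil (\<alpha> j) (t j) (v - u)\<bar> * abs_conv_on I f (x(j := u)) t \<partial>lborel \<partial>lborel) =
      (\<integral>\<^sup>+u. \<integral>\<^sup>+v. ennreal \<bar>phi_dil (\<alpha> j) (t j) (v - u)\<bar> * abs_conv_on I f (x(j := u)) t \<partial>lborel \<partial>lborel)"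
      using borel_measurable_times_ennreal[OF m1 A[OF xj, of I]]
      by (intro nn_integral_swap lborel.sigma_finite_measure_axioms) (simp add: case_prod_beta)
  qed
  also have "\<dots> = (\<integral>\<^sup>+x. \<integral>\<^sup>+u. (\<integral>\<^sup>+v. ennreal \<bar>phi_dil (\<alpha> j) (t j) (v - u)\<bar> \<partial>lborel) * abs_conv_on I f (x(j := u)) t \<partial>lborel \<partial>lborel_n (UNIV - {j}))"
    by (intro nn_integral_cong nn_integral_multc) measurable
  also have "\<dots> \<le> (\<integral>\<^sup>+x. \<integral>\<^sup>+u. 2 * abs_conv_on I f (x(j := u)) t \<partial>lborel \<partial>lborel_n (UNIV - {j}))"
  proof (intro nn_integral_mono mult_right_mono)
    fix u :: real
    have "0 < \<alpha> j" using \<alpha>[of j] by simp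
    then show "(\<integral>\<^sup>+v. ennreal \<bar>phi_dil (\<alpha> j) (t j) (v - u)\<bar> \<partial>lborel) \<le> 2"
      using nn_integral_shift[of "\<lambda>v. ennreal \<bar>phi_dil (\<alpha> j) (t j) v\<bar>" "- u"] nn_integral_phi_dil_le[of "\<alpha> j" "t j"] by simp
  qed simp
  also have "\<dots> = (\<integral>\<^sup>+x. 2 * abs_conv_on I f x t \<partial>lborel_n UNIV)"
    by (intro nn_integral_lborel_n_split[symmetric] borel_measurable_times_ennreal borel_measurable_const A) simp
  also have "\<dots> = 2 * (\<integral>\<^sup>+x. abs_conv_on I f x t \<partial>lborel_n UNIV)"
    by (intro nn_integral_cmult A) simp
  also have "\<dots> \<le> 2 * (2 ^ card I * (\<integral>\<^sup>+x. ennreal \<bar>f x\<bar> \<partial>lborel_n UNIV))"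
    by (intro mult_left_mono insert.IH) simp
  finally show ?case using insert(1,2) by (simp add: mult.assoc)
qed

end

end

section \<open>Induction over the variables\<close>

context product_kernel
begin

lemma square_on_scale:
  assumes [measurable]: "f \<in> borel_measurable (lborel_n UNIV)" and s: "s > 0" and x [measurable]: "x \<in> space (lborel_n UNIV)"
  shows "square_on I (\<lambda>x. f x / s) x = square_on I f x * ennreal (1 / s\<^sup>2)"
proof -
  have "conv_on I (\<lambda>x. f x / s) x t = conv_on I f x t / s" for t
    by (simp add: conv_on_def)
  then have "square_on I (\<lambda>x. f x / s) x = (\<integral>\<^sup>+t. ennreal ((conv_on I f x t)\<^sup>2) * ennreal (1 / s\<^sup>2) \<partial>nu_n I)"
    by (simp add: square_on_def power_divide flip: ennreal_mult)
  also have "\<dots> = square_on I f x * ennreal (1 / s\<^sup>2)"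
    unfolding square_on_def by (intro nn_integral_multc) measurable
  finally show ?thesis .
qed

lemma abs_conv_on_finite:
  assumes f: "integrable (lborel_n UNIV) f"
  shows "(\<integral>\<^sup>+x. abs_conv_on I f x t \<partial>lborel_n UNIV) < \<infinity>"
proof -
  have "(\<integral>\<^sup>+x. abs_conv_on I f x t \<partial>lborel_n UNIV) \<le> 2 ^ card I * (\<integral>\<^sup>+x. ennreal \<bar>f x\<bar> \<partial>lborel_n UNIV)"
    using f by (intro nn_integral_abs_conv_on_le) (auto simp: space_PiM)
  also have "\<dots> < \<infinity>"
    using f by (auto simp: integrable_iff_bounded ennreal_mult_less_top power_less_top_ennreal)
  finally show ?thesis .
qed

text \<open>The square function in one more variable is the one-variable square function of the
  \<open>L^2\<close>-valued convolution in the old ones. Equality is claimed for those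
  \<open>x\<close> at which absolute convergence holds for almost every \<open>t\<close>.\<close>

lemma square_on_insert_AE:
  assumes j: "j \<notin> I" and f: "integrable (lborel_n UNIV) f"
  shows "AE x in lborel_n UNIV. square_on (insert j I) f x =
    (\<integral>\<^sup>+w. \<integral>\<^sup>+t. ennreal ((LINT u|lborel. conv_on I f (x(j := u)) w * phi_dil (\<alpha> j) t (x j - u))\<^sup>2) \<partial>nu \<partial>nu_n I)"
proof -
  note [measurable] = borel_measurable_integrable[OF f]
  interpret P: pair_sigma_finite "lborel_n UNIV :: ('n \<Rightarrow> real) measure" "nu_n (insert j I) :: ('n \<Rightarrow> real) measure"
    by (simp add: pair_sigma_finite_def sigma_finite_lborel_n sigma_finite_nu_n)
  have "AE x in lborel_n UNIV. AE t in nu_n (insert j I). abs_conv_on (insert j I) f x t < \<infinity>"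
  proof (subst P.AE_commute)
    show "{p \<in> space (lborel_n UNIV \<Otimes>\<^sub>M nu_n (insert j I)). abs_conv_on (insert j I) f (fst p) (snd p) < \<infinity>} \<in> sets (lborel_n UNIV \<Otimes>\<^sub>M nu_n (insert j I))"
      by measurable
    show "AE t in nu_n (insert j I). AE x in lborel_n UNIV. abs_conv_on (insert j I) f x t < \<infinity>"
    proof (rule AE_I2)
      fix t assume [measurable]: "t \<in> space (nu_n (insert j I) :: ('n \<Rightarrow> real) measure)"
      have "AE x in lborel_n UNIV. abs_conv_on (insert j I) f x t \<noteq> \<infinity>"
        by (rule nn_integral_PInf_AE, measurable) (use abs_conv_on_finite[OF f, of "insert j I" t] in \<open>simp add: less_top\<close>)
      then show "AE x in lborel_n UNIV. abs_conv_on (insert j I) f x t < \<infinity>"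
        by (simp add: top.not_eq_extremum)
    qed
  qed
  then show ?thesis
  proof (rule AE_mp, intro AE_I2 impI)
    fix x assume x [measurable]: "x \<in> space (lborel_n UNIV :: ('n \<Rightarrow> real) measure)"
      and fin: "AE t in nu_n (insert j I). abs_conv_on (insert j I) f x t < \<infinity>"
    let ?g = "\<lambda>t. ennreal ((LINT u|lborel. conv_on I f (x(j := u)) (restrict t I) * phi_dil (\<alpha> j) (t j) (x j - u))\<^sup>2)"
    have [measurable]: "(\<lambda>t. t j) \<in> borel_measurable (nu_n (insert j I))"
      by (rule measurable_component_nu_n[where g = "\<lambda>t. t" and I = "insert j I"]) auto
    have [measurable]: "(\<lambda>t. restrict t I) \<in> nu_n (insert j I) \<rightarrow>\<^sub>M nu_n I"
      by (rule measurable_restrict_subset) auto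
    have xj: "(\<lambda>p. x(j := snd p)) \<in> nu_n (insert j I) \<Otimes>\<^sub>M lborel \<rightarrow>\<^sub>M lborel_n UNIV"
      by (rule measurable_fun_upd_lborel_n[OF measurable_const[OF x]]) measurable
    have "square_on (insert j I) f x = (\<integral>\<^sup>+t. ?g t \<partial>nu_n (insert j I))"
      unfolding square_on_def
    proof (rule nn_integral_cong_AE, rule AE_mp[OF fin], intro AE_I2 impI)
      fix t assume t: "t \<in> space (nu_n (insert j I) :: ('n \<Rightarrow> real) measure)" and "abs_conv_on (insert j I) f x t < \<infinity>"
      then show "ennreal ((conv_on (insert j I) f x t)\<^sup>2) = ?g t"
        by (simp add: conv_on_insert[OF _ j x t] conv_on_restrict)
    qed
    also have "\<dots> = (\<integral>\<^sup>+w. \<integral>\<^sup>+s. ?g (w(j := s)) \<partial>nu \<partial>nu_n I)"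
    proof (rule nu_n.product_nn_integral_insert)
      have "(\<lambda>p. conv_on I f (x(j := snd p)) (restrict (fst p) I)) \<in> borel_measurable (nu_n (insert j I) \<Otimes>\<^sub>M lborel)"
        by (rule measurable_conv_on[OF _ xj]) measurable
      then have "(\<lambda>p. conv_on I f (x(j := snd p)) (restrict (fst p) I) * phi_dil (\<alpha> j) (fst p j) (x j - snd p)) \<in> borel_measurable (nu_n (insert j I) \<Otimes>\<^sub>M lborel)"
        by measurable
      then have "(\<lambda>t. LINT u|lborel. conv_on I f (x(j := u)) (restrict t I) * phi_dil (\<alpha> j) (t j) (x j - u)) \<in> borel_measurable (nu_n (insert j I))"
        by (intro lborel.borel_measurable_lebesgue_integral) (simp add: case_prod_beta)
      then show "?g \<in> borel_measurable (nu_n (insert j I))" by measurable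
    qed (use j in auto)
    also have "\<dots> = (\<integral>\<^sup>+w. \<integral>\<^sup>+t. ennreal ((LINT u|lborel. conv_on I f (x(j := u)) w * phi_dil (\<alpha> j) t (x j - u))\<^sup>2) \<partial>nu \<partial>nu_n I)"
    proof (intro nn_integral_cong)
      fix w s assume w: "w \<in> space (nu_n I :: ('n \<Rightarrow> real) measure)"
      have "restrict (w(j := s)) I = w" using w j by (auto simp: space_PiM PiE_def extensional_def fun_eq_iff)
      then show "?g (w(j := s)) = ennreal ((LINT u|lborel. conv_on I f (x(j := u)) w * phi_dil (\<alpha> j) s (x j - u))\<^sup>2)"
        by (simp only: fun_upd_same)
    qed
    finally show "square_on (insert j I) f x = (\<integral>\<^sup>+w. \<integral>\<^sup>+t. ennreal ((LINT u|lborel. conv_on I f (x(j := u)) w * phi_dil (\<alpha> j) t (x j - u))\<^sup>2) \<partial>nu \<partial>nu_n I)" .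
  qed
qed

lemma weak_type_step:
  assumes j: "j \<notin> I"
  shows "\<exists>C>0. \<forall>f. integrable (lborel_n UNIV) f \<longrightarrow>
    emeasure (lborel_n UNIV) {x\<in>space (lborel_n UNIV). 1 < square_on (insert j I) f x} \<le>
      ennreal C * (\<integral>\<^sup>+x. Psi (square_on I f x) \<partial>lborel_n UNIV)"
proof -
  obtain C where C: "C > 0" "\<And>(N :: ('n \<Rightarrow> real) measure) F. sigma_finite_measure N \<Longrightarrow>
    (\<lambda>(x, w). F x w) \<in> borel_measurable (lborel \<Otimes>\<^sub>M N) \<Longrightarrow>
    (AE w in N. integrable lborel (\<lambda>x. F x w)) \<Longrightarrow>
    emeasure lborel {x. 1 < (\<integral>\<^sup>+w. \<integral>\<^sup>+t. ennreal ((LINT y|lborel. F y w * phi_dil (\<alpha> j) t (x - y))\<^sup>2) \<partial>nu \<partial>N)}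
      \<le> ennreal C * (\<integral>\<^sup>+x. Psi (\<integral>\<^sup>+w. ennreal ((F x w)\<^sup>2) \<partial>N) \<partial>lborel)"
    using weak_type_1D[OF \<alpha>[of j], where ?'w = "'n \<Rightarrow> real"] by blast
  show ?thesis
  proof (intro exI[of _ C] conjI allI impI C(1))
    fix f :: "('n \<Rightarrow> real) \<Rightarrow> real" assume f: "integrable (lborel_n UNIV) f"
    note [measurable] = borel_measurable_integrable[OF f]
    let ?X = "lborel_n UNIV :: ('n \<Rightarrow> real) measure" and ?X' = "lborel_n (UNIV - {j}) :: ('n \<Rightarrow> real) measure"
      and ?N = "nu_n I :: ('n \<Rightarrow> real) measure"
    interpret N: sigma_finite_measure ?N by (rule sigma_finite_nu_n)
    interpret nu: sigma_finite_measure nu by (rule sigma_finite_nu)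
    \<comment> \<open>The evaluation point \<open>v\<close> is separated from \<open>x\<close>, so
      \<open>R v x\<close> does not depend on \<open>x j\<close>: on a line in direction
      \<open>j\<close> only \<open>v\<close> varies.\<close>
    define R where "R v x = (\<integral>\<^sup>+w. \<integral>\<^sup>+t. ennreal ((LINT u|lborel. conv_on I f (x(j := u)) w * phi_dil (\<alpha> j) t (v - u))\<^sup>2) \<partial>nu \<partial>nu_n I)" for v x
    have [measurable]: "(\<lambda>x. x j) \<in> borel_measurable ?X"
      by (rule measurable_component_lborel_n[where g = "\<lambda>x. x" and I = UNIV]) auto
    have R_meas [measurable]: "(\<lambda>x. R (x j) x) \<in> borel_measurable ?X" unfolding R_def by measurable
    have AE: "AE x in ?X. square_on (insert j I) f x = R (x j) x"
      unfolding R_def by (rule square_on_insert_AE[OF j f])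
    have "emeasure ?X {x\<in>space ?X. 1 < square_on (insert j I) f x} = emeasure ?X {x\<in>space ?X. 1 < R (x j) x}"
      using AE by (intro emeasure_eq_AE) auto
    also have "\<dots> = (\<integral>\<^sup>+x. indicator {x\<in>space ?X. 1 < R (x j) x} x \<partial>?X)"
      by (intro nn_integral_indicator[symmetric]) measurable
    also have "\<dots> = (\<integral>\<^sup>+x. \<integral>\<^sup>+v. indicator {x\<in>space ?X. 1 < R (x j) x} (x(j := v)) \<partial>lborel \<partial>?X')"
      by (intro nn_integral_lborel_n_split) measurable
    also have "\<dots> \<le> (\<integral>\<^sup>+x. ennreal C * (\<integral>\<^sup>+u. Psi (square_on I f (x(j := u))) \<partial>lborel) \<partial>?X')"
    proof (rule nn_integral_mono_AE)
      interpret P: pair_sigma_finite ?X' ?N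
        by (simp add: pair_sigma_finite_def sigma_finite_lborel_n sigma_finite_nu_n)
      have "AE x in ?X'. AE w in ?N. (\<integral>\<^sup>+u. abs_conv_on I f (x(j := u)) w \<partial>lborel) < \<infinity>"
      proof (subst P.AE_commute)
        have "(\<lambda>q. (fst (fst q))(j := snd q)) \<in> (?X' \<Otimes>\<^sub>M ?N) \<Otimes>\<^sub>M lborel \<rightarrow>\<^sub>M ?X"
          by (rule measurable_fun_upd_lborel_n_remove) measurable
        then have "(\<lambda>q. abs_conv_on I f ((fst (fst q))(j := snd q)) (snd (fst q))) \<in> borel_measurable ((?X' \<Otimes>\<^sub>M ?N) \<Otimes>\<^sub>M lborel)"
          by (rule measurable_abs_conv_on[OF borel_measurable_integrable[OF f]]) measurable
        then have "(\<lambda>p. \<integral>\<^sup>+u. abs_conv_on I f ((fst p)(j := u)) (snd p) \<partial>lborel) \<in> borel_measurable (?X' \<Otimes>\<^sub>M ?N)"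
          by (intro lborel.borel_measurable_nn_integral) (simp add: case_prod_beta)
        then show "{p \<in> space (?X' \<Otimes>\<^sub>M ?N). (\<integral>\<^sup>+u. abs_conv_on I f ((fst p)(j := u)) (snd p) \<partial>lborel) < \<infinity>} \<in> sets (?X' \<Otimes>\<^sub>M ?N)"
          by measurable
        show "AE w in ?N. AE x in ?X'. (\<integral>\<^sup>+u. abs_conv_on I f (x(j := u)) w \<partial>lborel) < \<infinity>"
        proof (rule AE_I2)
          fix w assume [measurable]: "w \<in> space ?N"
          have "(\<integral>\<^sup>+x. \<integral>\<^sup>+u. abs_conv_on I f (x(j := u)) w \<partial>lborel \<partial>?X') = (\<integral>\<^sup>+x. abs_conv_on I f x w \<partial>?X)"
            by (intro nn_integral_lborel_n_split[symmetric]) measurable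
          also have "\<dots> < \<infinity>" by (rule abs_conv_on_finite[OF f])
          finally have "AE x in ?X'. (\<integral>\<^sup>+u. abs_conv_on I f (x(j := u)) w \<partial>lborel) \<noteq> \<infinity>"
            by (intro nn_integral_PInf_AE) auto
          then show "AE x in ?X'. (\<integral>\<^sup>+u. abs_conv_on I f (x(j := u)) w \<partial>lborel) < \<infinity>"
            by (simp add: top.not_eq_extremum)
        qed
      qed
      then show "AE x in ?X'. (\<integral>\<^sup>+v. indicator {x\<in>space ?X. 1 < R (x j) x} (x(j := v)) \<partial>lborel) \<le> ennreal C * (\<integral>\<^sup>+u. Psi (square_on I f (x(j := u))) \<partial>lborel)"
      proof (rule AE_mp, intro AE_I2 impI)
        fix x assume x [measurable]: "x \<in> space ?X'" and fin: "AE w in ?N. (\<integral>\<^sup>+u. abs_conv_on I f (x(j := u)) w \<partial>lborel) < \<infinity>"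
        have xu [measurable]: "(\<lambda>u. x(j := u)) \<in> borel \<rightarrow>\<^sub>M ?X"
          by (rule measurable_fun_upd_lborel_n_remove[OF measurable_const[OF x]]) measurable
        have "(\<lambda>v. R v x) \<in> borel_measurable lborel"
        proof -
          have "(\<lambda>v. R ((x(j := v)) j) (x(j := v))) \<in> borel_measurable borel"
            by (rule measurable_compose[OF xu R_meas])
          then show ?thesis by (simp add: R_def)
        qed
        then have [measurable]: "(\<lambda>v. R v x) \<in> borel_measurable borel" by simp
        have "(\<integral>\<^sup>+v. indicator {x\<in>space ?X. 1 < R (x j) x} (x(j := v)) \<partial>lborel) = (\<integral>\<^sup>+v. indicator {v. 1 < R v x} v \<partial>lborel)"
          by (intro nn_integral_cong) (auto simp: indicator_def R_def space_PiM)
        also have "\<dots> = emeasure lborel {v. 1 < R v x}"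
          by (intro nn_integral_indicator) measurable
        also have "\<dots> \<le> ennreal C * (\<integral>\<^sup>+u. Psi (\<integral>\<^sup>+w. ennreal ((conv_on I f (x(j := u)) w)\<^sup>2) \<partial>?N) \<partial>lborel)"
          unfolding R_def
        proof (rule C(2)[OF sigma_finite_nu_n])
          have xj: "(\<lambda>p. x(j := fst p)) \<in> lborel \<Otimes>\<^sub>M ?N \<rightarrow>\<^sub>M ?X"
            by (rule measurable_fun_upd_lborel_n_remove[OF measurable_const[OF x]]) measurable
          show "(\<lambda>(u, w). conv_on I f (x(j := u)) w) \<in> borel_measurable (lborel \<Otimes>\<^sub>M ?N)"
            unfolding case_prod_beta by (rule measurable_conv_on[OF _ xj]) measurable
          show "AE w in ?N. integrable lborel (\<lambda>u. conv_on I f (x(j := u)) w)"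
          proof (rule AE_mp[OF fin], intro AE_I2 impI integrableI_bounded)
            fix w assume w: "w \<in> space ?N" and lt: "(\<integral>\<^sup>+u. abs_conv_on I f (x(j := u)) w \<partial>lborel) < \<infinity>"
            show "(\<lambda>u. conv_on I f (x(j := u)) w) \<in> borel_measurable lborel"
              by (rule measurable_conv_on[OF borel_measurable_integrable[OF f] _ measurable_const]) (use xu w in simp_all)
            have "(\<integral>\<^sup>+u. ennreal (norm (conv_on I f (x(j := u)) w)) \<partial>lborel) \<le> (\<integral>\<^sup>+u. abs_conv_on I f (x(j := u)) w \<partial>lborel)"
              by (intro nn_integral_mono) (simp add: abs_conv_on_upper_bound)
            with lt show "(\<integral>\<^sup>+u. ennreal (norm (conv_on I f (x(j := u)) w)) \<partial>lborel) < \<infinity>" by simp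
          qed
        qed
        finally show "(\<integral>\<^sup>+v. indicator {x\<in>space ?X. 1 < R (x j) x} (x(j := v)) \<partial>lborel) \<le> ennreal C * (\<integral>\<^sup>+u. Psi (square_on I f (x(j := u))) \<partial>lborel)"
          by (simp add: square_on_def)
      qed
    qed
    also have "\<dots> = ennreal C * (\<integral>\<^sup>+x. \<integral>\<^sup>+u. Psi (square_on I f (x(j := u))) \<partial>lborel \<partial>?X')"
    proof (rule nn_integral_cmult)
      have "(\<lambda>p. (fst p)(j := snd p)) \<in> ?X' \<Otimes>\<^sub>M lborel \<rightarrow>\<^sub>M ?X"
        by (rule measurable_fun_upd_lborel_n_remove) measurable
      moreover have "(\<lambda>x. Psi (square_on I f x)) \<in> borel_measurable ?X" by measurable
      ultimately have "(\<lambda>p. Psi (square_on I f ((fst p)(j := snd p)))) \<in> borel_measurable (?X' \<Otimes>\<^sub>M lborel)"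
        by (rule measurable_compose)
      then show "(\<lambda>x. \<integral>\<^sup>+u. Psi (square_on I f (x(j := u))) \<partial>lborel) \<in> borel_measurable ?X'"
        by (intro lborel.borel_measurable_nn_integral) (simp add: case_prod_beta)
    qed
    also have "(\<integral>\<^sup>+x. \<integral>\<^sup>+u. Psi (square_on I f (x(j := u))) \<partial>lborel \<partial>?X') = (\<integral>\<^sup>+x. Psi (square_on I f x) \<partial>?X)"
      by (intro nn_integral_lborel_n_split[symmetric]) measurable
    finally show "emeasure ?X {x\<in>space ?X. 1 < square_on (insert j I) f x} \<le> ennreal C * (\<integral>\<^sup>+x. Psi (square_on I f x) \<partial>?X)" .
  qed
qed

text \<open>By homogeneity the level set at height \<open>s\<close> for \<open>f\<close> is the one
  at height 1 for \<open>f / s\<close>, to which the weak type step and the induction hypothesis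
  apply. Integrating over the layers \<open>s\<close> raises the power of the logarithm by
  one.\<close>

lemma nn_integral_Psi_square_on:
  "\<exists>C>0. \<forall>f. integrable (lborel_n UNIV) f \<longrightarrow>
    (\<integral>\<^sup>+x. Psi (square_on I f x) \<partial>lborel_n UNIV) \<le> ennreal C * (\<integral>\<^sup>+x. ennreal (Psi_log (card I) \<bar>f x\<bar>) \<partial>lborel_n UNIV)"
  using finite[of I]
proof (induction I)
  case empty
  have "square_on {} f x = ennreal ((f x)\<^sup>2)" for f x
    by (simp add: square_on_def conv_on_def splice_on_def PiM_empty nn_integral_count_space_finite lebesgue_integral_count_space_finite)
  then have "(\<integral>\<^sup>+x. Psi (square_on {} f x) \<partial>lborel_n UNIV) \<le> ennreal 1 * (\<integral>\<^sup>+x. ennreal (Psi_log (card {}) \<bar>f x\<bar>) \<partial>lborel_n UNIV)" for f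
    by (auto intro!: nn_integral_mono Psi_power2_le)
  then show ?case by (intro exI[of _ 1]) auto
next
  case (insert j I)
  let ?X = "lborel_n UNIV :: ('n \<Rightarrow> real) measure"
  obtain C1 where C1: "C1 > 0" "\<And>f. integrable ?X f \<Longrightarrow>
    (\<integral>\<^sup>+x. Psi (square_on I f x) \<partial>?X) \<le> ennreal C1 * (\<integral>\<^sup>+x. ennreal (Psi_log (card I) \<bar>f x\<bar>) \<partial>?X)"
    using insert.IH by blast
  obtain C2 where C2: "C2 > 0" "\<And>f. integrable ?X f \<Longrightarrow>
    emeasure ?X {x\<in>space ?X. 1 < square_on (insert j I) f x} \<le> ennreal C2 * (\<integral>\<^sup>+x. Psi (square_on I f x) \<partial>?X)"
    using weak_type_step[OF insert.hyps(2)] by blast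
  obtain C3 where C3: "C3 > 0" "\<And>u. u \<ge> 0 \<Longrightarrow> (\<integral>\<^sup>+s. ennreal (layer_weight s) * ennreal (Psi_log (card I) (u / s)) \<partial>lborel) \<le> ennreal (C3 * Psi_log (Suc (card I)) u)"
    using nn_integral_layer_Psi_log[of "card I"] by blast
  show ?case
  proof (intro exI[of _ "2 * (C2 * C1 * C3)"] conjI allI impI)
    show "0 < 2 * (C2 * C1 * C3)" using C1 C2 C3 by simp
    fix f :: "('n \<Rightarrow> real) \<Rightarrow> real" assume f: "integrable ?X f"
    note [measurable] = borel_measurable_integrable[OF f]
    interpret X: sigma_finite_measure ?X by (rule sigma_finite_lborel_n)
    have "(\<integral>\<^sup>+x. Psi (square_on (insert j I) f x) \<partial>?X) \<le>
      2 * (\<integral>\<^sup>+s. ennreal (layer_weight s) * emeasure ?X {x\<in>space ?X. ennreal (s\<^sup>2) < square_on (insert j I) f x} \<partial>lborel)"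
      by (intro nn_integral_Psi_le_layer sigma_finite_lborel_n) measurable
    also have "\<dots> \<le> 2 * (\<integral>\<^sup>+s. ennreal (C2 * C1) * (\<integral>\<^sup>+x. ennreal (layer_weight s) * ennreal (Psi_log (card I) (\<bar>f x\<bar> / s)) \<partial>?X) \<partial>lborel)"
    proof (intro mult_left_mono nn_integral_mono)
      fix s :: real
      show "ennreal (layer_weight s) * emeasure ?X {x\<in>space ?X. ennreal (s\<^sup>2) < square_on (insert j I) f x} \<le>
        ennreal (C2 * C1) * (\<integral>\<^sup>+x. ennreal (layer_weight s) * ennreal (Psi_log (card I) (\<bar>f x\<bar> / s)) \<partial>?X)"
      proof (cases "s > 0")
        case s: True
        have fs: "integrable ?X (\<lambda>x. f x / s)" using f by simp
        have iff: "ennreal (s\<^sup>2) < q \<longleftrightarrow> 1 < q * ennreal (1 / s\<^sup>2)" for q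
        proof (cases q)
          case (real r)
          have "q * ennreal (1 / s\<^sup>2) = ennreal (r / s\<^sup>2)" using real by (simp flip: ennreal_mult)
          moreover have "1 < ennreal (r / s\<^sup>2) \<longleftrightarrow> 1 < r / s\<^sup>2"
            using ennreal_less_iff[of 1 "r / s\<^sup>2"] by simp
          moreover have "ennreal (s\<^sup>2) < q \<longleftrightarrow> s\<^sup>2 < r" using real by (simp add: ennreal_less_iff)
          ultimately show ?thesis using s by (simp add: less_divide_eq)
        next
          case top
          then show ?thesis using s by (simp add: ennreal_top_mult)
        qed
        have "ennreal (s\<^sup>2) < square_on (insert j I) f x \<longleftrightarrow> 1 < square_on (insert j I) (\<lambda>x. f x / s) x" if "x \<in> space ?X" for x
          unfolding iff square_on_scale[OF borel_measurable_integrable[OF f] s that] ..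
        then have "{x\<in>space ?X. ennreal (s\<^sup>2) < square_on (insert j I) f x} = {x\<in>space ?X. 1 < square_on (insert j I) (\<lambda>x. f x / s) x}"
          by (intro Collect_cong conj_cong refl) simp
        then have "emeasure ?X {x\<in>space ?X. ennreal (s\<^sup>2) < square_on (insert j I) f x} \<le> ennreal C2 * (\<integral>\<^sup>+x. Psi (square_on I (\<lambda>x. f x / s) x) \<partial>?X)"
          using C2(2)[OF fs] by simp
        also have "\<dots> \<le> ennreal C2 * (ennreal C1 * (\<integral>\<^sup>+x. ennreal (Psi_log (card I) \<bar>f x / s\<bar>) \<partial>?X))"
          by (intro mult_left_mono C1(2) fs) simp
        also have "\<dots> = ennreal (C2 * C1) * (\<integral>\<^sup>+x. ennreal (Psi_log (card I) (\<bar>f x\<bar> / s)) \<partial>?X)"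
          using C1 C2 s by (simp add: ennreal_mult mult.assoc)
        finally have "ennreal (layer_weight s) * emeasure ?X {x\<in>space ?X. ennreal (s\<^sup>2) < square_on (insert j I) f x} \<le>
          ennreal (layer_weight s) * (ennreal (C2 * C1) * (\<integral>\<^sup>+x. ennreal (Psi_log (card I) (\<bar>f x\<bar> / s)) \<partial>?X))"
          by (rule mult_left_mono) simp
        also have "\<dots> = ennreal (C2 * C1) * (\<integral>\<^sup>+x. ennreal (layer_weight s) * ennreal (Psi_log (card I) (\<bar>f x\<bar> / s)) \<partial>?X)"
          by (subst nn_integral_cmult) (auto simp: mult_ac)
        finally show ?thesis .
      qed (simp add: layer_weight_def)
    qed simp
    also have "(\<integral>\<^sup>+s. ennreal (C2 * C1) * (\<integral>\<^sup>+x. ennreal (layer_weight s) * ennreal (Psi_log (card I) (\<bar>f x\<bar> / s)) \<partial>?X) \<partial>lborel) =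
      ennreal (C2 * C1) * (\<integral>\<^sup>+s. \<integral>\<^sup>+x. ennreal (layer_weight s) * ennreal (Psi_log (card I) (\<bar>f x\<bar> / s)) \<partial>?X \<partial>lborel)"
      by (intro nn_integral_cmult) measurable
    also have "(\<integral>\<^sup>+s. \<integral>\<^sup>+x. ennreal (layer_weight s) * ennreal (Psi_log (card I) (\<bar>f x\<bar> / s)) \<partial>?X \<partial>lborel) =
      (\<integral>\<^sup>+x. \<integral>\<^sup>+s. ennreal (layer_weight s) * ennreal (Psi_log (card I) (\<bar>f x\<bar> / s)) \<partial>lborel \<partial>?X)"
      by (intro nn_integral_swap lborel.sigma_finite_measure_axioms sigma_finite_lborel_n) measurable
    also have "\<dots> \<le> (\<integral>\<^sup>+x. ennreal C3 * ennreal (Psi_log (Suc (card I)) \<bar>f x\<bar>) \<partial>?X)"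
      using C3 by (intro nn_integral_mono) (simp add: Psi_log_nonneg flip: ennreal_mult)
    also have "\<dots> = ennreal C3 * (\<integral>\<^sup>+x. ennreal (Psi_log (card (insert j I)) \<bar>f x\<bar>) \<partial>?X)"
      using insert.hyps by (subst nn_integral_cmult) auto
    finally have "(\<integral>\<^sup>+x. Psi (square_on (insert j I) f x) \<partial>?X) \<le> 2 * (ennreal (C2 * C1) * (ennreal C3 * (\<integral>\<^sup>+x. ennreal (Psi_log (card (insert j I)) \<bar>f x\<bar>) \<partial>?X)))"
      by (simp add: mult_left_mono)
    also have "\<dots> = ennreal (2 * (C2 * C1 * C3)) * (\<integral>\<^sup>+x. ennreal (Psi_log (card (insert j I)) \<bar>f x\<bar>) \<partial>?X)"
      using C1 C2 C3 by (simp add: ennreal_mult mult.assoc)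
    finally show "(\<integral>\<^sup>+x. Psi (square_on (insert j I) f x) \<partial>?X) \<le> ennreal (2 * (C2 * C1 * C3)) * (\<integral>\<^sup>+x. ennreal (Psi_log (card (insert j I)) \<bar>f x\<bar>) \<partial>?X)" .
  qed
qed

text \<open>One variable \<open>j\<close> is set aside: the remaining \<open>n - 1\<close> are
  integrated with the gauge and cost one logarithm each, while for \<open>j\<close> the level set at
  height 1 is estimated directly. For \<open>n = 1\<close> the set \<open>I\<close> is empty and no
  logarithm occurs.\<close>

lemma weak_type_product:
  "\<exists>C>0. \<forall>f. integrable (lborel_n UNIV) f \<longrightarrow>
    emeasure (lborel_n UNIV) {x\<in>space (lborel_n UNIV). 1 < square_on UNIV f x} \<le>
      ennreal C * (\<integral>\<^sup>+x. ennreal (\<bar>f x\<bar> * ln (2 + \<bar>f x\<bar>) ^ (CARD('n) - 1)) \<partial>lborel_n UNIV)"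
proof -
  let ?X = "lborel_n UNIV :: ('n \<Rightarrow> real) measure"
  obtain j :: 'n where True by simp
  define I where "I = UNIV - {j}"
  define k where "k = CARD('n) - 1"
  have I: "insert j I = UNIV" "j \<notin> I" "card I = k" by (auto simp: I_def k_def card_Diff_singleton)
  obtain C1 where C1: "C1 > 0" "\<And>f. integrable ?X f \<Longrightarrow>
    (\<integral>\<^sup>+x. Psi (square_on I f x) \<partial>?X) \<le> ennreal C1 * (\<integral>\<^sup>+x. ennreal (Psi_log k \<bar>f x\<bar>) \<partial>?X)"
    using nn_integral_Psi_square_on[of I] unfolding I(3) by blast
  obtain C2 where C2: "C2 > 0" "\<And>f. integrable ?X f \<Longrightarrow>
    emeasure ?X {x\<in>space ?X. 1 < square_on UNIV f x} \<le> ennreal C2 * (\<integral>\<^sup>+x. Psi (square_on I f x) \<partial>?X)"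
    using weak_type_step[OF I(2)] unfolding I(1) by blast
  show ?thesis
  proof (intro exI[of _ "C2 * (C1 * 2 ^ k)"] conjI allI impI)
    show "0 < C2 * (C1 * 2 ^ k)" using C1 C2 by simp
    fix f :: "('n \<Rightarrow> real) \<Rightarrow> real" assume f: "integrable ?X f"
    note [measurable] = borel_measurable_integrable[OF f]
    have "emeasure ?X {x\<in>space ?X. 1 < square_on UNIV f x} \<le> ennreal C2 * (ennreal C1 * (\<integral>\<^sup>+x. ennreal (Psi_log k \<bar>f x\<bar>) \<partial>?X))"
      by (intro order_trans[OF C2(2)[OF f]] mult_left_mono C1(2) f) simp
    also have "\<dots> \<le> ennreal C2 * (ennreal C1 * (\<integral>\<^sup>+x. ennreal (2 ^ k) * ennreal (\<bar>f x\<bar> * ln (2 + \<bar>f x\<bar>) ^ k) \<partial>?X))"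
      by (intro mult_left_mono nn_integral_mono) (auto simp: Psi_log_le ennreal_leI simp flip: ennreal_mult)
    also have "(\<integral>\<^sup>+x. ennreal (2 ^ k) * ennreal (\<bar>f x\<bar> * ln (2 + \<bar>f x\<bar>) ^ k) \<partial>?X) = ennreal (2 ^ k) * (\<integral>\<^sup>+x. ennreal (\<bar>f x\<bar> * ln (2 + \<bar>f x\<bar>) ^ k) \<partial>?X)"
      by (intro nn_integral_cmult) measurable
    also have "ennreal C2 * (ennreal C1 * (ennreal (2 ^ k) * (\<integral>\<^sup>+x. ennreal (\<bar>f x\<bar> * ln (2 + \<bar>f x\<bar>) ^ k) \<partial>?X))) =
      ennreal (C2 * (C1 * 2 ^ k)) * (\<integral>\<^sup>+x. ennreal (\<bar>f x\<bar> * ln (2 + \<bar>f x\<bar>) ^ k) \<partial>?X)"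
      using C1 C2 by (simp add: ennreal_mult mult.assoc)
    finally show "emeasure ?X {x\<in>space ?X. 1 < square_on UNIV f x} \<le>
      ennreal (C2 * (C1 * 2 ^ k)) * (\<integral>\<^sup>+x. ennreal (\<bar>f x\<bar> * ln (2 + \<bar>f x\<bar>) ^ (CARD('n) - 1)) \<partial>?X)" by (simp add: k_def)
  qed
qed

end

section \<open>Transfer to Euclidean space\<close>

definition vec_of :: "('n \<Rightarrow> real) \<Rightarrow> real ^ 'n" where
  "vec_of x = (\<chi> i. x i)"

lemma measurable_vec_nth_real [measurable]: "(\<lambda>x :: real ^ 'n. x $ i) \<in> borel_measurable borel"
  by (intro borel_measurable_continuous_onI continuous_intros)

lemma measurable_vec_of [measurable]: "vec_of \<in> lborel_n (UNIV :: 'n::finite set) \<rightarrow>\<^sub>M borel"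
proof (subst borel_measurable_euclidean_space, rule ballI)
  fix b :: "real ^ 'n" assume "b \<in> Basis"
  then obtain i where b: "b = axis i 1" by (auto simp: Basis_vec_def)
  show "(\<lambda>x. vec_of x \<bullet> b) \<in> borel_measurable (lborel_n UNIV)"
    using measurable_component_lborel_n[where g = "\<lambda>x. x" and I = UNIV and i = i]
    by (simp add: b inner_axis vec_of_def)
qed

lemma lborel_eq_distr_vec_of: "(lborel :: (real ^ 'n) measure) = distr (lborel_n UNIV) borel vec_of"
proof (rule lborel_eqI)
  fix l u :: "real ^ 'n" assume lu: "\<And>b. b \<in> Basis \<Longrightarrow> l \<bullet> b \<le> u \<bullet> b"
  have le: "l $ i \<le> u $ i" for i using lu[of "axis i 1"] by (simp add: inner_axis axis_in_Basis_iff)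
  have B: "(Basis :: (real ^ 'n) set) = (\<lambda>i. axis i 1) ` UNIV" by (auto simp: Basis_vec_def)
  have "vec_of -` box l u \<inter> space (lborel_n UNIV) = (\<Pi>\<^sub>E i\<in>UNIV. {l $ i<..<u $ i})"
    by (auto simp: vec_of_def mem_box_cart space_PiM PiE_iff)
  then have "emeasure (distr (lborel_n UNIV) borel vec_of) (box l u) = emeasure (lborel_n UNIV) (\<Pi>\<^sub>E i\<in>UNIV. {l $ i<..<u $ i})"
    by (subst emeasure_distr) auto
  also have "\<dots> = (\<Prod>i\<in>UNIV. emeasure lborel {l $ i<..<u $ i})"
    by (rule lborel_n.emeasure_PiM) auto
  also have "\<dots> = (\<Prod>i\<in>UNIV. ennreal (u $ i - l $ i))"
    using le by simp
  also have "\<dots> = ennreal (\<Prod>i\<in>UNIV. (u $ i - l $ i))"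
    using le by (intro prod_ennreal) auto
  also have "(\<Prod>i\<in>UNIV. (u $ i - l $ i)) = (\<Prod>b\<in>Basis. (u - l) \<bullet> b)"
    unfolding B by (subst prod.reindex) (auto simp: inj_on_def axis_eq_axis inner_axis)
  finally show "emeasure (distr (lborel_n UNIV) borel vec_of) (box l u) = ennreal (\<Prod>b\<in>Basis. (u - l) \<bullet> b)" by simp
qed simp

text \<open>Links the product of the measures \<open>dt / t\<close>, as used in the induction, with
  Lebesgue measure weighted by the reciprocal of the product of the \<open>t $ i\<close>. The
  variables are peeled off one by one, each with its own density.\<close>

lemma nn_integral_nu_n:
  fixes g :: "('n::finite \<Rightarrow> real) \<Rightarrow> ennreal"
  assumes "g \<in> borel_measurable (lborel_n I)"
  shows "(\<integral>\<^sup>+t. g t \<partial>nu_n I) = (\<integral>\<^sup>+t. (\<Prod>i\<in>I. ennreal (indicator {0<..} (t i) / t i)) * g t \<partial>lborel_n I)"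
  using finite[of I] assms
proof (induction I arbitrary: g)
  case empty
  then show ?case by (simp add: PiM_empty)
next
  case (insert j I)
  have sets: "sets (nu_n K) = sets (lborel_n K :: ('n \<Rightarrow> real) measure)" for K
    by (intro sets_PiM_cong) auto
  have comp: "(\<lambda>t. t i) \<in> borel_measurable (lborel_n K)" if "i \<in> K" for i :: 'n and K
    by (rule measurable_component_lborel_n[OF _ that]) simp
  let ?w = "\<lambda>s. ennreal (indicator {0<..} s / s)"
  have w: "(\<lambda>t. \<Prod>i\<in>K. ?w (t i)) \<in> borel_measurable (lborel_n K)" for K :: "'n set"
  proof (rule borel_measurable_prod_ennreal)
    fix i assume "i \<in> K"
    then have [measurable]: "(\<lambda>t. t i) \<in> borel_measurable (lborel_n K)" by (rule comp)
    show "(\<lambda>t. ?w (t i)) \<in> borel_measurable (lborel_n K)" by measurable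
  qed
  have add: "(\<lambda>(t, s). t(j := s)) \<in> lborel_n I \<Otimes>\<^sub>M lborel \<rightarrow>\<^sub>M lborel_n (insert j I)"
    by (rule measurable_add_dim)
  have gadd: "(\<lambda>(t, s). g (t(j := s))) \<in> borel_measurable (lborel_n I \<Otimes>\<^sub>M lborel)"
    using measurable_compose[OF add insert.prems] by (simp only: case_prod_beta')
  have g_sec: "(\<lambda>s. g (t(j := s))) \<in> borel_measurable borel" if "t \<in> space (lborel_n I)" for t
    using measurable_compose[OF measurable_Pair1'[OF that] gadd] by simp
  have inner: "(\<lambda>t. \<integral>\<^sup>+s. ?w s * g (t(j := s)) \<partial>lborel) \<in> borel_measurable (lborel_n I)"
  proof (rule lborel.borel_measurable_nn_integral)
    have "(\<lambda>p. ?w (snd p)) \<in> borel_measurable (lborel_n I \<Otimes>\<^sub>M lborel)" by measurable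
    from borel_measurable_times_ennreal[OF this gadd]
    show "(\<lambda>(t, s). ?w s * g (t(j := s))) \<in> borel_measurable (lborel_n I \<Otimes>\<^sub>M lborel)"
      by (simp add: case_prod_beta)
  qed
  have "(\<integral>\<^sup>+t. g t \<partial>nu_n (insert j I)) = (\<integral>\<^sup>+t. \<integral>\<^sup>+s. g (t(j := s)) \<partial>nu \<partial>nu_n I)"
    using insert.hyps insert.prems by (intro nu_n.product_nn_integral_insert) (auto simp: measurable_cong_sets[OF sets refl])
  also have "\<dots> = (\<integral>\<^sup>+t. \<integral>\<^sup>+s. ?w s * g (t(j := s)) \<partial>lborel \<partial>nu_n I)"
  proof (rule nn_integral_cong)
    fix t assume "t \<in> space (nu_n I :: ('n \<Rightarrow> real) measure)"
    then have "t \<in> space (lborel_n I)" by (simp add: space_PiM)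
    then show "(\<integral>\<^sup>+s. g (t(j := s)) \<partial>nu) = (\<integral>\<^sup>+s. ?w s * g (t(j := s)) \<partial>lborel)"
      by (intro nn_integral_nu g_sec)
  qed
  also have "\<dots> = (\<integral>\<^sup>+t. (\<Prod>i\<in>I. ?w (t i)) * (\<integral>\<^sup>+s. ?w s * g (t(j := s)) \<partial>lborel) \<partial>lborel_n I)"
    by (rule insert.IH[OF inner])
  also have "\<dots> = (\<integral>\<^sup>+t. \<integral>\<^sup>+s. (\<Prod>i\<in>I. ?w (t i)) * (?w s * g (t(j := s))) \<partial>lborel \<partial>lborel_n I)"
  proof (rule nn_integral_cong)
    fix t assume t: "t \<in> space (lborel_n I :: ('n \<Rightarrow> real) measure)"
    note [measurable] = g_sec[OF t]
    show "(\<Prod>i\<in>I. ?w (t i)) * (\<integral>\<^sup>+s. ?w s * g (t(j := s)) \<partial>lborel) = (\<integral>\<^sup>+s. (\<Prod>i\<in>I. ?w (t i)) * (?w s * g (t(j := s))) \<partial>lborel)"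
      by (intro nn_integral_cmult[symmetric]) measurable
  qed
  also have "\<dots> = (\<integral>\<^sup>+t. \<integral>\<^sup>+s. (\<Prod>i\<in>insert j I. ?w ((t(j := s)) i)) * g (t(j := s)) \<partial>lborel \<partial>lborel_n I)"
  proof (intro nn_integral_cong)
    fix t :: "'n \<Rightarrow> real" and s :: real
    have "(\<Prod>i\<in>insert j I. ?w ((t(j := s)) i)) = ?w s * (\<Prod>i\<in>I. ?w ((t(j := s)) i))"
      using insert.hyps by simp
    also have "(\<Prod>i\<in>I. ?w ((t(j := s)) i)) = (\<Prod>i\<in>I. ?w (t i))"
      using insert.hyps by (intro prod.cong) auto
    finally show "(\<Prod>i\<in>I. ?w (t i)) * (?w s * g (t(j := s))) = (\<Prod>i\<in>insert j I. ?w ((t(j := s)) i)) * g (t(j := s))"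
      by (simp add: mult_ac)
  qed
  also have "\<dots> = (\<integral>\<^sup>+t. (\<Prod>i\<in>insert j I. ?w (t i)) * g t \<partial>lborel_n (insert j I))"
    using insert.hyps by (intro lborel_n.product_nn_integral_insert[symmetric] borel_measurable_times_ennreal w insert.prems) auto
  finally show ?case .
qed

text \<open>The real Borel counterpart of \<open>S_op\<close>, with the reflection moved from the
  function to the kernel as in \<open>conv_on\<close>.\<close>

definition real_conv :: "real ^ 'n \<Rightarrow> (real ^ 'n \<Rightarrow> real) \<Rightarrow> real ^ 'n \<Rightarrow> real ^ 'n \<Rightarrow> real" where
  "real_conv \<alpha> f x t = (LINT y|lborel. f y * Phi \<alpha> t (x - y))"

definition real_square :: "real ^ 'n \<Rightarrow> (real ^ 'n \<Rightarrow> real) \<Rightarrow> real ^ 'n \<Rightarrow> ennreal" where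
  "real_square \<alpha> f x = (\<integral>\<^sup>+t\<in>{t. \<forall>i. 0 < t $ i}. ennreal ((real_conv \<alpha> f x t)\<^sup>2 / (\<Prod>i\<in>UNIV. t $ i)) \<partial>lborel)"

lemma measurable_Phi [measurable (raw)]:
  assumes [measurable]: "g \<in> borel_measurable M" "h \<in> borel_measurable M"
  shows "(\<lambda>p. Phi \<alpha> (g p) (h p)) \<in> borel_measurable M"
  unfolding Phi_def
proof (rule borel_measurable_prod)
  fix i
  have "(\<lambda>p. g p $ i) \<in> borel_measurable M" "(\<lambda>p. h p $ i) \<in> borel_measurable M"
    using measurable_compose[OF assms(1) measurable_vec_nth_real] measurable_compose[OF assms(2) measurable_vec_nth_real] by auto
  then show "(\<lambda>p. phi_dil (\<alpha> $ i) (g p $ i) (h p $ i)) \<in> borel_measurable M" by (rule measurable_phi_dil)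
qed

lemma measurable_real_conv [measurable (raw)]:
  assumes [measurable]: "f \<in> borel_measurable borel" "g \<in> borel_measurable M" "h \<in> borel_measurable M"
  shows "(\<lambda>p. real_conv \<alpha> f (g p) (h p)) \<in> borel_measurable M"
  unfolding real_conv_def by measurable

lemma sets_orthant [measurable]: "{t :: real ^ 'n. \<forall>i. 0 < t $ i} \<in> sets borel"
proof -
  have "{t :: real ^ 'n. \<forall>i. 0 < t $ i} = (\<Inter>i. {t \<in> space borel. 0 < t $ i})" by auto
  also have "\<dots> \<in> sets borel" by (intro sets.countable_INT'') (auto simp: countable_finite)
  finally show ?thesis .
qed

lemma measurable_prod_vec [measurable]: "(\<lambda>t :: real ^ 'n. \<Prod>i\<in>UNIV. t $ i) \<in> borel_measurable borel"
  by (intro borel_measurable_prod) measurable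

lemma measurable_real_square [measurable]:
  assumes [measurable]: "f \<in> borel_measurable borel"
  shows "real_square \<alpha> f \<in> borel_measurable borel"
proof -
  have "real_square \<alpha> f \<in> borel_measurable lborel"
    unfolding real_square_def by measurable
  then show ?thesis by simp
qed

lemma weak_type_real_square:
  fixes \<alpha> :: "real ^ 'n"
  assumes \<alpha>: "\<And>i. \<alpha> $ i > 1 / 2"
  shows "\<exists>C>0. \<forall>f. integrable lborel f \<longrightarrow>
    emeasure lborel {x. 1 < real_square \<alpha> f x} \<le>
      ennreal C * (\<integral>\<^sup>+x. ennreal (\<bar>f x\<bar> * ln (2 + \<bar>f x\<bar>) ^ (CARD('n) - 1)) \<partial>lborel)"
proof -
  interpret product_kernel "\<lambda>i. \<alpha> $ i" using \<alpha> by unfold_locales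
  obtain C where C: "C > 0" "\<And>f. integrable (lborel_n UNIV) f \<Longrightarrow>
    emeasure (lborel_n UNIV) {x\<in>space (lborel_n UNIV). 1 < square_on UNIV f x} \<le>
      ennreal C * (\<integral>\<^sup>+x. ennreal (\<bar>f x\<bar> * ln (2 + \<bar>f x\<bar>) ^ (CARD('n) - 1)) \<partial>lborel_n UNIV)"
    using weak_type_product by blast
  let ?X = "lborel_n UNIV :: ('n \<Rightarrow> real) measure"
  show ?thesis
  proof (intro exI[of _ C] conjI allI impI C(1))
    fix f :: "real ^ 'n \<Rightarrow> real" assume f: "integrable lborel f"
    have fb [measurable]: "f \<in> borel_measurable borel" using borel_measurable_integrable[OF f] by simp
    define f0 where "f0 = (\<lambda>x. f (vec_of x))"
    have f0: "integrable ?X f0"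
    proof -
      have "integrable (distr ?X borel vec_of) f" using f by (simp only: lborel_eq_distr_vec_of[symmetric])
      then show ?thesis unfolding f0_def by (subst (asm) integrable_distr_eq) auto
    qed
    have conv: "real_conv \<alpha> f (vec_of x) (vec_of t) = conv_on UNIV f0 x t" for x t
    proof -
      have "real_conv \<alpha> f (vec_of x) (vec_of t) = (LINT y|distr ?X borel vec_of. f y * Phi \<alpha> (vec_of t) (vec_of x - y))"
        unfolding real_conv_def by (simp only: lborel_eq_distr_vec_of[symmetric])
      also have "\<dots> = (LINT y|?X. f (vec_of y) * Phi \<alpha> (vec_of t) (vec_of x - vec_of y))"
        by (intro integral_distr) measurable
      also have "\<dots> = conv_on UNIV f0 x t"
        by (simp add: conv_on_def f0_def splice_on_def Phi_def vec_of_def)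
      finally show ?thesis .
    qed
    have conv_meas: "(\<lambda>t. ennreal ((conv_on UNIV f0 x t)\<^sup>2)) \<in> borel_measurable ?X" for x
    proof -
      have "(\<lambda>t. real_conv \<alpha> f (vec_of x) (vec_of t)) \<in> borel_measurable ?X" by measurable
      then show ?thesis unfolding conv by measurable
    qed
    have square: "real_square \<alpha> f (vec_of x) = square_on UNIV f0 x" for x
    proof -
      let ?O = "{t :: real ^ 'n. \<forall>i. 0 < t $ i}"
      have "real_square \<alpha> f (vec_of x) = (\<integral>\<^sup>+t. ennreal ((real_conv \<alpha> f (vec_of x) t)\<^sup>2 / (\<Prod>i\<in>UNIV. t $ i)) * indicator ?O t \<partial>distr ?X borel vec_of)"
        unfolding real_square_def by (simp only: lborel_eq_distr_vec_of[symmetric])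
      also have "\<dots> = (\<integral>\<^sup>+t. ennreal ((real_conv \<alpha> f (vec_of x) (vec_of t))\<^sup>2 / (\<Prod>i\<in>UNIV. vec_of t $ i)) * indicator ?O (vec_of t) \<partial>?X)"
        by (intro nn_integral_distr) measurable
      also have "\<dots> = (\<integral>\<^sup>+t. (\<Prod>i\<in>UNIV. ennreal (indicator {0<..} (t i) / t i)) * ennreal ((conv_on UNIV f0 x t)\<^sup>2) \<partial>?X)"
      proof (rule nn_integral_cong)
        fix t :: "'n \<Rightarrow> real"
        show "ennreal ((real_conv \<alpha> f (vec_of x) (vec_of t))\<^sup>2 / (\<Prod>i\<in>UNIV. vec_of t $ i)) * indicator ?O (vec_of t) =
          (\<Prod>i\<in>UNIV. ennreal (indicator {0<..} (t i) / t i)) * ennreal ((conv_on UNIV f0 x t)\<^sup>2)"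
        proof (cases "\<forall>i. 0 < t i")
          case True
          then have "(\<Prod>i\<in>UNIV. ennreal (indicator {0<..} (t i) / t i)) = (\<Prod>i\<in>UNIV. ennreal (1 / t i))"
            by (intro prod.cong) auto
          also have "\<dots> = ennreal (\<Prod>i\<in>UNIV. 1 / t i)"
            using True by (intro prod_ennreal) (auto simp: less_imp_le)
          also have "(\<Prod>i\<in>UNIV. 1 / t i) = 1 / (\<Prod>i\<in>UNIV. t i)" by (simp add: prod_dividef)
          finally have eq: "(\<Prod>i\<in>UNIV. ennreal (indicator {0<..} (t i) / t i)) = ennreal (1 / (\<Prod>i\<in>UNIV. t i))" .
          have "0 < (\<Prod>i\<in>UNIV. t i)" using True by (intro prod_pos) auto
          then show ?thesis unfolding eq conv using True by (simp add: vec_of_def flip: ennreal_mult)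
        next
          case False
          \<comment> \<open>Off the open orthant some coordinate is nonpositive and its density
            vanishes, also at 0, so both sides are 0.\<close>
          then obtain i where "\<not> 0 < t i" by blast
          then have "ennreal (indicator {0<..} (t i) / t i) = 0" by simp
          then have "(\<Prod>i\<in>UNIV. ennreal (indicator {0<..} (t i) / t i)) = 0"
            by (intro prod_zero bexI[of _ i] finite UNIV_I)
          then show ?thesis using False by (auto simp: vec_of_def simp del: ennreal_eq_0_iff)
        qed
      qed
      also have "\<dots> = square_on UNIV f0 x"
        unfolding square_on_def by (intro nn_integral_nu_n[symmetric] conv_meas)
      finally show ?thesis .
    qed
    have "emeasure lborel {x. 1 < real_square \<alpha> f x} = emeasure (distr ?X borel vec_of) {x \<in> space borel. 1 < real_square \<alpha> f x}"
      by (simp flip: lborel_eq_distr_vec_of)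
    also have "\<dots> = emeasure ?X (vec_of -` {x \<in> space borel. 1 < real_square \<alpha> f x} \<inter> space ?X)"
      by (intro emeasure_distr) measurable
    also have "vec_of -` {x \<in> space borel. 1 < real_square \<alpha> f x} \<inter> space ?X = {x\<in>space ?X. 1 < square_on UNIV f0 x}"
      by (auto simp: square)
    also have "emeasure ?X \<dots> \<le> ennreal C * (\<integral>\<^sup>+x. ennreal (\<bar>f0 x\<bar> * ln (2 + \<bar>f0 x\<bar>) ^ (CARD('n) - 1)) \<partial>?X)"
      by (rule C(2)[OF f0])
    also have "(\<integral>\<^sup>+x. ennreal (\<bar>f0 x\<bar> * ln (2 + \<bar>f0 x\<bar>) ^ (CARD('n) - 1)) \<partial>?X) =
       (\<integral>\<^sup>+x. ennreal (\<bar>f x\<bar> * ln (2 + \<bar>f x\<bar>) ^ (CARD('n) - 1)) \<partial>distr ?X borel vec_of)"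
      unfolding f0_def by (intro nn_integral_distr[symmetric]) measurable
    finally show "emeasure lborel {x. 1 < real_square \<alpha> f x} \<le>
      ennreal C * (\<integral>\<^sup>+x. ennreal (\<bar>f x\<bar> * ln (2 + \<bar>f x\<bar>) ^ (CARD('n) - 1)) \<partial>lborel)"
      by (simp only: lborel_eq_distr_vec_of[symmetric])
  qed
qed

section \<open>Reduction from complex Lebesgue measurable to real Borel functions\<close>

lemma lborel_eq_distr_reflect: "(lborel :: (real ^ 'n) measure) = distr lborel borel (\<lambda>y. x - y)"
proof -
  have "(lborel :: (real ^ 'n) measure) = density (distr lborel borel (\<lambda>y. x + (- 1) *\<^sub>R y)) (\<lambda>_. \<bar>- 1 :: real\<bar> ^ DIM(real ^ 'n))"
    by (rule lborel_affine) simp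
  then show ?thesis by (simp add: density_1)
qed

lemma measurable_lebesgue_reflect: "(\<lambda>y :: real ^ 'n. x - y) \<in> lebesgue \<rightarrow>\<^sub>M lebesgue"
proof -
  have "(\<lambda>y. x + (\<Sum>j\<in>Basis. (- 1 * (y \<bullet> j)) *\<^sub>R j)) \<in> lebesgue \<rightarrow>\<^sub>M lebesgue"
    by (rule lebesgue_affine_measurable) simp
  also have "(\<lambda>y. x + (\<Sum>j\<in>Basis. (- 1 * (y \<bullet> j)) *\<^sub>R j)) = (\<lambda>y. x - y)"
    by (simp add: sum_negf euclidean_representation)
  finally show ?thesis .
qed

text \<open>Reflection and translation preserve null sets, so changing \<open>f\<close> on a null
  set changes the integrand on a null set for each single \<open>x\<close> and \<open>t\<close>; the
  identity therefore holds everywhere, whether or not the integral converges.\<close>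

lemma S_op_eq:
  fixes \<alpha> :: "real ^ 'n"
  assumes f: "f \<in> borel_measurable lebesgue" and g [measurable]: "g \<in> borel_measurable borel" and AE: "AE x in lborel. f x = g x"
  shows "S_op \<alpha> t f x = (LINT y|lborel. g y * complex_of_real (Phi \<alpha> t (x - y)))"
proof -
  have "AE y in lborel. f (x - y) = g (x - y)"
  proof (rule AE_distrD[where M' = borel and f = "\<lambda>y. x - y"])
    show "AE y in distr lborel borel (\<lambda>y. x - y). f y = g y"
      unfolding lborel_eq_distr_reflect[of x, symmetric] by (rule AE)
  qed measurable
  then have AE': "AE y in lebesgue. f (x - y) * complex_of_real (Phi \<alpha> t y) = g (x - y) * complex_of_real (Phi \<alpha> t y)"
    by (intro AE_completion) auto
  have m: "(\<lambda>y. complex_of_real (Phi \<alpha> t y)) \<in> borel_measurable lebesgue"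
    by (rule measurable_completion) measurable
  have m2: "(\<lambda>y. g (x - y) * complex_of_real (Phi \<alpha> t y)) \<in> borel_measurable lborel"
    by measurable
  have "S_op \<alpha> t f x = (LINT y|lebesgue. g (x - y) * complex_of_real (Phi \<alpha> t y))"
    unfolding S_op_def
  proof (rule integral_cong_AE[OF _ _ AE'])
    show "(\<lambda>y. f (x - y) * complex_of_real (Phi \<alpha> t y)) \<in> borel_measurable lebesgue"
      using measurable_compose[OF measurable_lebesgue_reflect f] m by (rule borel_measurable_times)
    show "(\<lambda>y. g (x - y) * complex_of_real (Phi \<alpha> t y)) \<in> borel_measurable lebesgue"
      using m2 by (rule measurable_completion)
  qed
  also have "\<dots> = (LINT y|lborel. g (x - y) * complex_of_real (Phi \<alpha> t y))"
    using m2 by (rule integral_completion)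
  also have "\<dots> = (LINT y|distr lborel borel (\<lambda>y. x - y). g (x - y) * complex_of_real (Phi \<alpha> t y))"
    by (simp only: lborel_eq_distr_reflect[symmetric])
  also have "\<dots> = (LINT y|lborel. g (x - (x - y)) * complex_of_real (Phi \<alpha> t (x - y)))"
    by (intro integral_distr) measurable
  finally show ?thesis by simp
qed

text \<open>Only an inequality: the kernel is real, so equality holds when the complex integral
  exists; otherwise the left side is 0 by convention, whereas one of the real integrals may still
  exist.\<close>

lemma cmod_conv_power2_le:
  fixes \<alpha> :: "real ^ 'n"
  shows "(cmod (LINT y|lborel. g y * complex_of_real (Phi \<alpha> t (x - y))))\<^sup>2 \<le>
    (real_conv \<alpha> (\<lambda>y. Re (g y)) x t)\<^sup>2 + (real_conv \<alpha> (\<lambda>y. Im (g y)) x t)\<^sup>2"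
proof (cases "integrable lborel (\<lambda>y. g y * complex_of_real (Phi \<alpha> t (x - y)))")
  case True
  then show ?thesis by (simp add: cmod_power2 real_conv_def flip: integral_Re integral_Im)
qed (simp add: not_integrable_integral_eq)

lemma mu_op_power2_le:
  fixes \<alpha> :: "real ^ 'n"
  assumes f: "f \<in> borel_measurable lebesgue" and g [measurable]: "g \<in> borel_measurable borel" and AE: "AE x in lborel. f x = g x"
  shows "(mu_op \<alpha> f x)\<^sup>2 \<le> real_square \<alpha> (\<lambda>y. Re (g y)) x + real_square \<alpha> (\<lambda>y. Im (g y)) x"
    and "mu_op \<alpha> f \<in> borel_measurable borel"
proof -
  let ?O = "{t :: real ^ 'n. \<forall>i. 0 < t $ i}"
  let ?S = "\<lambda>x t. LINT y|lborel. g y * complex_of_real (Phi \<alpha> t (x - y))"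
  have S [measurable]: "(\<lambda>(x, t). ?S x t) \<in> borel_measurable (borel \<Otimes>\<^sub>M borel)" by measurable
  have eq: "mu_op \<alpha> f x = ennreal_sqrt (\<integral>\<^sup>+t. ennreal ((cmod (?S x t))\<^sup>2 / (\<Prod>i\<in>UNIV. t $ i)) * indicator ?O t \<partial>lborel)" for x
    unfolding mu_op_def S_op_eq[OF f g AE] by (simp only: nn_integral_completion)
  have "mu_op \<alpha> f \<in> borel_measurable lborel" unfolding eq[abs_def] by measurable
  then show "mu_op \<alpha> f \<in> borel_measurable borel" by simp
  have "(mu_op \<alpha> f x)\<^sup>2 = (\<integral>\<^sup>+t. ennreal ((cmod (?S x t))\<^sup>2 / (\<Prod>i\<in>UNIV. t $ i)) * indicator ?O t \<partial>lborel)"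
    unfolding eq by simp
  also have "\<dots> \<le> (\<integral>\<^sup>+t. ennreal ((real_conv \<alpha> (\<lambda>y. Re (g y)) x t)\<^sup>2 / (\<Prod>i\<in>UNIV. t $ i)) * indicator ?O t +
       ennreal ((real_conv \<alpha> (\<lambda>y. Im (g y)) x t)\<^sup>2 / (\<Prod>i\<in>UNIV. t $ i)) * indicator ?O t \<partial>lborel)"
  proof (rule nn_integral_mono)
    fix t :: "real ^ 'n"
    show "ennreal ((cmod (?S x t))\<^sup>2 / (\<Prod>i\<in>UNIV. t $ i)) * indicator ?O t \<le>
       ennreal ((real_conv \<alpha> (\<lambda>y. Re (g y)) x t)\<^sup>2 / (\<Prod>i\<in>UNIV. t $ i)) * indicator ?O t +
       ennreal ((real_conv \<alpha> (\<lambda>y. Im (g y)) x t)\<^sup>2 / (\<Prod>i\<in>UNIV. t $ i)) * indicator ?O t"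
    proof (cases "t \<in> ?O")
      case True
      then have pos: "0 < (\<Prod>i\<in>UNIV. t $ i)" by (intro prod_pos) auto
      have "(cmod (?S x t))\<^sup>2 / (\<Prod>i\<in>UNIV. t $ i) \<le>
        ((real_conv \<alpha> (\<lambda>y. Re (g y)) x t)\<^sup>2 + (real_conv \<alpha> (\<lambda>y. Im (g y)) x t)\<^sup>2) / (\<Prod>i\<in>UNIV. t $ i)"
        using pos cmod_conv_power2_le[of g \<alpha> t x] by (intro divide_right_mono) auto
      then show ?thesis using True pos
        by (simp add: add_divide_distrib ennreal_leI flip: ennreal_plus)
    qed simp
  qed
  also have "\<dots> = real_square \<alpha> (\<lambda>y. Re (g y)) x + real_square \<alpha> (\<lambda>y. Im (g y)) x"
    unfolding real_square_def by (intro nn_integral_add) measurable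
  finally show "(mu_op \<alpha> f x)\<^sup>2 \<le> real_square \<alpha> (\<lambda>y. Re (g y)) x + real_square \<alpha> (\<lambda>y. Im (g y)) x" .
qed

lemma real_square_scale:
  assumes [measurable]: "f \<in> borel_measurable borel" and s: "s \<ge> 0"
  shows "real_square \<alpha> (\<lambda>y. s * f y) x = ennreal (s\<^sup>2) * real_square \<alpha> f x"
proof -
  have "real_conv \<alpha> (\<lambda>y. s * f y) x t = s * real_conv \<alpha> f x t" for t
    by (simp add: real_conv_def mult.assoc)
  then have "real_square \<alpha> (\<lambda>y. s * f y) x = (\<integral>\<^sup>+t. ennreal (s\<^sup>2) * (ennreal ((real_conv \<alpha> f x t)\<^sup>2 / (\<Prod>i\<in>UNIV. t $ i)) * indicator {t. \<forall>i. 0 < t $ i} t) \<partial>lborel)"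
    unfolding real_square_def
    by (intro nn_integral_cong) (auto simp: indicator_def power_mult_distrib prod_nonneg less_imp_le simp flip: ennreal_mult)
  also have "\<dots> = ennreal (s\<^sup>2) * real_square \<alpha> f x"
    unfolding real_square_def by (intro nn_integral_cmult) measurable
  finally show ?thesis .
qed

text \<open>\<open>2 + v <= (2 + u)^2\<close> at most doubles the logarithm; together with
  \<open>v <= 2 * u\<close> this gives one factor 2 for each power.\<close>

lemma log_weight_scale_le:
  fixes u v :: real
  assumes "0 \<le> v" "v \<le> 2 * u"
  shows "v * ln (2 + v) ^ k \<le> 2 ^ (k + 1) * (u * ln (2 + u) ^ k)"
proof -
  have u: "0 \<le> u" using assms by simp
  have "(2 + u)\<^sup>2 = 4 + 4 * u + u * u" by (simp add: power2_eq_square algebra_simps)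
  moreover have "0 \<le> u * u" by simp
  ultimately have "2 + v \<le> (2 + u)\<^sup>2" using assms u by linarith
  then have "ln (2 + v) \<le> ln ((2 + u)\<^sup>2)" using assms by simp
  also have "\<dots> = 2 * ln (2 + u)" using u by (simp add: ln_realpow)
  finally have "ln (2 + v) ^ k \<le> (2 * ln (2 + u)) ^ k" using assms by (intro power_mono) auto
  then have "v * ln (2 + v) ^ k \<le> (2 * u) * (2 * ln (2 + u)) ^ k" using assms u by (intro mult_mono) auto
  then show ?thesis by (simp add: power_mult_distrib mult_ac)
qed

theorem theorem6:
  fixes \<alpha> :: "real ^ 'n"
  assumes "\<And>i. \<alpha> $ i > 1 / 2"
  shows "\<exists>C::real. \<forall>(f :: real ^ 'n \<Rightarrow> complex) (l::real).
    f \<in> borel_measurable lebesgue \<longrightarrow>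
    integrable lebesgue (\<lambda>x. cmod (f x) * (ln (2 + cmod (f x))) ^ (CARD('n) - 1)) \<longrightarrow>
    l > 0 \<longrightarrow>
      {x. mu_op \<alpha> f x > ennreal l} \<in> sets lebesgue \<and>
      emeasure lebesgue {x. mu_op \<alpha> f x > ennreal l}
        \<le> ennreal C * (\<integral>\<^sup>+x. ennreal (cmod (f x) / l * (ln (2 + cmod (f x) / l)) ^ (CARD('n) - 1)) \<partial>lebesgue)"
proof -
  define k where "k = CARD('n) - 1"
  obtain C where C: "C > 0" "\<And>f. integrable lborel f \<Longrightarrow>
    emeasure lborel {x. 1 < real_square \<alpha> f x} \<le> ennreal C * (\<integral>\<^sup>+x. ennreal (\<bar>f x\<bar> * ln (2 + \<bar>f x\<bar>) ^ k) \<partial>lborel)"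
    using weak_type_real_square[OF assms] unfolding k_def by blast
  show ?thesis
    unfolding k_def[symmetric]
  proof (intro exI[of _ "2 * (C * 2 ^ (k + 1))"] allI impI)
    fix f :: "real ^ 'n \<Rightarrow> complex" and l :: real
    assume f: "f \<in> borel_measurable lebesgue" and int: "integrable lebesgue (\<lambda>x. cmod (f x) * ln (2 + cmod (f x)) ^ k)" and l: "l > 0"
    have "(\<lambda>x. Re (f x)) \<in> borel_measurable lebesgue" and Im: "(\<lambda>x. Im (f x)) \<in> borel_measurable lebesgue"
      using f by measurable
    from completion_ex_borel_measurable_real[OF this(1)] completion_ex_borel_measurable_real[OF Im]
    obtain g1 g2 where g12: "g1 \<in> borel_measurable lborel" "AE x in lborel. Re (f x) = g1 x"
      "g2 \<in> borel_measurable lborel" "AE x in lborel. Im (f x) = g2 x"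
      by blast
    have [measurable]: "g1 \<in> borel_measurable borel" "g2 \<in> borel_measurable borel" using g12 by simp_all
    define g where "g x = complex_of_real (g1 x) + \<i> * complex_of_real (g2 x)" for x
    have g [measurable]: "g \<in> borel_measurable borel" unfolding g_def by measurable
    have AE: "AE x in lborel. f x = g x"
      using g12(2,4) by eventually_elim (simp add: g_def complex_eq_iff)
    define W where "W = (\<integral>\<^sup>+x. ennreal (cmod (g x) / l * ln (2 + cmod (g x) / l) ^ k) \<partial>lborel)"
    have W: "(\<integral>\<^sup>+x. ennreal (cmod (f x) / l * ln (2 + cmod (f x) / l) ^ k) \<partial>lebesgue) = W"
      unfolding nn_integral_completion W_def by (rule nn_integral_cong_AE) (use AE in eventually_elim, simp)
    \<comment> \<open>The hypothesis implies plain integrability because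
      \<open>2 * ln (2 + u) >= 1\<close>; the real estimate is stated for integrable
      functions.\<close>
    have gfin: "(\<integral>\<^sup>+x. ennreal (cmod (g x)) \<partial>lborel) < \<infinity>"
    proof -
      have ln2: "1 / 2 \<le> ln (2::real)" using ln2_ge_two_thirds by simp
      have "(\<integral>\<^sup>+x. ennreal (cmod (g x)) \<partial>lborel) = (\<integral>\<^sup>+x. ennreal (cmod (f x)) \<partial>lborel)"
        by (rule nn_integral_cong_AE) (use AE in eventually_elim, simp)
      also have "\<dots> = (\<integral>\<^sup>+x. ennreal (cmod (f x)) \<partial>lebesgue)" by (simp add: nn_integral_completion)
      also have "\<dots> \<le> (\<integral>\<^sup>+x. ennreal (norm (2 ^ k * (cmod (f x) * ln (2 + cmod (f x)) ^ k))) \<partial>lebesgue)"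
      proof (intro nn_integral_mono ennreal_leI)
        fix x
        have "ln 2 \<le> ln (2 + cmod (f x))" by (subst ln_le_cancel_iff) (auto intro: add_pos_nonneg)
        then have "1 \<le> (2 * ln (2 + cmod (f x))) ^ k" using ln2 by (intro one_le_power) linarith
        then have "cmod (f x) * 1 \<le> cmod (f x) * (2 * ln (2 + cmod (f x))) ^ k" by (intro mult_left_mono) auto
        then show "cmod (f x) \<le> norm (2 ^ k * (cmod (f x) * ln (2 + cmod (f x)) ^ k))"
          by (simp add: power_mult_distrib mult_ac abs_mult)
      qed
      also have "\<dots> < \<infinity>"
        using integrable_mult_right[OF int, of "2 ^ k"] unfolding integrable_iff_bounded by simp
      finally show ?thesis .
    qed
    \<comment> \<open>If the square function exceeds \<open>l\<close>, that of the real or of the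
      imaginary part has a square above \<open>l^2 / 2\<close>. The scaling by \<open>s\<close>
      moves this threshold to 1, and \<open>s <= 2 / l\<close> lets the weight be compared with that
      of \<open>|g| / l\<close>.\<close>
    define s where "s = sqrt 2 / l"
    have s: "s > 0" "s \<le> 2 / l" using l sqrt2_less_2 by (auto simp: s_def divide_right_mono)
    have part: "emeasure lborel {x. ennreal (l\<^sup>2 / 2) < real_square \<alpha> u x} \<le> ennreal (C * 2 ^ (k + 1)) * W"
      if [measurable]: "u \<in> borel_measurable borel" and u: "\<And>x. \<bar>u x\<bar> \<le> cmod (g x)" for u
    proof -
      have "integrable lborel u"
      proof (rule integrableI_bounded)
        have "(\<integral>\<^sup>+x. ennreal (norm (u x)) \<partial>lborel) \<le> (\<integral>\<^sup>+x. ennreal (cmod (g x)) \<partial>lborel)"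
          using u by (intro nn_integral_mono ennreal_leI) simp
        with gfin show "(\<integral>\<^sup>+x. ennreal (norm (u x)) \<partial>lborel) < \<infinity>" by simp
      qed simp
      then have su: "integrable lborel (\<lambda>x. s * u x)" by simp
      have "1 < real_square \<alpha> (\<lambda>y. s * u y) x" if "ennreal (l\<^sup>2 / 2) < real_square \<alpha> u x" for x
      proof -
        have "1 = ennreal (s\<^sup>2) * ennreal (l\<^sup>2 / 2)"
          using l by (simp add: s_def power_divide flip: ennreal_mult)
        also have "\<dots> < ennreal (s\<^sup>2) * real_square \<alpha> u x"
          using that s by (intro ennreal_mult_strict_left_mono) auto
        finally show ?thesis using s by (simp add: real_square_scale)
      qed
      then have "emeasure lborel {x. ennreal (l\<^sup>2 / 2) < real_square \<alpha> u x} \<le> emeasure lborel {x \<in> space lborel. 1 < real_square \<alpha> (\<lambda>y. s * u y) x}"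
        by (intro emeasure_mono) (auto, measurable)
      also have "\<dots> \<le> ennreal C * (\<integral>\<^sup>+x. ennreal (\<bar>s * u x\<bar> * ln (2 + \<bar>s * u x\<bar>) ^ k) \<partial>lborel)"
        using C(2)[OF su] by simp
      also have "\<dots> \<le> ennreal C * (\<integral>\<^sup>+x. ennreal (2 ^ (k + 1)) * ennreal (cmod (g x) / l * ln (2 + cmod (g x) / l) ^ k) \<partial>lborel)"
      proof (intro mult_left_mono nn_integral_mono)
        fix x
        have "\<bar>s * u x\<bar> = s * \<bar>u x\<bar>" using s by (simp add: abs_mult)
        also have "\<dots> \<le> 2 / l * cmod (g x)" using s l u by (intro mult_mono) auto
        finally have "\<bar>s * u x\<bar> \<le> 2 * (cmod (g x) / l)" by simp
        then have "\<bar>s * u x\<bar> * ln (2 + \<bar>s * u x\<bar>) ^ k \<le> 2 ^ (k + 1) * (cmod (g x) / l * ln (2 + cmod (g x) / l) ^ k)"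
          by (intro log_weight_scale_le) auto
        then have "ennreal (\<bar>s * u x\<bar> * ln (2 + \<bar>s * u x\<bar>) ^ k) \<le> ennreal (2 ^ (k + 1) * (cmod (g x) / l * ln (2 + cmod (g x) / l) ^ k))"
          by (rule ennreal_leI)
        also have "\<dots> = ennreal (2 ^ (k + 1)) * ennreal (cmod (g x) / l * ln (2 + cmod (g x) / l) ^ k)"
          using l by (intro ennreal_mult) auto
        finally show "ennreal (\<bar>s * u x\<bar> * ln (2 + \<bar>s * u x\<bar>) ^ k) \<le> \<dots>" .
      qed simp
      also have "\<dots> = ennreal C * (ennreal (2 ^ (k + 1)) * W)"
        unfolding W_def by (subst nn_integral_cmult) auto
      also have "\<dots> = ennreal (C * 2 ^ (k + 1)) * W"
        using C(1) by (subst ennreal_mult) (auto simp: mult.assoc)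
      finally show ?thesis .
    qed
    have mu_meas [measurable]: "mu_op \<alpha> f \<in> borel_measurable borel" by (rule mu_op_power2_le(2)[OF f g AE])
    have "{x \<in> space borel. ennreal l < mu_op \<alpha> f x} \<in> sets borel" by measurable
    then have set: "{x. ennreal l < mu_op \<alpha> f x} \<in> sets lborel" by simp
    have sub: "{x. ennreal l < mu_op \<alpha> f x} \<subseteq> {x. ennreal (l\<^sup>2 / 2) < real_square \<alpha> (\<lambda>y. Re (g y)) x} \<union> {x. ennreal (l\<^sup>2 / 2) < real_square \<alpha> (\<lambda>y. Im (g y)) x}"
    proof (rule subsetI, rule ccontr)
      fix x assume "x \<in> {x. ennreal l < mu_op \<alpha> f x}"
        and "x \<notin> {x. ennreal (l\<^sup>2 / 2) < real_square \<alpha> (\<lambda>y. Re (g y)) x} \<union> {x. ennreal (l\<^sup>2 / 2) < real_square \<alpha> (\<lambda>y. Im (g y)) x}"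
      then have x: "ennreal l < mu_op \<alpha> f x" "real_square \<alpha> (\<lambda>y. Re (g y)) x \<le> ennreal (l\<^sup>2 / 2)" "real_square \<alpha> (\<lambda>y. Im (g y)) x \<le> ennreal (l\<^sup>2 / 2)"
        by (simp_all add: not_less)
      have "(mu_op \<alpha> f x)\<^sup>2 \<le> ennreal (l\<^sup>2 / 2) + ennreal (l\<^sup>2 / 2)"
        by (rule order_trans[OF mu_op_power2_le(1)[OF f g AE] add_mono[OF x(2,3)]])
      also have "\<dots> = (ennreal l)\<^sup>2" using l by (simp add: ennreal_power flip: ennreal_plus)
      finally show False using x(1) by (simp add: ennreal_power2_le_iff)
    qed
    have sets: "{x. ennreal (l\<^sup>2 / 2) < real_square \<alpha> (\<lambda>y. Re (g y)) x} \<in> sets lborel" "{x. ennreal (l\<^sup>2 / 2) < real_square \<alpha> (\<lambda>y. Im (g y)) x} \<in> sets lborel"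
    proof -
      have "{x \<in> space borel. ennreal (l\<^sup>2 / 2) < real_square \<alpha> (\<lambda>y. Re (g y)) x} \<in> sets borel" by measurable
      then show "{x. ennreal (l\<^sup>2 / 2) < real_square \<alpha> (\<lambda>y. Re (g y)) x} \<in> sets lborel" by simp
      have "{x \<in> space borel. ennreal (l\<^sup>2 / 2) < real_square \<alpha> (\<lambda>y. Im (g y)) x} \<in> sets borel" by measurable
      then show "{x. ennreal (l\<^sup>2 / 2) < real_square \<alpha> (\<lambda>y. Im (g y)) x} \<in> sets lborel" by simp
    qed
    have "emeasure lebesgue {x. ennreal l < mu_op \<alpha> f x} = emeasure lborel {x. ennreal l < mu_op \<alpha> f x}"
      using nn_integral_completion[of lborel "indicator {x. ennreal l < mu_op \<alpha> f x}"] set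
      by (simp add: sets_completionI_sets)
    also have "\<dots> \<le> emeasure lborel {x. ennreal (l\<^sup>2 / 2) < real_square \<alpha> (\<lambda>y. Re (g y)) x} + emeasure lborel {x. ennreal (l\<^sup>2 / 2) < real_square \<alpha> (\<lambda>y. Im (g y)) x}"
      by (rule order_trans[OF emeasure_mono[OF sub sets.Un[OF sets]] emeasure_subadditive[OF sets]])
    also have "\<dots> \<le> ennreal (C * 2 ^ (k + 1)) * W + ennreal (C * 2 ^ (k + 1)) * W"
      by (intro add_mono part) (auto simp: abs_Re_le_cmod abs_Im_le_cmod)
    also have "\<dots> = (ennreal (C * 2 ^ (k + 1)) + ennreal (C * 2 ^ (k + 1))) * W"
      by (rule distrib_right[symmetric])
    also have "ennreal (C * 2 ^ (k + 1)) + ennreal (C * 2 ^ (k + 1)) = ennreal (2 * (C * 2 ^ (k + 1)))"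
      using C(1) by (subst ennreal_plus[symmetric]) auto
    finally show "{x. ennreal l < mu_op \<alpha> f x} \<in> sets lebesgue \<and> emeasure lebesgue {x. ennreal l < mu_op \<alpha> f x} \<le>
      ennreal (2 * (C * 2 ^ (k + 1))) * (\<integral>\<^sup>+x. ennreal (cmod (f x) / l * ln (2 + cmod (f x) / l) ^ k) \<partial>lebesgue)"
      unfolding W using sets_completionI_sets[OF set] by (rule conjI[rotated])
  qed
qed

end
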